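(* For every odd integer $k$ there is a map $\psi_k:\mathrm{SU}(3)\to\mathrm{SU}(3)$ of degree $k$ that is equivariant with respect to the cohomogeneity one action $$\mathrm{SU}(3)\times\mathrm{SU}(3)\to\mathrm{SU}(3),\qquad (A,B)\mapsto ABA^{\mathrm{T}},$$ i.e. $\psi_k(ABA^{\mathrm{T}})=A\,\psi_k(B)\,A^{\mathrm{T}}$ for all $A,B\in\mathrm{SU}(3)$.
   Context: $A^{\mathrm{T}}$ denotes the transpose (not the conjugate transpose) of $A$. *)

theory Defs
  imports "HOL-Analysis.Analysis" "HOL-Homology.Homology"
begin

definition conj_transpose :: "complex ^ 'n ^ 'm \<Rightarrow> complex ^ 'm ^ 'n" where
  "conj_transpose A = map_matrix cnj (transpose A)"

definition SU :: "(complex ^ 'n ^ 'n) set" where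
  "SU = {A. A ** conj_transpose A = mat 1 \<and> conj_transpose A ** A = mat 1 \<and> det A = 1}"

abbreviation SU3 :: "(complex ^ 3 ^ 3) set" where
  "SU3 \<equiv> SU"

(* For a closed connected orientable n-manifold X the group H_n(X; Z) is infinite cyclic, and the
   fundamental classes (one for each of the two orientations) are its generators. *)
definition fundamental_class :: "nat \<Rightarrow> 'a topology \<Rightarrow> 'a chain set \<Rightarrow> bool" where
  "fundamental_class n X \<mu> \<longleftrightarrow>
     infinite (carrier (homology_group (int n) X)) \<and>
     \<mu> \<in> carrier (homology_group (int n) X) \<and>
     subgroup_generated (homology_group (int n) X) {\<mu>} = homology_group (int n) X"

(* f_* \<mu> = d \<mu> in H_n(X; Z), whose group operation the library writes multiplicatively.
   Replacing \<mu> by the other generator (its inverse) does not change d.  The continuity requirement is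
   needed because hom_induced is the trivial map on a discontinuous f. *)
definition has_degree :: "nat \<Rightarrow> 'a topology \<Rightarrow> ('a \<Rightarrow> 'a) \<Rightarrow> int \<Rightarrow> bool" where
  "has_degree n X f d \<longleftrightarrow>
     continuous_map X X f \<and>
     (\<exists>\<mu>. fundamental_class n X \<mu> \<and>
          hom_induced (int n) X {} X {} f \<mu> = \<mu> [^]\<^bsub>homology_group (int n) X\<^esub> d)"

end

theory Submission
  imports Defs
begin

text \<open>
  For \<open>k = 2 m + 1 > 0\<close> the map is \<open>B \<mapsto> B (cnj B B)\<^sup>m\<close>, and for \<open>k < 0\<close> its transpose for \<open>- k\<close>;
  equivariance holds because \<open>A\<^sup>T (cnj A) = 1\<close>. On \<open>SU(2) = S\<^sup>3\<close>, where conjugation is homotopic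
  to the identity, it is homotopic to the \<open>k\<close>-th power map and hence has degree \<open>k\<close>, since degrees add
  under multiplication of maps into \<open>S\<^sup>3\<close>.

  To pass to \<open>SU(3)\<close>, consider \<open>E = {(w, B). B (cnj w) = w}\<close>, a bundle over \<open>S\<^sup>5\<close> with fibre
  \<open>SU(2)\<close>. The maps act fibrewise on \<open>E\<close> and agree with the map on \<open>SU(2)\<close> in a suitable
  trivialization, so they multiply \<open>H\<^sub>8(E) \<cong> \<int>\<close> by \<open>k\<close>. The projection \<open>(w, B) \<mapsto> B\<close> to
  \<open>SU(3)\<close> commutes with them and identifies, generically, only \<open>(w, B)\<close> with \<open>(- w, B)\<close>. The involution
  exchanging these points acts trivially on \<open>H\<^sub>8(E)\<close>, so the two local degrees agree, the projection
  is injective on \<open>H\<^sub>8\<close>, and the degree on \<open>SU(3)\<close> is \<open>k\<close> as well.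
\<close>

subsection \<open>Local homology and suspension\<close>

text \<open>The projection of SU(3) to the five-sphere by \<open>B *v e3\<close> is not respected by
  the maps: already for a real rotation B the vectors B e3 and B B B e3 differ. The condition
  \<open>B *v cnj_vec w = w\<close> is respected. It implies that cnj B sends w to cnj w and that
  the transpose of B also sends cnj w to w, so every alternating word in B and cnj B, and its
  transpose, satisfies it again. It also forces cnj w into the kernel of B minus its transpose, a
  line spanned by the axial vector unless B is symmetric; unit length and a reality condition leave
  just two values of w.

  The involution acts trivially because it can be compared with a circle of maps
  \<open>turn c\<close> from c = 1 to c = -1: at the end, the two differ by q \<mapsto> -q on the
  fibres, which is homotopic to the identity.

  No orientations or smooth structures enter. Local degrees live in the groups H_n(X, X - K), and a
  natural suspension isomorphism takes the place of a Kuenneth formula. The degree of the projection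
  is never computed: in an infinite cyclic group, any nontrivial class that is sent to its k-th
  power already determines the degree.\<close>

abbreviation local_homology :: "int \<Rightarrow> 'a topology \<Rightarrow> 'a set \<Rightarrow> 'a chain set monoid" where
  "local_homology p X K \<equiv> relative_homology_group p X (topspace X - K)"

abbreviation local_hom ::
  "int \<Rightarrow> 'a topology \<Rightarrow> 'a set \<Rightarrow> 'b topology \<Rightarrow> 'b set \<Rightarrow> ('a \<Rightarrow> 'b) \<Rightarrow> 'a chain set \<Rightarrow> 'b chain set" where
  "local_hom p X K Y L f \<equiv> hom_induced p X (topspace X - K) Y (topspace Y - L) f"

lemma local_hom_compose:
  assumes "continuous_map X Y f" "f \<in> (topspace X - K) \<rightarrow> (topspace Y - L)"
    and "continuous_map Y Z g" "g \<in> (topspace Y - L) \<rightarrow> (topspace Z - M)"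
  shows "local_hom p Y L Z M g (local_hom p X K Y L f c) = local_hom p X K Z M (g \<circ> f) c"
  using hom_induced_compose'[OF assms] .

lemma open_embedding_local_homology_iso:
  assumes f: "homeomorphic_map T (subtopology X (f ` topspace T)) f"
    and opn: "openin X (f ` topspace T)" and K: "K \<subseteq> topspace T" and clo: "closedin X (f ` K)"
  shows "local_hom p T K X (f ` K) f \<in> iso (local_homology p T K) (local_homology p X (f ` K))"
proof -
  let ?O = "f ` topspace T"
  let ?S = "subtopology X ?O"
  have OX: "?O \<subseteq> topspace X"
    using opn openin_subset by blast
  have inj: "inj_on f (topspace T)"
    using f homeomorphic_imp_injective_map by blast
  have cont: "continuous_map T ?S f"
    using f homeomorphic_imp_continuous_map by blast
  have im: "f ` (topspace T - K) = ?O - f ` K"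
    using inj K by (auto simp: inj_on_def)
  have 1: "hom_induced p T (topspace T - K) ?S (?O - f ` K) f
     \<in> iso (relative_homology_group p T (topspace T - K)) (relative_homology_group p ?S (?O - f ` K))"
    by (rule homeomorphic_map_relative_homology_iso[OF f]) (use im in auto)
  have exc: "X closure_of (topspace X - ?O) \<subseteq> X interior_of (topspace X - f ` K)"
  proof -
    have "closedin X (topspace X - ?O)" "openin X (topspace X - f ` K)"
      using opn clo by auto
    moreover have "topspace X - ?O \<subseteq> topspace X - f ` K"
      using K by auto
    ultimately show ?thesis
      by (simp add: closure_of_closedin interior_of_openin)
  qed
  have 2: "hom_induced p ?S (?O - f ` K) X (topspace X - f ` K) id
     \<in> iso (relative_homology_group p ?S (?O - f ` K)) (relative_homology_group p X (topspace X - f ` K))"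
  proof -
    have e1: "topspace X - (topspace X - ?O) = ?O" using OX by auto
    have e2: "topspace X - f ` K - (topspace X - ?O) = ?O - f ` K" using OX by auto
    show ?thesis
      using homology_excision_axiom[OF exc, of "topspace X" p]
      unfolding e1 e2 by simp
  qed
  have "hom_induced p T (topspace T - K) X (topspace X - f ` K) (id \<circ> f)
      = hom_induced p ?S (?O - f ` K) X (topspace X - f ` K) id
        \<circ> hom_induced p T (topspace T - K) ?S (?O - f ` K) f"
    by (rule hom_induced_compose) (use cont im OX in \<open>auto simp: continuous_map_from_subtopology\<close>)
  with iso_set_trans[OF 1 2] show ?thesis
    by simp
qed

lemma open_inclusion_local_homology_iso:
  assumes "openin X T" "K \<subseteq> T" "closedin X K"
  shows "local_hom p (subtopology X T) K X K id
    \<in> iso (local_homology p (subtopology X T) K) (local_homology p X K)"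
proof -
  have "T \<subseteq> topspace X" using assms openin_subset by blast
  then show ?thesis
    using open_embedding_local_homology_iso[of "subtopology X T" X id K p] assms
    by (simp add: inf.absorb2)
qed

text \<open>Local homology at \<open>{a} \<times> L\<close> is the homology of the product of pairs
  \<open>(V, V - a) \<times> (Y, Y - L)\<close>. Stating everything through local homology keeps the products of pairs
  implicit; the case of interest is \<open>V = \<real>\<^sup>d\<close>.\<close>

definition natural_suspension ::
  "'v topology \<Rightarrow> 'v \<Rightarrow> int \<Rightarrow> (int \<Rightarrow> 'a topology \<Rightarrow> 'a set \<Rightarrow> 'a chain set \<Rightarrow> ('v \<times> 'a) chain set) \<Rightarrow> bool"
  where "natural_suspension V a d \<sigma> \<longleftrightarrow>
    (\<forall>n Y L. closedin Y L \<longrightarrow>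
       \<sigma> n Y L \<in> iso (local_homology n Y L) (local_homology (n + d) (prod_topology V Y) ({a} \<times> L))) \<and>
    (\<forall>n Y L Y' L' f u. closedin Y L \<and> closedin Y' L' \<and> continuous_map Y Y' f \<and>
       f \<in> (topspace Y - L) \<rightarrow> (topspace Y' - L') \<and> u \<in> carrier (local_homology n Y L) \<longrightarrow>
       local_hom (n + d) (prod_topology V Y) ({a} \<times> L) (prod_topology V Y') ({a} \<times> L') (map_prod id f) (\<sigma> n Y L u)
       = \<sigma> n Y' L' (local_hom n Y L Y' L' f u))"

lemma natural_suspension_iso:
  assumes "natural_suspension V a d \<sigma>" "closedin Y L"
  shows "\<sigma> n Y L \<in> iso (local_homology n Y L) (local_homology (n + d) (prod_topology V Y) ({a} \<times> L))"
  using assms unfolding natural_suspension_def by simp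

lemma natural_suspension_natural:
  assumes "natural_suspension V a d \<sigma>" "closedin Y L" "closedin Y' L'" "continuous_map Y Y' f"
    "f \<in> (topspace Y - L) \<rightarrow> (topspace Y' - L')" "u \<in> carrier (local_homology n Y L)"
  shows "local_hom (n + d) (prod_topology V Y) ({a} \<times> L) (prod_topology V Y') ({a} \<times> L') (map_prod id f) (\<sigma> n Y L u)
       = \<sigma> n Y' L' (local_hom n Y L Y' L' f u)"
  using assms unfolding natural_suspension_def by simp

lemma closedin_halfline_times:
  assumes "closedin Y L" "closed C"
  shows "closedin (prod_topology euclidean Y) (C \<times> L)"
  using assms by (simp add: closedin_prod_Times_iff)

text \<open>The deformation pushes the line coordinate down to at most -1. Only points over L need
  care: there the complement consists of t < 0, and a convex combination of negative numbers is
  negative.\<close>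

lemma half_line_relative_trivial:
  fixes Y :: "'a topology"
  shows "trivial_group (local_homology p (prod_topology euclideanreal Y) ({0..} \<times> L))"
proof (rule trivial_relative_homology_group_alt)
  let ?X = "prod_topology euclideanreal Y"
  let ?f = "\<lambda>(t, y). (min t (-1), y)"
  show "continuous_map ?X (subtopology ?X (topspace ?X - {0..} \<times> L)) ?f"
    unfolding continuous_map_in_subtopology case_prod_unfold
    by (auto intro!: continuous_map_real_min continuous_map_fst continuous_map_snd simp: continuous_map_paired)
  show "homotopic_with (\<lambda>k. k ` (topspace ?X - {0..} \<times> L) \<subseteq> topspace ?X - {0..} \<times> L) ?X ?X ?f id"
    unfolding homotopic_with_def
  proof (intro exI[of _ "\<lambda>(s, (t, y)). ((1 - s) * min t (-1) + s * t, y)"] conjI ballI)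
    let ?D = "prod_topology (top_of_set {0..1::real}) ?X"
    have c1: "continuous_map ?D euclideanreal (\<lambda>z. fst z)"
      using continuous_map_fst continuous_map_into_fulltopology by blast
    have "continuous_map ?D ?X snd" by (rule continuous_map_snd)
    then have c2: "continuous_map ?D euclideanreal (\<lambda>z. fst (snd z))" "continuous_map ?D Y (\<lambda>z. snd (snd z))"
      unfolding continuous_map_pairwise by (auto simp: o_def)
    show "continuous_map ?D ?X (\<lambda>(s, (t, y)). ((1 - s) * min t (-1) + s * t, y))"
      unfolding case_prod_unfold continuous_map_paired
      by (intro conjI c2 continuous_map_add continuous_map_real_mult continuous_map_diff continuous_map_real_min c1)
         simp_all
  next
    fix s :: real assume s: "s \<in> {0..1}"
    have "(1 - s) * min t (-1) + s * t < 0" if "t < 0" for t :: real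
    proof -
      have "(1 - s) * min t (-1) + s * t \<le> (1 - s) * max t (-1) + s * max t (-1)"
        by (rule add_mono) (use s in \<open>auto intro: mult_left_mono\<close>)
      also have "\<dots> < 0" using that by (simp add: algebra_simps)
      finally show ?thesis .
    qed
    moreover define g where "g t = (1 - s) * min t (-1) + s * t" for t :: real
    ultimately have g: "0 \<le> t" if "0 \<le> g t" for t
      using that by (metis not_le)
    have eq: "(\<lambda>x. (\<lambda>(s, t, y). ((1 - s) * min t (-1) + s * t, y)) (s, x)) = map_prod g (id :: 'a \<Rightarrow> 'a)"
      by (auto simp: g_def)
    show "(\<lambda>x. (\<lambda>(s, t, y). ((1 - s) * min t (-1) + s * t, y)) (s, x)) ` (topspace ?X - {0..} \<times> L)
          \<subseteq> topspace ?X - {0..} \<times> L"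
      unfolding eq by (auto simp: image_subset_iff dest: g)
  qed auto
qed

text \<open>Both neighbours of the connecting map in the long exact sequence of the triple (X, S, T)
  vanish.\<close>

lemma iso_hom_relboundary_trivial:
  assumes "T \<subseteq> S" and "\<And>p. trivial_group (relative_homology_group p X T)"
  shows "hom_relboundary p X S T
         \<in> iso (relative_homology_group p X S) (relative_homology_group (p - 1) (subtopology X S) T)"
proof (rule very_short_exact_sequence)
  show "exact_seq
         ([relative_homology_group (p - 1) X T, relative_homology_group (p - 1) (subtopology X S) T, relative_homology_group p X S, relative_homology_group p X T],
          [hom_induced (p - 1) (subtopology X S) T X T id, hom_relboundary p X S T, hom_induced p X T X S id])"
    using homology_exactness_triple_1 [OF \<open>T \<subseteq> S\<close>] homology_exactness_triple_2 [OF \<open>T \<subseteq> S\<close>] by simp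
qed (use assms in auto)

text \<open>The complements of \<open>{0} \<times> L\<close> and \<open>{0..} \<times> L\<close>
  differ only where t > 0, so excision restricts this pair to the open right half. There the line
  coordinate contracts linearly to 1.\<close>

lemma slice_local_homology_iso:
  fixes Y :: "'a topology"
  assumes L: "closedin Y L"
  defines "X \<equiv> prod_topology euclideanreal Y"
  shows "hom_induced p Y (topspace Y - L) (subtopology X (topspace X - {0} \<times> L)) (topspace X - {0..} \<times> L) (Pair 1)
    \<in> iso (local_homology p Y L)
          (relative_homology_group p (subtopology X (topspace X - {0} \<times> L)) (topspace X - {0..} \<times> L))"
proof -
  let ?T = "topspace X - {0} \<times> L"
  let ?N = "topspace X - {0..} \<times> L"
  let ?O = "{0<..} \<times> topspace Y"
  let ?K = "{0<..} \<times> L"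
  let ?XT = "subtopology X ?T"
  let ?XO = "subtopology X ?O"
  have LY: "L \<subseteq> topspace Y" using L closedin_subset by blast
  have opn: "openin X ?O"
    unfolding X_def by (simp add: openin_prod_Times_iff)
  have topX: "topspace X = UNIV \<times> topspace Y" by (simp add: X_def)
  have topO: "topspace ?XO = ?O" by (auto simp: topX)
  have 1: "local_hom p Y L ?XO ?K (Pair 1) \<in> iso (local_homology p Y L) (local_homology p ?XO ?K)"
  proof (rule homotopy_equivalence_relative_homology_group_isomorphism)
    show cP: "continuous_map Y ?XO (Pair 1)"
      unfolding X_def continuous_map_in_subtopology by (auto simp: continuous_map_pairwise o_def)
    show cs: "continuous_map ?XO Y snd"
      unfolding X_def by (simp add: continuous_map_from_subtopology continuous_map_snd)
    show "Pair 1 \<in> (topspace Y - L) \<rightarrow> (topspace ?XO - ?K)" "snd \<in> (topspace ?XO - ?K) \<rightarrow> (topspace Y - L)"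
      by (auto simp: topX)
    have "(snd \<circ> Pair (1::real)) = (id :: 'a \<Rightarrow> 'a)" by auto
    then show "homotopic_with (\<lambda>h. h \<in> (topspace Y - L) \<rightarrow> topspace Y - L) Y Y (snd \<circ> Pair (1::real)) id"
      by simp
    show "homotopic_with (\<lambda>k. k \<in> (topspace ?XO - ?K) \<rightarrow> topspace ?XO - ?K) ?XO ?XO (Pair 1 \<circ> snd) id"
      unfolding homotopic_with_def
    proof (intro exI[of _ "\<lambda>(s, (t, y)). ((1 - s) + s * t, y)"] conjI ballI)
      have pos: "(1 - s) + s * t > 0" if "0 \<le> s" "s \<le> 1" "0 < t" for s t :: real
        using that by (cases "s = 0") (auto intro: add_nonneg_pos)
      let ?D = "prod_topology (top_of_set {0..1::real}) ?XO"
      have c1: "continuous_map ?D euclideanreal (\<lambda>z. fst z)"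
        using continuous_map_fst continuous_map_into_fulltopology by blast
      have "continuous_map ?D X snd"
        using continuous_map_into_fulltopology[OF continuous_map_snd] .
      then have c2: "continuous_map ?D euclideanreal (\<lambda>z. fst (snd z))" "continuous_map ?D Y (\<lambda>z. snd (snd z))"
        unfolding X_def continuous_map_pairwise by (auto simp: o_def)
      then have "continuous_map ?D X (\<lambda>(s, (t, y)). ((1 - s) + s * t, y))"
        unfolding X_def case_prod_unfold continuous_map_paired
        by (intro conjI c2 continuous_map_add continuous_map_real_mult continuous_map_diff c1[unfolded X_def]) simp_all
      then show "continuous_map ?D ?XO (\<lambda>(s, (t, y)). ((1 - s) + s * t, y))"
        using pos by (auto simp: continuous_map_in_subtopology topX)
    next
      fix s :: real assume "s \<in> {0..1}"
      then have "(1 - s) + s * t > 0" if "0 < t" for t :: real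
        using that by (cases "s = 0") (auto intro: add_nonneg_pos)
      then show "(\<lambda>x. (\<lambda>(s, t, y). ((1 - s) + s * t, y)) (s, x)) \<in> (topspace ?XO - ?K) \<rightarrow> topspace ?XO - ?K"
        by (auto simp: topX)
    qed auto
  qed
  have OT: "?O \<subseteq> ?T" by (auto simp: topX)
  have e: "subtopology ?XT ?O = ?XO"
    using OT by (simp add: subtopology_subtopology inf.absorb2)
  have eK: "topspace ?XT - ?K = ?N"
    using LY by (auto simp: topX)
  have "openin ?XT ?O"
    using opn OT by (simp add: openin_subtopology_alt) blast
  moreover have "closedin ?XT ?K"
  proof -
    have "closedin X ({0..} \<times> L)" unfolding X_def using L by (rule closedin_halfline_times) simp
    moreover have "?K = ({0..} \<times> L) \<inter> ?T" using LY by (auto simp: topX)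
    ultimately show ?thesis unfolding closedin_subtopology by blast
  qed
  ultimately have 2: "local_hom p ?XO ?K ?XT ?K id \<in> iso (local_homology p ?XO ?K) (local_homology p ?XT ?K)"
    using open_inclusion_local_homology_iso[of ?XT ?O ?K p] LY unfolding e by (auto simp: Sigma_mono)
  have "local_hom p Y L ?XT ?K (id \<circ> Pair 1) = local_hom p ?XO ?K ?XT ?K id \<circ> local_hom p Y L ?XO ?K (Pair 1)"
  proof (rule hom_induced_compose)
    show "continuous_map Y ?XO (Pair 1)"
      unfolding X_def continuous_map_in_subtopology by (auto simp: continuous_map_pairwise o_def)
    show "continuous_map ?XO ?XT id"
      using OT by (auto simp: continuous_map_in_subtopology continuous_map_from_subtopology)
  qed (auto simp: topX)
  with iso_set_trans[OF 1 2] show ?thesis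
    unfolding eK by simp
qed


lemma iso_inv_into:
  assumes "f \<in> iso G H" "x \<in> carrier H"
  shows "inv_into (carrier G) f x \<in> carrier G" "f (inv_into (carrier G) f x) = x"
  using assms by (auto simp: iso_def bij_betw_def inv_into_into f_inv_into_f)

text \<open>The class is placed on the slice at height 1 and then lifted through the connecting map
  of the triple. Taking the positive side everywhere fixes the sign once for all pairs, so
  naturality holds without a sign.\<close>

definition line_suspension :: "int \<Rightarrow> 'a topology \<Rightarrow> 'a set \<Rightarrow> 'a chain set \<Rightarrow> (real \<times> 'a) chain set" where
  "line_suspension n Y L =
    (let X = prod_topology euclideanreal Y;
         T = topspace X - {0} \<times> L;
         N = topspace X - {0..} \<times> L
     in inv_into (carrier (relative_homology_group (n + 1) X T)) (hom_relboundary (n + 1) X T N)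
        \<circ> hom_induced n Y (topspace Y - L) (subtopology X T) N (Pair 1))"

text \<open>Naturality is tested after the connecting map, which is injective and itself natural;
  what remains is that \<open>map_prod id f\<close> commutes with inserting the slice
  \<open>Pair 1\<close>.\<close>

lemma natural_suspension_line:
  "natural_suspension euclideanreal 0 1 (line_suspension :: int \<Rightarrow> 'a topology \<Rightarrow> _)"
proof -
  let ?X = "\<lambda>Y::'a topology. prod_topology euclideanreal Y"
  let ?T = "\<lambda>Y L. topspace (?X Y) - {0} \<times> L"
  let ?N = "\<lambda>Y L. topspace (?X Y) - {0..} \<times> L"
  let ?bd = "\<lambda>n Y L. hom_relboundary (n + 1) (?X Y) (?T Y L) (?N Y L)"
  let ?sl = "\<lambda>n Y L. hom_induced n Y (topspace Y - L) (subtopology (?X Y) (?T Y L)) (?N Y L) (Pair 1)"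
  have bd: "?bd n Y L \<in> iso (local_homology (n + 1) (?X Y) ({0} \<times> L))
       (relative_homology_group n (subtopology (?X Y) (?T Y L)) (?N Y L))" for n Y L
  proof -
    have "?N Y L \<subseteq> ?T Y L" by auto
    from iso_hom_relboundary_trivial[OF this half_line_relative_trivial, of "n + 1"] show ?thesis by simp
  qed
  have sl: "?sl n Y L \<in> iso (local_homology n Y L) (relative_homology_group n (subtopology (?X Y) (?T Y L)) (?N Y L))"
    if "closedin Y L" for n Y L
    using slice_local_homology_iso[OF that] .
  have ls: "line_suspension n Y L = inv_into (carrier (local_homology (n + 1) (?X Y) ({0} \<times> L))) (?bd n Y L) \<circ> ?sl n Y L"
    for n Y L by (simp add: line_suspension_def Let_def)
  have iso: "line_suspension n Y L \<in> iso (local_homology n Y L) (local_homology (n + 1) (?X Y) ({0} \<times> L))"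
    if "closedin Y L" for n Y L
    unfolding ls by (rule iso_set_trans[OF sl[OF that] group.iso_set_sym[OF _ bd]]) simp
  have bd_ls: "?bd n Y L (line_suspension n Y L u) = ?sl n Y L u" for n Y L u
    unfolding ls o_def by (rule iso_inv_into(2)[OF bd]) (rule hom_induced_carrier)
  show ?thesis
    unfolding natural_suspension_def
  proof (intro conjI allI impI iso; (elim conjE)?)
    fix n :: int and Y Y' :: "'a topology" and L L' f u
    assume L: "closedin Y L" and L': "closedin Y' L'" and f: "continuous_map Y Y' f"
      and fL: "f \<in> topspace Y - L \<rightarrow> topspace Y' - L'" and u: "u \<in> carrier (local_homology n Y L)"
    let ?F = "map_prod id f :: real \<times> 'a \<Rightarrow> _"
    have cF: "continuous_map (?X Y) (?X Y') ?F"
      using f by (simp add: continuous_map_prod_top map_prod_def)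
    have fY: "f y \<in> topspace Y'" if "y \<in> topspace Y" for y
      using f that by (auto simp: continuous_map_def)
    have F: "?F \<in> ?T Y L \<rightarrow> ?T Y' L'" "?F \<in> ?N Y L \<rightarrow> ?N Y' L'"
      using fL by (auto simp: fY Pi_iff)
    let ?v = "local_hom (n + 1) (?X Y) ({0} \<times> L) (?X Y') ({0} \<times> L') ?F (line_suspension n Y L u)"
    let ?w = "line_suspension n Y' L' (local_hom n Y L Y' L' f u)"
    have cS: "continuous_map Y (subtopology (?X Y) (?T Y L)) (Pair 1)" for Y L
      unfolding continuous_map_in_subtopology by (auto simp: continuous_map_pairwise o_def)
    have "?bd n Y' L' ?v = hom_induced n (subtopology (?X Y) (?T Y L)) (?N Y L) (subtopology (?X Y') (?T Y' L')) (?N Y' L') ?F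
           (?bd n Y L (line_suspension n Y L u))"
      using fun_cong[OF naturality_hom_induced_relboundary[OF cF F, of "n + 1"], of "line_suspension n Y L u"]
      by simp
    also have "\<dots> = hom_induced n Y (topspace Y - L) (subtopology (?X Y') (?T Y' L')) (?N Y' L') (?F \<circ> Pair 1) u"
      unfolding bd_ls
    proof (rule hom_induced_compose'[OF cS])
      show "continuous_map (subtopology (?X Y) (?T Y L)) (subtopology (?X Y') (?T Y' L')) ?F"
        using cF F(1) by (auto simp: continuous_map_in_subtopology continuous_map_from_subtopology Pi_iff)
    qed (use F in auto)
    also have "?F \<circ> Pair 1 = Pair 1 \<circ> f" by auto
    also have "hom_induced n Y (topspace Y - L) (subtopology (?X Y') (?T Y' L')) (?N Y' L') (Pair 1 \<circ> f) u
        = ?sl n Y' L' (local_hom n Y L Y' L' f u)"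
      by (rule hom_induced_compose'[OF f fL cS, symmetric]) auto
    also have "\<dots> = ?bd n Y' L' ?w" unfolding bd_ls ..
    finally have eq: "?bd n Y' L' ?v = ?bd n Y' L' ?w" .
    moreover have "?v \<in> carrier (local_homology (n + 1) (?X Y') ({0} \<times> L'))"
      by (rule hom_induced_carrier)
    moreover have "?w \<in> carrier (local_homology (n + 1) (?X Y') ({0} \<times> L'))"
      by (rule hom_in_carrier[OF iso_imp_homomorphism[OF iso[OF L']]]) (rule hom_induced_carrier)
    ultimately show "?v = ?w"
      using bd[of n Y' L'] unfolding iso_def bij_betw_def by (blast dest: inj_onD)
  qed
qed

lemma natural_suspension_homeomorphic:
  assumes \<sigma>: "natural_suspension V a d (\<sigma> :: int \<Rightarrow> 'a topology \<Rightarrow> _)"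
    and h: "homeomorphic_map V W h" and a: "a \<in> topspace V"
  shows "\<exists>\<tau>. natural_suspension W (h a) d (\<tau> :: int \<Rightarrow> 'a topology \<Rightarrow> _)"
proof -
  define H where "H = (map_prod h id :: _ \<times> 'a \<Rightarrow> _)"
  define \<tau> where "\<tau> n Y L = local_hom (n + d) (prod_topology V Y) ({a} \<times> L) (prod_topology W Y) ({h a} \<times> L) H \<circ> \<sigma> n Y L"
    for n and Y :: "'a topology" and L
  have ch: "continuous_map V W h" using h homeomorphic_imp_continuous_map by blast
  have inj: "inj_on h (topspace V)" using h homeomorphic_imp_injective_map by blast
  have hi: "homeomorphic_map (prod_topology V Y) (prod_topology W Y) H" for Y :: "'a topology"
  proof -
    obtain h' where "homeomorphic_maps V W h h'" using h homeomorphic_map_maps by blast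
    then have "homeomorphic_maps (prod_topology V Y) (prod_topology W Y) H (\<lambda>(x, y). (h' x, id y))"
      unfolding H_def map_prod_def homeomorphic_maps_prod
      using homeomorphic_maps_id[of Y] by (simp add: id_def)
    then show ?thesis using homeomorphic_map_maps by blast
  qed
  then have cH: "continuous_map (prod_topology V Y) (prod_topology W Y) H" for Y :: "'a topology"
    using homeomorphic_imp_continuous_map by blast
  have hV: "h x \<in> topspace W" if "x \<in> topspace V" for x
    using ch that by (auto simp: continuous_map_def)
  have Hd: "H \<in> topspace (prod_topology V Y) - {a} \<times> L \<rightarrow> topspace (prod_topology W Y) - {h a} \<times> L" for Y L
    using a inj hV by (auto simp: H_def inj_on_def)
  have iso: "\<tau> n Y L \<in> iso (local_homology n Y L) (local_homology (n + d) (prod_topology W Y) ({h a} \<times> L))"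
    if "closedin Y L" for n Y L
    unfolding \<tau>_def
  proof (rule iso_set_trans)
    show "\<sigma> n Y L \<in> iso (local_homology n Y L) (local_homology (n + d) (prod_topology V Y) ({a} \<times> L))"
      by (rule natural_suspension_iso[OF \<sigma> that])
    have LY: "L \<subseteq> topspace Y" using that closedin_subset by blast
    have "H ` topspace (prod_topology V Y) = topspace (prod_topology W Y)"
      using hi homeomorphic_imp_surjective_map by blast
    moreover have "H ` ({a} \<times> L) = {h a} \<times> L" by (force simp: H_def)
    moreover have "inj_on H (topspace (prod_topology V Y))"
      using hi homeomorphic_imp_injective_map by blast
    ultimately have "H ` (topspace (prod_topology V Y) - {a} \<times> L) = topspace (prod_topology W Y) - {h a} \<times> L"
      using a LY by (subst inj_on_image_set_diff[of H "topspace (prod_topology V Y)"]) auto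
    then show "local_hom (n + d) (prod_topology V Y) ({a} \<times> L) (prod_topology W Y) ({h a} \<times> L) H
      \<in> iso (local_homology (n + d) (prod_topology V Y) ({a} \<times> L)) (local_homology (n + d) (prod_topology W Y) ({h a} \<times> L))"
      by (intro homeomorphic_map_relative_homology_iso[OF hi]) auto
  qed
  have "natural_suspension W (h a) d \<tau>"
    unfolding natural_suspension_def
  proof (intro conjI allI impI iso; (elim conjE)?)
    fix n :: int and Y Y' :: "'a topology" and L L' f u
    assume L: "closedin Y L" and L': "closedin Y' L'" and f: "continuous_map Y Y' f"
      and fL: "f \<in> topspace Y - L \<rightarrow> topspace Y' - L'" and u: "u \<in> carrier (local_homology n Y L)"
    have cF: "continuous_map (prod_topology V Y) (prod_topology V Y') (map_prod id f)"
        "continuous_map (prod_topology W Y) (prod_topology W Y') (map_prod id f)"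
      using f by (simp_all add: continuous_map_prod_top map_prod_def)
    have fY: "f y \<in> topspace Y'" if "y \<in> topspace Y" for y
      using f that by (auto simp: continuous_map_def)
    have F: "map_prod id f \<in> topspace (prod_topology V Y) - {a} \<times> L \<rightarrow> topspace (prod_topology V Y') - {a} \<times> L'"
       "map_prod id f \<in> topspace (prod_topology W Y) - {h a} \<times> L \<rightarrow> topspace (prod_topology W Y') - {h a} \<times> L'"
      using fL fY by (auto simp: Pi_iff)
    have eq: "map_prod id f \<circ> H = H \<circ> map_prod id f" by (auto simp: H_def)
    have comm: "local_hom (n + d) (prod_topology W Y) ({h a} \<times> L) (prod_topology W Y') ({h a} \<times> L') (map_prod id f)
        (local_hom (n + d) (prod_topology V Y) ({a} \<times> L) (prod_topology W Y) ({h a} \<times> L) H c)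
      = local_hom (n + d) (prod_topology V Y') ({a} \<times> L') (prod_topology W Y') ({h a} \<times> L') H
        (local_hom (n + d) (prod_topology V Y) ({a} \<times> L) (prod_topology V Y') ({a} \<times> L') (map_prod id f) c)" for c
      by (simp only: local_hom_compose[OF cH Hd cF(2) F(2)] local_hom_compose[OF cF(1) F(1) cH Hd] eq)
    show "local_hom (n + d) (prod_topology W Y) ({h a} \<times> L) (prod_topology W Y') ({h a} \<times> L') (map_prod id f) (\<tau> n Y L u)
      = \<tau> n Y' L' (local_hom n Y L Y' L' f u)"
      by (simp only: \<tau>_def o_apply comm natural_suspension_natural[OF \<sigma> L L' f fL u])
  qed
  then show ?thesis by blast
qed

text \<open>Suspending by V and then by W suspends by the product. Closedness of \<open>{a}\<close>
  keeps \<open>{a} \<times> L\<close> closed, as the second suspension requires; \<open>H\<close>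
  merely reassociates triples.\<close>

lemma natural_suspension_prod:
  assumes \<sigma>: "natural_suspension V a d (\<sigma> :: int \<Rightarrow> 'a topology \<Rightarrow> 'a set \<Rightarrow> 'a chain set \<Rightarrow> ('v \<times> 'a) chain set)"
    and \<tau>: "natural_suspension W b e (\<tau> :: int \<Rightarrow> ('v \<times> 'a) topology \<Rightarrow> ('v \<times> 'a) set \<Rightarrow> ('v \<times> 'a) chain set \<Rightarrow> ('w \<times> 'v \<times> 'a) chain set)"
    and a: "a \<in> topspace V" "closedin V {a}" and b: "b \<in> topspace W"
  shows "\<exists>\<rho>. natural_suspension (prod_topology W V) (b, a) (d + e) (\<rho> :: int \<Rightarrow> 'a topology \<Rightarrow> _)"
proof -
  define H where "H = (\<lambda>(w, v, y). ((w, v), y) :: ('w \<times> 'v) \<times> 'a)"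
  let ?A = "\<lambda>Y::'a topology. prod_topology W (prod_topology V Y)"
  let ?B = "\<lambda>Y::'a topology. prod_topology (prod_topology W V) Y"
  let ?K = "\<lambda>L::'a set. {b} \<times> {a} \<times> L"
  let ?M = "\<lambda>L::'a set. {(b, a)} \<times> L"
  define \<rho> where "\<rho> n Y L = local_hom (n + (d + e)) (?A Y) (?K L) (?B Y) (?M L) H \<circ> (\<tau> (n + d) (prod_topology V Y) ({a} \<times> L) \<circ> \<sigma> n Y L)"
    for n and Y :: "'a topology" and L
  have hi: "homeomorphic_map (?A Y) (?B Y) H" for Y
    unfolding homeomorphic_map_maps homeomorphic_maps_def H_def
  proof (rule exI[of _ "\<lambda>((w, v), y). (w, v, y)"], intro conjI)
    have "continuous_map (?A Y) (prod_topology V Y) snd" "continuous_map (?B Y) (prod_topology W V) fst"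
      by (rule continuous_map_snd continuous_map_fst)+
    then have c: "continuous_map (?A Y) V (\<lambda>x. fst (snd x))" "continuous_map (?A Y) Y (\<lambda>x. snd (snd x))"
      "continuous_map (?B Y) W (\<lambda>x. fst (fst x))" "continuous_map (?B Y) V (\<lambda>x. snd (fst x))"
      by (auto simp: continuous_map_pairwise o_def)
    show "continuous_map (?A Y) (?B Y) (\<lambda>(w, v, y). ((w, v), y))"
      unfolding case_prod_unfold continuous_map_paired by (intro conjI c continuous_map_fst)
    show "continuous_map (?B Y) (?A Y) (\<lambda>((w, v), y). (w, v, y))"
      unfolding case_prod_unfold continuous_map_paired by (intro conjI c continuous_map_snd)
  qed auto
  then have cH: "continuous_map (?A Y) (?B Y) H" for Y :: "'a topology"
    using homeomorphic_imp_continuous_map by blast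
  have Hd: "H \<in> topspace (?A Y) - ?K L \<rightarrow> topspace (?B Y) - ?M L" for Y L
    by (auto simp: H_def)
  have clo: "closedin (prod_topology V Y) ({a} \<times> L)" if "closedin Y L" for Y :: "'a topology" and L
    using that a by (simp add: closedin_prod_Times_iff)
  have s1: "\<sigma> n Y L \<in> iso (local_homology n Y L) (local_homology (n + d) (prod_topology V Y) ({a} \<times> L))"
    if "closedin Y L" for n Y L
    by (rule natural_suspension_iso[OF \<sigma> that])
  have t1: "\<tau> (n + d) (prod_topology V Y) ({a} \<times> L) \<in> iso (local_homology (n + d) (prod_topology V Y) ({a} \<times> L))
      (local_homology (n + (d + e)) (?A Y) (?K L))"
    if "closedin Y L" for n Y L
    unfolding add.assoc[symmetric] by (rule natural_suspension_iso[OF \<tau> clo[OF that]])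
  have iso: "\<rho> n Y L \<in> iso (local_homology n Y L) (local_homology (n + (d + e)) (?B Y) (?M L))"
    if "closedin Y L" for n Y L
    unfolding \<rho>_def
  proof (rule iso_set_trans[OF iso_set_trans[OF s1[OF that] t1[OF that]]])
    have "H ` (topspace (?A Y) - ?K L) = topspace (?B Y) - ?M L"
      by (force simp: H_def image_iff)
    then show "local_hom (n + (d + e)) (?A Y) (?K L) (?B Y) (?M L) H
      \<in> iso (local_homology (n + (d + e)) (?A Y) (?K L)) (local_homology (n + (d + e)) (?B Y) (?M L))"
      by (intro homeomorphic_map_relative_homology_iso[OF hi]) auto
  qed
  have "natural_suspension (prod_topology W V) (b, a) (d + e) \<rho>"
    unfolding natural_suspension_def
  proof (intro conjI allI impI iso; (elim conjE)?)
    fix n :: int and Y Y' :: "'a topology" and L L' f u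
    assume L: "closedin Y L" and L': "closedin Y' L'" and f: "continuous_map Y Y' f"
      and fL: "f \<in> topspace Y - L \<rightarrow> topspace Y' - L'" and u: "u \<in> carrier (local_homology n Y L)"
    let ?f = "map_prod id f :: 'v \<times> 'a \<Rightarrow> _"
    let ?g = "map_prod id ?f :: 'w \<times> 'v \<times> 'a \<Rightarrow> _"
    let ?h = "map_prod id f :: ('w \<times> 'v) \<times> 'a \<Rightarrow> _"
    have cf: "continuous_map (prod_topology V Y) (prod_topology V Y') ?f"
      using f by (simp_all add: continuous_map_prod_top map_prod_def)
    have cg: "continuous_map (?A Y) (?A Y') ?g"
      using cf by (subst map_prod_def) (simp add: continuous_map_prod_top)
    have ch: "continuous_map (?B Y) (?B Y') ?h"
      using f by (simp_all add: continuous_map_prod_top map_prod_def)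
    have fY: "f y \<in> topspace Y'" if "y \<in> topspace Y" for y
      using f that by (auto simp: continuous_map_def)
    have F: "?f \<in> topspace (prod_topology V Y) - {a} \<times> L \<rightarrow> topspace (prod_topology V Y') - {a} \<times> L'"
      "?g \<in> topspace (?A Y) - ?K L \<rightarrow> topspace (?A Y') - ?K L'"
      "?h \<in> topspace (?B Y) - ?M L \<rightarrow> topspace (?B Y') - ?M L'"
      using fL fY by (auto simp: Pi_iff)
    let ?su = "\<sigma> n Y L u"
    have su: "?su \<in> carrier (local_homology (n + d) (prod_topology V Y) ({a} \<times> L))"
      by (rule hom_in_carrier[OF iso_imp_homomorphism[OF s1[OF L]] u])
    have 1: "local_hom (n + d) (prod_topology V Y) ({a} \<times> L) (prod_topology V Y') ({a} \<times> L') ?f ?su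
      = \<sigma> n Y' L' (local_hom n Y L Y' L' f u)"
      by (rule natural_suspension_natural[OF \<sigma> L L' f fL u])
    have 2: "local_hom (n + (d + e)) (?A Y) (?K L) (?A Y') (?K L') ?g (\<tau> (n + d) (prod_topology V Y) ({a} \<times> L) ?su)
      = \<tau> (n + d) (prod_topology V Y') ({a} \<times> L') (local_hom (n + d) (prod_topology V Y) ({a} \<times> L) (prod_topology V Y') ({a} \<times> L') ?f ?su)"
      unfolding add.assoc[symmetric] by (rule natural_suspension_natural[OF \<tau> clo[OF L] clo[OF L'] cf F(1) su])
    have eq: "?h \<circ> H = H \<circ> ?g" by (auto simp: H_def)
    have comm: "local_hom (n + (d + e)) (?B Y) (?M L) (?B Y') (?M L') ?h (local_hom (n + (d + e)) (?A Y) (?K L) (?B Y) (?M L) H c)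
      = local_hom (n + (d + e)) (?A Y') (?K L') (?B Y') (?M L') H (local_hom (n + (d + e)) (?A Y) (?K L) (?A Y') (?K L') ?g c)" for c
      by (simp only: local_hom_compose[OF cH Hd ch F(3)] local_hom_compose[OF cg F(2) cH Hd] eq)
    show "local_hom (n + (d + e)) (?B Y) (?M L) (?B Y') (?M L') ?h (\<rho> n Y L u)
      = \<rho> n Y' L' (local_hom n Y L Y' L' f u)"
      by (simp only: \<rho>_def o_apply comm 1 2)
  qed
  then show ?thesis by blast
qed

subsection \<open>Spheres\<close>

lemma punctured_sphere_chart:
  fixes a b :: "'e::euclidean_space"
  assumes "a \<in> sphere 0 1" "b \<in> sphere 0 1" "a \<noteq> b" and dim: "DIM('e) = DIM('v::euclidean_space) + 1"
  shows "\<exists>h. homeomorphic_map (euclidean :: 'v topology) (top_of_set (sphere 0 1 - {b})) h \<and> h 0 = a"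
proof -
  have "(sphere (0::'e) 1 - {b}) homeomorphic (UNIV :: 'v set)"
    by (rule homeomorphic_punctured_sphere_affine) (use assms in auto)
  then obtain g g' where g: "homeomorphism (UNIV :: 'v set) (sphere (0::'e) 1 - {b}) g g'"
    using homeomorphic_sym homeomorphic_def by metis
  \<comment> \<open>The translation makes the chart send 0, the centre of the Euclidean suspension,
    to \<open>a\<close>.\<close>
  define h where "h = g \<circ> (\<lambda>v. v + g' a)"
  have "homeomorphic_maps (euclidean :: 'v topology) (top_of_set (sphere 0 1 - {b})) h ((\<lambda>v. v - g' a) \<circ> g')"
    using g unfolding homeomorphic_maps_def h_def homeomorphism_def
    by (auto simp: continuous_map_in_subtopology intro!: continuous_intros continuous_on_compose2[of UNIV g])
  moreover have "h 0 = a"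
    using g assms unfolding h_def homeomorphism_def by auto
  ultimately show ?thesis using homeomorphic_map_maps by blast
qed

lemma contractible_punctured_sphere:
  fixes b :: "'e::euclidean_space"
  assumes "b \<in> sphere 0 1" and dim: "DIM('e) = DIM('v::euclidean_space) + 1"
  shows "contractible (sphere 0 1 - {b})"
proof -
  have "(sphere (0::'e) 1 - {b}) homeomorphic (UNIV :: 'v set)"
    by (rule homeomorphic_punctured_sphere_affine) (use assms in auto)
  then show ?thesis using homeomorphic_contractible_eq contractible_UNIV by blast
qed

text \<open>Dimensions are added one line at a time. With nested pairs of reals as the model, each
  product topology is again the Euclidean one.\<close>

lemma natural_suspension_euclidean3:
  "\<exists>\<sigma>. natural_suspension (euclidean :: (real \<times> real \<times> real) topology) 0 3 (\<sigma> :: int \<Rightarrow> 'a topology \<Rightarrow> _)"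
proof -
  obtain \<sigma>1 :: "int \<Rightarrow> 'a topology \<Rightarrow> 'a set \<Rightarrow> 'a chain set \<Rightarrow> ((real \<times> real) \<times> 'a) chain set"
    where s1: "natural_suspension euclidean (0, 0) (1 + 1) \<sigma>1"
    using natural_suspension_prod[OF natural_suspension_line natural_suspension_line] by fastforce
  have "\<exists>\<sigma>. natural_suspension (prod_topology euclideanreal (euclidean :: (real \<times> real) topology)) (0, (0, 0)) ((1 + 1) + 1) (\<sigma> :: int \<Rightarrow> 'a topology \<Rightarrow> _)"
    by (rule natural_suspension_prod[OF s1 natural_suspension_line]) auto
  then show ?thesis by (simp add: zero_prod_def)
qed

lemma natural_suspension_euclidean5:
  "\<exists>\<sigma>. natural_suspension (euclidean :: (real \<times> real \<times> real \<times> real \<times> real) topology) 0 5 (\<sigma> :: int \<Rightarrow> 'a topology \<Rightarrow> _)"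
proof -
  obtain \<sigma>1 :: "int \<Rightarrow> 'a topology \<Rightarrow> 'a set \<Rightarrow> 'a chain set \<Rightarrow> ((real \<times> real \<times> real) \<times> 'a) chain set"
    where s1: "natural_suspension euclidean 0 3 \<sigma>1"
    using natural_suspension_euclidean3 by blast
  obtain \<sigma>2 :: "int \<Rightarrow> 'a topology \<Rightarrow> 'a set \<Rightarrow> 'a chain set \<Rightarrow> ((real \<times> real \<times> real \<times> real) \<times> 'a) chain set"
    where s2: "natural_suspension (prod_topology euclidean euclidean) (0, 0) (3 + 1) \<sigma>2"
    using natural_suspension_prod[OF s1 natural_suspension_line] by fastforce
  have "\<exists>\<sigma>. natural_suspension (prod_topology euclideanreal (euclidean :: (real \<times> real \<times> real \<times> real) topology)) (0, 0) ((3 + 1) + 1) (\<sigma> :: int \<Rightarrow> 'a topology \<Rightarrow> _)"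
    by (rule natural_suspension_prod[OF s2[unfolded prod_topology_euclidean zero_prod_def[symmetric]] natural_suspension_line]) auto
  then show ?thesis by (simp add: zero_prod_def)
qed

lemma natural_suspension_punctured_sphere:
  fixes a b :: "'e::euclidean_space"
  assumes "a \<in> sphere 0 1" "b \<in> sphere 0 1" "a \<noteq> b"
  shows "DIM('e) = 4 \<Longrightarrow> \<exists>\<sigma>. natural_suspension (top_of_set (sphere 0 1 - {b})) a 3 (\<sigma> :: int \<Rightarrow> 'a topology \<Rightarrow> _)"
    and "DIM('e) = 6 \<Longrightarrow> \<exists>\<sigma>. natural_suspension (top_of_set (sphere 0 1 - {b})) a 5 (\<sigma> :: int \<Rightarrow> 'a topology \<Rightarrow> _)"
proof -
  assume "DIM('e) = 4"
  then obtain h where h: "homeomorphic_map (euclidean :: (real \<times> real \<times> real) topology) (top_of_set (sphere 0 1 - {b})) h" "h 0 = a"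
    using punctured_sphere_chart[OF assms, where 'v = "real \<times> real \<times> real"] by auto
  obtain \<sigma> :: "int \<Rightarrow> 'a topology \<Rightarrow> 'a set \<Rightarrow> 'a chain set \<Rightarrow> ((real \<times> real \<times> real) \<times> 'a) chain set"
    where s: "natural_suspension euclidean 0 3 \<sigma>" using natural_suspension_euclidean3 by blast
  show "\<exists>\<sigma>. natural_suspension (top_of_set (sphere 0 1 - {b})) a 3 (\<sigma> :: int \<Rightarrow> 'a topology \<Rightarrow> _)"
    using natural_suspension_homeomorphic[OF s h(1)] h(2) by simp
next
  assume "DIM('e) = 6"
  then obtain h where h: "homeomorphic_map (euclidean :: (real \<times> real \<times> real \<times> real \<times> real) topology) (top_of_set (sphere 0 1 - {b})) h" "h 0 = a"
    using punctured_sphere_chart[OF assms, where 'v = "real \<times> real \<times> real \<times> real \<times> real"] by auto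
  obtain \<sigma> :: "int \<Rightarrow> 'a topology \<Rightarrow> 'a set \<Rightarrow> 'a chain set \<Rightarrow> ((real \<times> real \<times> real \<times> real \<times> real) \<times> 'a) chain set"
    where s: "natural_suspension euclidean 0 5 \<sigma>" using natural_suspension_euclidean5 by blast
  show "\<exists>\<sigma>. natural_suspension (top_of_set (sphere 0 1 - {b})) a 5 (\<sigma> :: int \<Rightarrow> 'a topology \<Rightarrow> _)"
    using natural_suspension_homeomorphic[OF s h(1)] h(2) by simp
qed

section \<open>Homology of the three-sphere\<close>

abbreviation point_space :: "unit topology" where
  "point_space \<equiv> discrete_topology {()}"

abbreviation sphere_top :: "'e::euclidean_space topology" where
  "sphere_top \<equiv> top_of_set (sphere 0 1)"

lemma openin_punctured_sphere: "openin sphere_top (sphere (0::'e::euclidean_space) 1 - {b})"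
  by (simp add: openin_delete)

lemma subtopology_punctured_sphere:
  "subtopology sphere_top (sphere (0::'e::euclidean_space) 1 - {b}) = top_of_set (sphere 0 1 - {b})"
  by (simp add: subtopology_subtopology Int_absorb1)

lemma minus_sphere_neq:
  fixes a :: "'e::real_normed_vector"
  assumes "a \<in> sphere 0 1"
  shows "- a \<in> sphere 0 1" "- a \<noteq> a" "a \<noteq> - a"
proof -
  have "2 *\<^sub>R a \<noteq> 0" using assms by auto
  then show "- a \<noteq> a" by (metis add.left_inverse scaleR_2)
  then show "a \<noteq> - a" by metis
qed (use assms in auto)

lemma sphere3_punctured_iso:
  fixes a :: "'e::euclidean_space"
  assumes a: "a \<in> sphere 0 1" and dim: "DIM('e) = 4"
  shows "hom_induced p sphere_top {} sphere_top (topspace sphere_top - {a}) id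
      \<in> iso (reduced_homology_group p (sphere_top :: 'e topology)) (local_homology p sphere_top {a})"
proof (rule iso_reduced_homology_by_contractible)
  have "contractible (sphere 0 1 - {a})"
    by (rule contractible_punctured_sphere[where 'v = "real \<times> real \<times> real"]) (use a dim in auto)
  then show "contractible_space (subtopology sphere_top (topspace sphere_top - {a}))"
    by (simp add: subtopology_punctured_sphere)
  have "-a \<in> topspace sphere_top \<inter> (topspace sphere_top - {a})"
    using minus_sphere_neq[OF a] by simp
  then show "topspace sphere_top \<inter> (topspace sphere_top - {a}) \<noteq> {}" by blast
qed

text \<open>The complement of \<open>a\<close> is contractible, so the reduced group is the local
  one at \<open>a\<close>; excision moves that into a chart, and there it is the threefold
  suspension of the homology of a point.\<close>

lemma reduced_homology_sphere3:
  assumes dim: "DIM('e::euclidean_space) = 4"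
  shows "reduced_homology_group p (sphere_top :: 'e topology) \<cong> homology_group (p - 3) point_space"
proof -
  obtain a :: 'e where a: "a \<in> sphere 0 1"
    using vector_choose_size[of 1] by auto
  let ?S = "sphere_top :: 'e topology"
  let ?b = "-a"
  note b = minus_sphere_neq(1,3)[OF a]
  let ?U = "top_of_set (sphere 0 1 - {?b})"
  let ?P = "prod_topology ?U point_space"
  obtain \<sigma> where s: "natural_suspension ?U a 3 (\<sigma> :: int \<Rightarrow> unit topology \<Rightarrow> _)"
    using natural_suspension_punctured_sphere(1)[OF a b dim] by blast
  have 1: "homology_group (p - 3) point_space \<cong> local_homology p ?P ({a} \<times> {()})"
    using natural_suspension_iso[OF s, of point_space "{()}" "p - 3"] unfolding is_iso_def by auto
  have 2: "local_homology p ?P ({a} \<times> {()}) \<cong> local_homology p ?U {a}"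
  proof -
    have "homeomorphic_map ?P ?U fst"
      unfolding homeomorphic_map_maps homeomorphic_maps_def
      by (rule exI[of _ "\<lambda>x. (x, ())"]) (auto simp: continuous_map_fst continuous_map_pairwise o_def)
    then have "hom_induced p ?P (topspace ?P - {a} \<times> {()}) ?U (topspace ?U - {a}) fst
       \<in> iso (local_homology p ?P ({a} \<times> {()})) (local_homology p ?U {a})"
    proof (rule homeomorphic_map_relative_homology_iso)
      show "fst ` (topspace ?P - {a} \<times> {()}) = topspace ?U - {a}" by force
    qed auto
    then show ?thesis unfolding is_iso_def by blast
  qed
  have 3: "local_homology p ?U {a} \<cong> local_homology p ?S {a}"
  proof -
    have "closedin ?S {a}" using a by auto
    then show ?thesis
      using open_inclusion_local_homology_iso[OF openin_punctured_sphere[of ?b], of "{a}" p] a b(2)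
      unfolding subtopology_punctured_sphere is_iso_def by auto
  qed
  have 4: "reduced_homology_group p ?S \<cong> local_homology p ?S {a}"
    using sphere3_punctured_iso[OF a dim] unfolding is_iso_def by blast
  have "homology_group (p - 3) point_space \<cong> local_homology p ?S {a}"
    using iso_trans[OF iso_trans[OF 1 2] 3] .
  from iso_trans[OF 4 group.iso_sym[OF _ this]] show ?thesis by simp
qed

lemma homology_sphere3:
  assumes dim: "DIM('e::euclidean_space) = 4"
  shows "homology_group 3 (sphere_top :: 'e topology) \<cong> integer_group"
    and "\<And>p. p \<noteq> 0 \<Longrightarrow> p \<noteq> 3 \<Longrightarrow> trivial_group (homology_group p (sphere_top :: 'e topology))"
    and "trivial_group (reduced_homology_group 0 (sphere_top :: 'e topology))"
proof -
  have "homology_group 0 point_space \<cong> integer_group"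
    by (rule homology_coefficients) simp
  then show "homology_group 3 (sphere_top :: 'e topology) \<cong> integer_group"
    using reduced_homology_sphere3[OF dim, of 3] by (simp add: un_reduced_homology_group) (metis iso_trans)
  have triv: "trivial_group (reduced_homology_group p (sphere_top :: 'e topology))" if "p \<noteq> 3" for p
  proof -
    have "trivial_group (homology_group (p - 3) point_space)"
      by (rule homology_dimension_axiom) (use that in auto)
    then show ?thesis
      using isomorphic_group_triviality[OF reduced_homology_sphere3[OF dim, of p]] by simp
  qed
  show "trivial_group (homology_group p (sphere_top :: 'e topology))" if "p \<noteq> 0" "p \<noteq> 3" for p
    using triv[OF that(2)] that(1) by (simp add: un_reduced_homology_group)
  show "trivial_group (reduced_homology_group 0 (sphere_top :: 'e topology))"
    by (rule triv) simp
qed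

section \<open>Additivity of degrees for a unital multiplication on the three-sphere\<close>

lemma snd_homology_iso_contractible:
  assumes V: "contractible_space V" "topspace V \<noteq> {}"
  shows "hom_induced p (prod_topology V Y) {} Y {} snd \<in> iso (homology_group p (prod_topology V Y)) (homology_group p Y)"
proof -
  obtain v where v: "v \<in> topspace V" using V(2) by blast
  have h: "homotopic_with (\<lambda>x. True) V V id (\<lambda>x. v)"
    by (rule bspec[OF iffD1[OF contractible_space_alt V(1)] v])
  show ?thesis
  proof (rule homotopy_equivalence_homology_group_isomorphism)
    show "continuous_map (prod_topology V Y) Y snd" by (rule continuous_map_snd)
    show "continuous_map Y (prod_topology V Y) (Pair v)"
      using v by (simp add: continuous_map_pairwise o_def)
    have "homotopic_with (\<lambda>x. True) (prod_topology V Y) (prod_topology V Y)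
        (\<lambda>z. (v, id (snd z))) (\<lambda>z. (id (fst z), id (snd z)))"
    proof (rule homotopic_with_prod_topology[OF homotopic_with_symD[OF h]])
      show "homotopic_with (\<lambda>x. True) Y Y id id" by simp
    qed auto
    then show "homotopic_with (\<lambda>x. True) (prod_topology V Y) (prod_topology V Y) (Pair v \<circ> snd) id"
      by (rule homotopic_with_eq) auto
    show "homotopic_with (\<lambda>x. True) Y Y (snd \<circ> Pair v) id"
      by (rule homotopic_with_equal) (auto simp: o_def)
  qed
qed

lemma iso_eq_oneD:
  assumes "f \<in> iso G H" "group G" "group H" "x \<in> carrier G" "f x = \<one>\<^bsub>H\<^esub>"
  shows "x = \<one>\<^bsub>G\<^esub>"
proof -
  have "inj_on f (carrier G)" using assms(1) by (simp add: iso_def bij_betw_def)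
  moreover have "f x = f \<one>\<^bsub>G\<^esub>"
    using hom_one[OF iso_imp_homomorphism[OF assms(1)] assms(2,3)] assms(5) by simp
  moreover have "\<one>\<^bsub>G\<^esub> \<in> carrier G"
    using assms(2) by (simp add: group.is_monoid monoid.one_closed)
  ultimately show ?thesis
    using assms(4) by (simp add: inj_onD)
qed

lemma hom_induced_one: "hom_induced p X S Y T f \<one>\<^bsub>relative_homology_group p X S\<^esub> = \<one>\<^bsub>relative_homology_group p Y T\<^esub>"
  by (rule hom_one[OF hom_induced_hom]) auto

lemma hom_induced_const:
  assumes "p \<noteq> 0" "e \<in> topspace Y"
  shows "hom_induced p X {} Y {} (\<lambda>_. e) z = \<one>\<^bsub>homology_group p Y\<^esub>"
proof -
  have triv: "trivial_group (homology_group p point_space)"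
    by (rule homology_dimension_axiom) (use assms in auto)
  have "hom_induced p X {} Y {} ((\<lambda>_::unit. e) \<circ> (\<lambda>_. ())) z
      = hom_induced p point_space {} Y {} (\<lambda>_. e) (hom_induced p X {} point_space {} (\<lambda>_. ()) z)"
    using assms by (subst hom_induced_compose) auto
  also have "hom_induced p X {} point_space {} (\<lambda>_. ()) z = \<one>\<^bsub>homology_group p point_space\<^esub>"
    using triv hom_induced_carrier[of p X "{}" point_space "{}" "\<lambda>_. ()" z] by (simp add: trivial_group_def)
  finally show ?thesis by (simp add: hom_induced_one o_def)
qed

text \<open>A class killed by a constant map has augmentation zero, hence lies in reduced homology,
  which vanishes in degree 0. In this degree constant maps are thus injective.\<close>

lemma zeroth_homology_sphere3_const:
  fixes e :: "'e::euclidean_space"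
  assumes dim: "DIM('e) = 4" and e: "e \<in> sphere 0 1"
    and u: "u \<in> carrier (homology_group 0 (sphere_top :: 'e topology))"
    and 1: "hom_induced 0 sphere_top {} sphere_top {} (\<lambda>_. e) u = \<one>\<^bsub>homology_group 0 sphere_top\<^esub>"
  shows "u = \<one>\<^bsub>homology_group 0 sphere_top\<^esub>"
proof -
  have "hom_induced 0 sphere_top {} point_space {} ((\<lambda>_::'e. ()) \<circ> (\<lambda>_. e)) u
     = hom_induced 0 sphere_top {} point_space {} (\<lambda>_. ()) (hom_induced 0 sphere_top {} sphere_top {} (\<lambda>_. e) u)"
    using e by (subst hom_induced_compose) auto
  also have "\<dots> = \<one>\<^bsub>homology_group 0 point_space\<^esub>"
    unfolding 1 by (rule hom_induced_one)
  finally have "u \<in> carrier (reduced_homology_group 0 (sphere_top :: 'e topology))"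
    using u by (simp add: carrier_reduced_homology_group kernel_def o_def)
  then show ?thesis
    using homology_sphere3(3)[OF dim] by (simp add: trivial_group_def one_reduced_homology_group)
qed

lemma prod_topology_subtopology_left:
  "prod_topology (subtopology V T) Y = subtopology (prod_topology V Y) (T \<times> topspace Y)"
proof -
  have "topspace (prod_topology V Y) \<inter> (T \<times> UNIV) = topspace (prod_topology V Y) \<inter> (T \<times> topspace Y)"
    by auto
  then have "subtopology (prod_topology V Y) (T \<times> UNIV) = subtopology (prod_topology V Y) (T \<times> topspace Y)"
    by (metis subtopology_restrict)
  then show ?thesis by (simp only: prod_topology_subtopology(1))
qed

text \<open>The class is restricted to the slice \<open>K\<close> over \<open>a\<close>, where the
  local homology is H_0 of the second factor suspended three times. Vanishing of the first
  projection removes this restriction; the rest of the class comes from the complement of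
  \<open>K\<close>, on which the second projection is an isomorphism.\<close>

lemma homology_prod_sphere3_separated:
  fixes c :: "('e::euclidean_space \<times> 'e) chain set"
  defines "S \<equiv> sphere_top :: 'e topology"
  defines "X \<equiv> prod_topology S S"
  assumes dim: "DIM('e) = 4" and c: "c \<in> carrier (homology_group 3 X)"
    and fst1: "hom_induced 3 X {} S {} fst c = \<one>\<^bsub>homology_group 3 S\<^esub>"
    and snd1: "hom_induced 3 X {} S {} snd c = \<one>\<^bsub>homology_group 3 S\<^esub>"
  shows "c = \<one>\<^bsub>homology_group 3 X\<^esub>"
proof -
  obtain a :: 'e where a: "a \<in> sphere 0 1" using vector_choose_size[of 1] by auto
  define b where "b = - a"
  have b: "b \<in> sphere 0 1" "a \<noteq> b" using minus_sphere_neq[OF a] by (auto simp: b_def)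
  have tS: "topspace S = sphere 0 1" by (simp add: S_def)
  define K where "K = {a} \<times> topspace S"
  define U where "U = top_of_set (sphere 0 1 - {b})"
  define P where "P = prod_topology U S"
  have cloK: "closedin X K"
    unfolding X_def K_def closedin_prod_Times_iff using a by (auto simp: S_def)
  have KX: "K \<subseteq> topspace X" using cloK closedin_subset by blast
  have tX: "topspace X = sphere 0 1 \<times> sphere 0 1" by (simp add: X_def S_def)
  have PX: "P = subtopology X ((sphere 0 1 - {b}) \<times> topspace S)"
    unfolding P_def X_def U_def S_def subtopology_punctured_sphere[symmetric] prod_topology_subtopology_left ..
  have KP: "K \<subseteq> (sphere 0 1 - {b}) \<times> topspace S" using a b by (auto simp: K_def)
  have opn: "openin X ((sphere 0 1 - {b}) \<times> topspace S)"
    unfolding X_def openin_prod_Times_iff using openin_punctured_sphere[of b] by (simp add: S_def)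
  have i: "local_hom 3 P K X K id \<in> iso (local_homology 3 P K) (local_homology 3 X K)"
    unfolding PX by (rule open_inclusion_local_homology_iso[OF opn KP cloK])
  obtain \<sigma> where s: "natural_suspension U a 3 (\<sigma> :: int \<Rightarrow> 'e topology \<Rightarrow> _)"
    using natural_suspension_punctured_sphere(1)[OF a b dim] unfolding U_def by blast
  have cloS: "closedin S (topspace S)" by simp
  have \<sigma>: "\<sigma> 0 S (topspace S) \<in> iso (homology_group 0 S) (local_homology 3 P K)"
    using natural_suspension_iso[OF s cloS, of 0] by (simp add: P_def K_def)
  let ?k = "\<lambda>_::'e. a"
  let ?q = "map_prod id ?k :: 'e \<times> 'e \<Rightarrow> _"
  have ck: "continuous_map S S ?k" using a by (simp add: tS)
  have cq: "continuous_map X X ?q" "continuous_map P P ?q"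
    using ck unfolding X_def P_def map_prod_def by (simp_all add: continuous_map_prod_top)
  have qK: "?q \<in> (topspace X - K) \<rightarrow> (topspace X - K)" "?q \<in> (topspace P - K) \<rightarrow> (topspace P - K)"
    using a by (auto simp: X_def P_def K_def tS)
  have tP: "topspace P \<subseteq> topspace X" by (simp add: PX)
  have cid: "continuous_map P X id" by (simp add: PX continuous_map_from_subtopology)
  have iP: "id \<in> (topspace P - K) \<rightarrow> (topspace X - K)" using tP by auto
  let ?j = "hom_induced 3 X {} X (topspace X - K) id"
  define c' where "c' = ?j c"
  have c': "c' \<in> carrier (local_homology 3 X K)" unfolding c'_def by (rule hom_induced_carrier)
  \<comment> \<open>Collapsing the second factor to \<open>a\<close> factors through the first
    projection, which kills \<open>c\<close>.\<close>
  have qc: "hom_induced 3 X {} X {} ?q c = \<one>\<^bsub>homology_group 3 X\<^esub>"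
  proof -
    have q: "?q = (\<lambda>v. (v, a)) \<circ> fst" by (rule ext) auto
    have "continuous_map X S fst" unfolding X_def by (rule continuous_map_fst)
    moreover have "continuous_map S X (\<lambda>v. (v, a))"
      unfolding X_def continuous_map_paired using ck by simp
    ultimately have "hom_induced 3 X {} X {} ((\<lambda>v. (v, a)) \<circ> fst) c = hom_induced 3 S {} X {} (\<lambda>v. (v, a)) (hom_induced 3 X {} S {} fst c)"
      by (intro hom_induced_compose'[symmetric]) auto
    then show ?thesis unfolding q fst1 by (simp only: hom_induced_one)
  qed
  have qc': "local_hom 3 X K X K ?q c' = \<one>\<^bsub>local_homology 3 X K\<^esub>"
  proof -
    have "local_hom 3 X K X K ?q c' = hom_induced 3 X {} X (topspace X - K) (?q \<circ> id) c"
      unfolding c'_def by (rule hom_induced_compose'[OF _ _ cq(1) qK(1)]) auto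
    also have "\<dots> = hom_induced 3 X {} X (topspace X - K) (id \<circ> ?q) c" by simp
    also have "\<dots> = ?j (hom_induced 3 X {} X {} ?q c)"
      by (rule hom_induced_compose'[OF cq(1), symmetric]) auto
    finally show ?thesis by (simp add: qc hom_induced_one)
  qed
  obtain c2 where c2: "c2 \<in> carrier (local_homology 3 P K)" "local_hom 3 P K X K id c2 = c'"
    using iso_inv_into[OF i c'] by blast
  obtain u where u: "u \<in> carrier (homology_group 0 S)" "\<sigma> 0 S (topspace S) u = c2"
    using iso_inv_into[OF \<sigma> c2(1)] by blast
  let ?ku = "hom_induced 0 S {} S {} ?k u"
  have ku: "?ku \<in> carrier (homology_group 0 S)" by (rule hom_induced_carrier)
  \<comment> \<open>By naturality, the collapse acts on the desuspended class \<open>u\<close> as a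
    constant map on H_0, where it is injective.\<close>
  have "local_hom 3 P K P K ?q c2 = \<sigma> 0 S (topspace S) ?ku"
    using natural_suspension_natural[OF s cloS cloS ck, of u 0] u by (simp add: P_def K_def)
  moreover have "local_hom 3 P K P K ?q c2 = \<one>\<^bsub>local_homology 3 P K\<^esub>"
  proof (rule iso_eq_oneD[OF i])
    have "local_hom 3 P K X K id (local_hom 3 P K P K ?q c2) = local_hom 3 P K X K (id \<circ> ?q) c2"
      by (rule local_hom_compose[OF cq(2) qK(2) cid iP])
    also have "\<dots> = local_hom 3 P K X K (?q \<circ> id) c2" by simp
    also have "\<dots> = local_hom 3 X K X K ?q (local_hom 3 P K X K id c2)"
      by (rule local_hom_compose[OF cid iP cq(1) qK(1), symmetric])
    finally show "local_hom 3 P K X K id (local_hom 3 P K P K ?q c2) = \<one>\<^bsub>local_homology 3 X K\<^esub>"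
      by (simp add: c2 qc')
  qed (auto simp: hom_induced_carrier)
  ultimately have "?ku = \<one>\<^bsub>homology_group 0 S\<^esub>"
    using iso_eq_oneD[OF \<sigma> _ _ ku] by simp
  then have "u = \<one>\<^bsub>homology_group 0 S\<^esub>"
    using zeroth_homology_sphere3_const[OF dim a] u(1) unfolding S_def by blast
  then have "c2 = \<one>\<^bsub>local_homology 3 P K\<^esub>"
    using u(2) hom_one[OF iso_imp_homomorphism[OF \<sigma>]] by simp
  then have "c' = \<one>\<^bsub>local_homology 3 X K\<^esub>"
    using c2(2) hom_induced_one[of 3 P "topspace P - K" X "topspace X - K" id] by simp
  \<comment> \<open>With trivial restriction to \<open>K\<close>, exactness brings \<open>c\<close>
    from the complement of \<open>K\<close>: a punctured sphere, which is contractible, times the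
    second factor.\<close>
  then have "c \<in> kernel (homology_group 3 X) (local_homology 3 X K) ?j"
    using c by (simp add: kernel_def c'_def)
  moreover have "hom_induced 3 (subtopology X (topspace X - K)) {} X {} id ` carrier (homology_group 3 (subtopology X (topspace X - K)))
      = kernel (homology_group 3 X) (local_homology 3 X K) ?j"
    using homology_exactness_axiom_3[of 3 X "topspace X - K"] by simp
  ultimately have "c \<in> hom_induced 3 (subtopology X (topspace X - K)) {} X {} id ` carrier (homology_group 3 (subtopology X (topspace X - K)))"
    by simp
  then obtain y where y: "y \<in> carrier (homology_group 3 (subtopology X (topspace X - K)))"
      "hom_induced 3 (subtopology X (topspace X - K)) {} X {} id y = c"
    by (elim imageE) simp
  define Q where "Q = subtopology X (topspace X - K)"
  have "topspace X - K = (sphere 0 1 - {a}) \<times> topspace S"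
    by (auto simp: tX K_def tS)
  then have Q: "Q = prod_topology (top_of_set (sphere 0 1 - {a})) S"
    unfolding Q_def X_def S_def subtopology_punctured_sphere[symmetric] prod_topology_subtopology_left by simp
  have iso: "hom_induced 3 Q {} S {} snd \<in> iso (homology_group 3 Q) (homology_group 3 S)"
    unfolding Q
  proof (rule snd_homology_iso_contractible)
    show "contractible_space (top_of_set (sphere 0 1 - {a}))"
      using contractible_punctured_sphere[OF a, where 'v = "real \<times> real \<times> real"] dim by simp
    show "topspace (top_of_set (sphere 0 1 - {a})) \<noteq> {}" using b by auto
  qed
  have "hom_induced 3 Q {} S {} (snd \<circ> id) y = hom_induced 3 X {} S {} snd (hom_induced 3 Q {} X {} id y)"
  proof (rule hom_induced_compose'[symmetric])
    show "continuous_map Q X id" by (simp add: Q_def continuous_map_from_subtopology)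
    show "continuous_map X S snd" unfolding X_def by (rule continuous_map_snd)
  qed auto
  then have "hom_induced 3 Q {} S {} snd y = \<one>\<^bsub>homology_group 3 S\<^esub>"
    using y(2) snd1 by (simp add: Q_def)
  then have "y = \<one>\<^bsub>homology_group 3 Q\<^esub>"
    using iso_eq_oneD[OF iso] y(1) by (simp add: Q_def)
  then show ?thesis
    using y(2) hom_induced_one[of 3 Q "{}" X "{}" id] unfolding Q_def by simp
qed

text \<open>In H_3 of the product, the class of (f, g) is the sum of the classes of (f, e) and (e,
  g), because the difference dies under both projections. Applying \<open>m\<close> and the unit
  laws gives the claim.\<close>

lemma sphere3_multiplication_additive:
  fixes m :: "'e::euclidean_space \<Rightarrow> 'e \<Rightarrow> 'e"
  defines "S \<equiv> sphere_top :: 'e topology"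
  assumes dim: "DIM('e) = 4"
    and m: "continuous_map (prod_topology S S) S (\<lambda>(x, y). m x y)"
    and e: "e \<in> topspace S" and unit: "\<And>x. x \<in> topspace S \<Longrightarrow> m x e = x" "\<And>x. x \<in> topspace S \<Longrightarrow> m e x = x"
    and f: "continuous_map S S f" and g: "continuous_map S S g" and z: "z \<in> carrier (homology_group 3 S)"
  shows "hom_induced 3 S {} S {} (\<lambda>x. m (f x) (g x)) z
       = hom_induced 3 S {} S {} f z \<otimes>\<^bsub>homology_group 3 S\<^esub> hom_induced 3 S {} S {} g z"
proof -
  define X where "X = prod_topology S S"
  let ?H = "\<lambda>Y. homology_group 3 Y"
  interpret HX: comm_group "?H X" by simp
  interpret HS: comm_group "?H S" by simp
  define d where "d = hom_induced 3 S {} X {} (\<lambda>x. (f x, g x)) z"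
  define d1 where "d1 = hom_induced 3 S {} X {} (\<lambda>x. (f x, e)) z"
  define d2 where "d2 = hom_induced 3 S {} X {} (\<lambda>x. (e, g x)) z"
  have dc [simp]: "d \<in> carrier (?H X)" "d1 \<in> carrier (?H X)" "d2 \<in> carrier (?H X)"
    by (auto simp: d_def d1_def d2_def hom_induced_carrier)
  have cont: "continuous_map S X (\<lambda>x. (f x, g x))" "continuous_map S X (\<lambda>x. (f x, e))" "continuous_map S X (\<lambda>x. (e, g x))"
    using f g e by (auto simp: X_def continuous_map_pairwise o_def)
  have comp: "hom_induced 3 X {} S {} p (hom_induced 3 S {} X {} k z) = hom_induced 3 S {} S {} (p \<circ> k) z"
    if "continuous_map X S p" "continuous_map S X k" for p k
    by (rule hom_induced_compose'[OF that(2) _ that(1)]) auto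
  have pr: "continuous_map X S fst" "continuous_map X S snd" "continuous_map X S (\<lambda>(x, y). m x y)"
    using m by (auto simp: X_def continuous_map_fst continuous_map_snd)
  let ?F = "hom_induced 3 S {} S {} f z" and ?G = "hom_induced 3 S {} S {} g z"
  have FG [simp]: "?F \<in> carrier (?H S)" "?G \<in> carrier (?H S)" by (auto simp: hom_induced_carrier)
  have const: "hom_induced 3 S {} S {} (\<lambda>_. e) z = \<one>\<^bsub>?H S\<^esub>"
    by (rule hom_induced_const) (use e in auto)
  have p1: "hom_induced 3 X {} S {} fst d = ?F" "hom_induced 3 X {} S {} fst d1 = ?F" "hom_induced 3 X {} S {} fst d2 = \<one>\<^bsub>?H S\<^esub>"
    unfolding d_def d1_def d2_def by (simp_all add: comp pr cont o_def const)
  have p2: "hom_induced 3 X {} S {} snd d = ?G" "hom_induced 3 X {} S {} snd d1 = \<one>\<^bsub>?H S\<^esub>" "hom_induced 3 X {} S {} snd d2 = ?G"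
    unfolding d_def d1_def d2_def by (simp_all add: comp pr cont o_def const)
  interpret F: group_hom "?H X" "?H S" "hom_induced 3 X {} S {} fst"
    by (simp add: group_hom_def group_hom_axioms_def hom_induced_hom)
  interpret G: group_hom "?H X" "?H S" "hom_induced 3 X {} S {} snd"
    by (simp add: group_hom_def group_hom_axioms_def hom_induced_hom)
  interpret M: group_hom "?H X" "?H S" "hom_induced 3 X {} S {} (\<lambda>(x, y). m x y)"
    by (simp add: group_hom_def group_hom_axioms_def hom_induced_hom)
  have "d \<otimes>\<^bsub>?H X\<^esub> inv\<^bsub>?H X\<^esub> (d1 \<otimes>\<^bsub>?H X\<^esub> d2) = \<one>\<^bsub>?H X\<^esub>"
    unfolding X_def S_def
  proof (rule homology_prod_sphere3_separated[OF dim], fold S_def, fold X_def)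
    show "hom_induced 3 X {} S {} fst (d \<otimes>\<^bsub>?H X\<^esub> inv\<^bsub>?H X\<^esub> (d1 \<otimes>\<^bsub>?H X\<^esub> d2)) = \<one>\<^bsub>?H S\<^esub>"
      by (simp add: p1)
    show "hom_induced 3 X {} S {} snd (d \<otimes>\<^bsub>?H X\<^esub> inv\<^bsub>?H X\<^esub> (d1 \<otimes>\<^bsub>?H X\<^esub> d2)) = \<one>\<^bsub>?H S\<^esub>"
      by (simp add: p2)
  qed simp
  then have d: "d = d1 \<otimes>\<^bsub>?H X\<^esub> d2"
    using HX.inv_equality[of d "inv\<^bsub>?H X\<^esub> (d1 \<otimes>\<^bsub>?H X\<^esub> d2)"] by simp
  have unitF: "hom_induced 3 S {} S {} (\<lambda>x. m (f x) e) = hom_induced 3 S {} S {} f"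
    "hom_induced 3 S {} S {} (\<lambda>x. m e (g x)) = hom_induced 3 S {} S {} g"
    using f g unit by (auto intro!: hom_induced_eq simp: continuous_map_def Pi_iff)
  have "hom_induced 3 S {} S {} (\<lambda>x. m (f x) (g x)) z = hom_induced 3 X {} S {} (\<lambda>(x, y). m x y) d"
    unfolding d_def by (simp add: comp pr cont o_def)
  also have "\<dots> = hom_induced 3 X {} S {} (\<lambda>(x, y). m x y) d1 \<otimes>\<^bsub>?H S\<^esub> hom_induced 3 X {} S {} (\<lambda>(x, y). m x y) d2"
    unfolding d by simp
  also have "\<dots> = ?F \<otimes>\<^bsub>?H S\<^esub> ?G"
    unfolding d1_def d2_def by (simp add: comp pr cont o_def unitF)
  finally show ?thesis .
qed

subsection \<open>Three-sphere bundles over the five-sphere\<close>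

lemma iso_cancel_right:
  assumes "\<beta> \<in> iso G H" "\<gamma> \<in> iso G K" "g \<in> hom H K" "\<And>u. u \<in> carrier G \<Longrightarrow> g (\<beta> u) = \<gamma> u"
  shows "g \<in> iso H K"
proof -
  have \<beta>: "bij_betw \<beta> (carrier G) (carrier H)" and "bij_betw \<gamma> (carrier G) (carrier K)"
    using assms by (auto simp: iso_def)
  then have "bij_betw (g \<circ> \<beta>) (carrier G) (carrier K)"
    using assms(4) by (subst bij_betw_cong[of _ _ \<gamma>]) auto
  then have "bij_betw g (carrier H) (carrier K)"
    using bij_betw_comp_iff[OF \<beta>] by blast
  then show ?thesis using assms(3) by (simp add: iso_def)
qed

text \<open>A bundle of three-spheres over the five-sphere presented by two charts. Classes are
  computed in \<open>k\<close>, around the fibre over \<open>a\<close>; \<open>l\<close> trivializes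
  the complement of that fibre and so gives its homology.\<close>

locale sphere_bundle =
  fixes X :: "'x topology" and p :: "'x \<Rightarrow> 'e::euclidean_space" and a b :: 'e
    and k l :: "'e \<times> 'f::euclidean_space \<Rightarrow> 'x"
  assumes dim_base: "DIM('e) = 6" and dim_fibre: "DIM('f) = 4"
    and a: "a \<in> sphere 0 1" and b: "b \<in> sphere 0 1" and ab: "a \<noteq> b"
    and p: "continuous_map X sphere_top p"
    and k: "homeomorphic_map (prod_topology (top_of_set (sphere 0 1 - {b})) sphere_top) (subtopology X {x. p x \<noteq> b}) k"
    and pk: "\<And>w q. \<lbrakk>w \<in> sphere 0 1 - {b}; q \<in> sphere 0 1\<rbrakk> \<Longrightarrow> p (k (w, q)) = w"
    and l: "homeomorphic_map (prod_topology (top_of_set (sphere 0 1 - {a})) sphere_top) (subtopology X {x. p x \<noteq> a}) l"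
begin

abbreviation F :: "'f topology" where "F \<equiv> sphere_top"

abbreviation P where "P \<equiv> prod_topology (top_of_set (sphere 0 1 - {b})) F"

abbreviation A where "A \<equiv> {x \<in> topspace X. p x = a}"

lemma topspace_P: "topspace P = (sphere 0 1 - {b}) \<times> sphere 0 1"
  by simp

lemma closed_fibre: "closedin X A"
proof -
  have "closedin sphere_top {a}" using a by simp
  from closedin_continuous_map_preimage[OF p this] show ?thesis by simp
qed

lemma open_chart: "openin X {x \<in> topspace X. p x \<noteq> b}"
proof -
  have "{x \<in> topspace X. p x \<in> sphere 0 1 - {b}} = {x \<in> topspace X. p x \<noteq> b}"
    using continuous_map_funspace[OF p] by auto
  then show ?thesis
    using openin_continuous_map_preimage[OF p openin_punctured_sphere[of b]] by simp
qed

lemma k_image: "k ` topspace P = {x \<in> topspace X. p x \<noteq> b}"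
  using homeomorphic_imp_surjective_map[OF k] by auto

lemma k_inj: "inj_on k (topspace P)"
  using homeomorphic_imp_injective_map[OF k] .

lemma k_fibre: "k ` ({a} \<times> topspace F) = A"
proof
  show "k ` ({a} \<times> topspace F) \<subseteq> A"
  proof clarify
    fix q assume "q \<in> topspace F"
    then have "(a, q) \<in> topspace P" "p (k (a, q)) = a" using pk a ab by auto
    then show "k (a, q) \<in> topspace X \<and> p (k (a, q)) = a"
      using k_image by (metis (no_types, lifting) imageI mem_Collect_eq)
  qed
  show "A \<subseteq> k ` ({a} \<times> topspace F)"
  proof
    fix x assume x: "x \<in> A"
    then have "x \<in> k ` topspace P" unfolding k_image using ab by auto
    then obtain z where z: "z \<in> topspace P" "x = k z" by blast
    then obtain w q where wq: "x = k (w, q)" "w \<in> sphere 0 1 - {b}" "q \<in> sphere 0 1"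
      by (cases z) (metis mem_Sigma_iff topspace_P)
    then have "w = a" using x pk by auto
    then show "x \<in> k ` ({a} \<times> topspace F)" using wq by auto
  qed
qed

lemma closed_k_image:
  assumes "closedin F L"
  shows "closedin X (k ` ({a} \<times> L))"
proof -
  have LF: "L \<subseteq> topspace F" using assms closedin_subset by blast
  have "closedin P ({a} \<times> L)"
    unfolding closedin_prod_Times_iff using assms a ab by (auto simp: closed_subset)
  then have "closedin (subtopology X {x. p x \<noteq> b}) (k ` ({a} \<times> L))"
    using homeomorphic_map_closedness_eq[OF k] by simp
  then obtain C where C: "closedin X C" "k ` ({a} \<times> L) = C \<inter> {x. p x \<noteq> b}"
    by (auto simp: closedin_subtopology)
  have "k ` ({a} \<times> L) \<subseteq> A" using k_fibre LF by blast
  moreover have "A \<subseteq> {x. p x \<noteq> b}" using ab by auto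
  ultimately have "k ` ({a} \<times> L) = C \<inter> A" using C(2) by blast
  then show ?thesis using closedin_Int[OF C(1) closed_fibre] by simp
qed

lemma k_embedding:
  "homeomorphic_map P (subtopology X (k ` topspace P)) k"
  "openin X (k ` topspace P)"
proof -
  have "subtopology X (k ` topspace P) = subtopology X {x. p x \<noteq> b}"
    unfolding k_image using subtopology_restrict[of X "{x. p x \<noteq> b}"] by (simp add: Collect_conj_eq)
  then show "homeomorphic_map P (subtopology X (k ` topspace P)) k" using k by simp
  show "openin X (k ` topspace P)" unfolding k_image by (rule open_chart)
qed

lemma k_continuous: "continuous_map P X k"
  using homeomorphic_imp_continuous_map[OF k] continuous_map_in_subtopology by blast

lemma k_local_iso:
  assumes "closedin F L"
  shows "local_hom n P ({a} \<times> L) X (k ` ({a} \<times> L)) k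
     \<in> iso (local_homology n P ({a} \<times> L)) (local_homology n X (k ` ({a} \<times> L)))"
proof (rule open_embedding_local_homology_iso[OF k_embedding _ closed_k_image[OF assms]])
  show "{a} \<times> L \<subseteq> topspace P"
    using a ab closedin_subset[OF assms] by auto
qed

lemma k_complement:
  assumes "closedin F L"
  shows "k \<in> (topspace P - {a} \<times> L) \<rightarrow> (topspace X - k ` ({a} \<times> L))"
proof
  fix z assume z: "z \<in> topspace P - {a} \<times> L"
  have "{a} \<times> L \<subseteq> topspace P"
    using a ab closedin_subset[OF assms] by auto
  then have "k z \<notin> k ` ({a} \<times> L)"
    using z k_inj by (auto dest: inj_onD)
  moreover have "k z \<in> topspace X" using z k_image by blast
  ultimately show "k z \<in> topspace X - k ` ({a} \<times> L)" by simp
qed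

text \<open>One fixed choice serves all \<open>L\<close>, so that the transfers for the whole fibre
  and for a single point of it can be compared by naturality.\<close>

definition \<sigma> :: "int \<Rightarrow> 'f topology \<Rightarrow> 'f set \<Rightarrow> 'f chain set \<Rightarrow> ('e \<times> 'f) chain set" where
  "\<sigma> = (SOME \<sigma>. natural_suspension (top_of_set (sphere 0 1 - {b})) a 5 \<sigma>)"

lemma \<sigma>: "natural_suspension (top_of_set (sphere 0 1 - {b})) a 5 \<sigma>"
  unfolding \<sigma>_def using natural_suspension_punctured_sphere(2)[OF a b ab dim_base] by (rule someI_ex)

text \<open>A Thom-type isomorphism: suspension along the five base directions, then excision from
  the chart into the total space.\<close>

definition transfer where
  "transfer L = local_hom 8 P ({a} \<times> L) X (k ` ({a} \<times> L)) k \<circ> \<sigma> 3 F L"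

lemma transfer_iso:
  assumes "closedin F L"
  shows "transfer L \<in> iso (local_homology 3 F L) (local_homology 8 X (k ` ({a} \<times> L)))"
  unfolding transfer_def
proof (rule iso_set_trans[OF _ k_local_iso[OF assms]])
  show "\<sigma> 3 F L \<in> iso (local_homology 3 F L) (local_homology 8 P ({a} \<times> L))"
    using natural_suspension_iso[OF \<sigma> assms, of 3] by simp
qed

lemma transfer_natural:
  assumes L: "closedin F L" and L': "closedin F L'" and \<phi>: "continuous_map F F \<phi>"
    and \<phi>L: "\<phi> \<in> (topspace F - L) \<rightarrow> (topspace F - L')" and u: "u \<in> carrier (local_homology 3 F L)"
    and f: "continuous_map X X f"
    and fL: "f \<in> (topspace X - k ` ({a} \<times> L)) \<rightarrow> (topspace X - k ` ({a} \<times> L'))"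
    and fk: "\<And>w q. \<lbrakk>w \<in> sphere 0 1 - {b}; q \<in> sphere 0 1\<rbrakk> \<Longrightarrow> f (k (w, q)) = k (w, \<phi> q)"
  shows "local_hom 8 X (k ` ({a} \<times> L)) X (k ` ({a} \<times> L')) f (transfer L u)
       = transfer L' (local_hom 3 F L F L' \<phi> u)"
proof -
  let ?\<phi> = "map_prod id \<phi> :: 'e \<times> 'f \<Rightarrow> _"
  have c\<phi>: "continuous_map P P ?\<phi>"
    unfolding map_prod_def continuous_map_prod_top by (intro disjI2 conjI \<phi>) simp
  have \<phi>F: "\<phi> q \<in> topspace F" if "q \<in> topspace F" for q
    using continuous_map_funspace[OF \<phi>] that by auto
  have \<phi>P: "?\<phi> \<in> (topspace P - {a} \<times> L) \<rightarrow> (topspace P - {a} \<times> L')"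
    using \<phi>L \<phi>F by (auto simp: topspace_P Pi_iff simp del: topspace_prod_topology)
  let ?s = "\<sigma> 3 F L u"
  have "local_hom 8 X (k ` ({a} \<times> L)) X (k ` ({a} \<times> L')) f (transfer L u)
      = local_hom 8 P ({a} \<times> L) X (k ` ({a} \<times> L')) (f \<circ> k) ?s"
  proof -
    have t: "transfer L u = local_hom 8 P ({a} \<times> L) X (k ` ({a} \<times> L)) k ?s"
      by (simp add: transfer_def)
    show ?thesis unfolding t by (rule local_hom_compose[OF k_continuous k_complement[OF L] f fL])
  qed
  also have "\<dots> = local_hom 8 P ({a} \<times> L) X (k ` ({a} \<times> L')) (k \<circ> ?\<phi>) ?s"
  proof -
    have "(f \<circ> k) z = (k \<circ> ?\<phi>) z" if "z \<in> topspace P" for z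
      using that fk by (cases z) (auto simp: topspace_P)
    then show ?thesis by (simp only: hom_induced_eq[of P "f \<circ> k" "k \<circ> ?\<phi>"])
  qed
  also have "\<dots> = local_hom 8 P ({a} \<times> L') X (k ` ({a} \<times> L')) k (local_hom 8 P ({a} \<times> L) P ({a} \<times> L') ?\<phi> ?s)"
    by (rule local_hom_compose[OF c\<phi> \<phi>P k_continuous k_complement[OF L'], symmetric])
  also have "local_hom 8 P ({a} \<times> L) P ({a} \<times> L') ?\<phi> ?s = \<sigma> 3 F L' (local_hom 3 F L F L' \<phi> u)"
    using natural_suspension_natural[OF \<sigma> L L' \<phi> \<phi>L u] by simp
  finally show ?thesis by (simp add: transfer_def)
qed

abbreviation relativize where "relativize \<equiv> hom_induced 8 X {} X (topspace X - A) id"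

text \<open>Away from the fibre over \<open>a\<close>, the space is a contractible base times a
  three-sphere, so its H_8 and H_7 vanish; the exact sequence of the pair does the rest.\<close>

lemma relativize_iso: "relativize \<in> iso (homology_group 8 X) (local_homology 8 X A)"
proof -
  let ?S = "subtopology X (topspace X - A)"
  let ?V = "top_of_set (sphere 0 1 - {a})"
  have "subtopology X (topspace X - A) = subtopology X {x. p x \<noteq> a}"
  proof -
    have "topspace X \<inter> {x. p x \<noteq> a} = topspace X - A" by auto
    then show ?thesis using subtopology_restrict[of X "{x. p x \<noteq> a}"] by simp
  qed
  with l have l': "homeomorphic_map (prod_topology ?V F) ?S l" by simp
  have triv: "trivial_group (homology_group n ?S)" if "n \<noteq> 0" "n \<noteq> 3" for n
  proof -
    have "homology_group n (prod_topology ?V F) \<cong> homology_group n ?S"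
      using homeomorphic_map_homology_iso[OF l'] unfolding is_iso_def by blast
    moreover have "homology_group n (prod_topology ?V F) \<cong> homology_group n F"
    proof -
      have "contractible_space ?V"
        using contractible_punctured_sphere[OF a, where 'v = "real \<times> real \<times> real \<times> real \<times> real"] dim_base by simp
      moreover have "topspace ?V \<noteq> {}" using b ab by auto
      ultimately show ?thesis using snd_homology_iso_contractible[of ?V n F] unfolding is_iso_def by blast
    qed
    ultimately have "homology_group n F \<cong> homology_group n ?S"
      using iso_trans group.iso_sym[OF group_relative_homology_group] by blast
    then show ?thesis
      using homology_sphere3(2)[OF dim_fibre that] isomorphic_group_triviality[of "homology_group n F" "homology_group n ?S"] by simp
  qed
  have "exact_seq ([homology_group (8 - 1) ?S, local_homology 8 X A, homology_group 8 X, homology_group 8 ?S],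
      [hom_boundary 8 X (topspace X - A), relativize, hom_induced 8 ?S {} X {} id])"
    using homology_exactness_axiom_1[of 8 X "topspace X - A"] homology_exactness_axiom_3[of 8 X "topspace X - A"]
    by simp
  then show ?thesis
    by (rule very_short_exact_sequence) (auto intro: triv)
qed

lemma whole_fibre: "closedin F (topspace F)" "local_homology n F (topspace F) = homology_group n F"
  by simp_all

lemma transfer_whole_iso: "transfer (topspace F) \<in> iso (homology_group 3 F) (local_homology 8 X A)"
  using transfer_iso[OF whole_fibre(1)] unfolding whole_fibre(2) k_fibre .

definition fibre_iso where
  "fibre_iso = inv_into (carrier (homology_group 8 X)) relativize \<circ> transfer (topspace F)"

lemma fibre_iso: "fibre_iso \<in> iso (homology_group 3 F) (homology_group 8 X)"
  unfolding fibre_iso_def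
  by (rule iso_set_trans[OF transfer_whole_iso group.iso_set_sym[OF group_relative_homology_group relativize_iso]])

lemma relativize_fibre_iso:
  assumes "u \<in> carrier (homology_group 3 F)"
  shows "relativize (fibre_iso u) = transfer (topspace F) u"
  unfolding fibre_iso_def o_apply
  by (rule iso_inv_into(2)[OF relativize_iso hom_in_carrier[OF iso_imp_homomorphism[OF transfer_whole_iso] assms]])

lemma top_homology: "homology_group 8 X \<cong> integer_group"
proof -
  have "homology_group 3 F \<cong> homology_group 8 X"
    using fibre_iso unfolding is_iso_def by blast
  then have "homology_group 8 X \<cong> homology_group 3 F" by (simp add: group.iso_sym)
  then show ?thesis using homology_sphere3(1)[OF dim_fibre] by (rule iso_trans)
qed

text \<open>The same \<open>\<phi>\<close> occurs over every base point of the chart, so there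
  \<open>f\<close> is the identity times \<open>\<phi>\<close>, and naturality of the suspension
  carries the degree of \<open>\<phi>\<close> from H_3 of the fibre to H_8.\<close>

lemma fibrewise_degree:
  assumes f: "continuous_map X X f" and pf: "\<And>x. x \<in> topspace X \<Longrightarrow> p (f x) = p x"
    and fk: "\<And>w q. \<lbrakk>w \<in> sphere 0 1 - {b}; q \<in> sphere 0 1\<rbrakk> \<Longrightarrow> f (k (w, q)) = k (w, \<phi> q)"
    and \<phi>: "continuous_map F F \<phi>"
    and deg: "\<And>u. u \<in> carrier (homology_group 3 F) \<Longrightarrow>
        hom_induced 3 F {} F {} \<phi> u = u [^]\<^bsub>homology_group 3 F\<^esub> (d::int)"
    and z: "z \<in> carrier (homology_group 8 X)"
  shows "hom_induced 8 X {} X {} f z = z [^]\<^bsub>homology_group 8 X\<^esub> d"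
proof -
  let ?u = "inv_into (carrier (homology_group 3 F)) fibre_iso z"
  have u: "?u \<in> carrier (homology_group 3 F)" "fibre_iso ?u = z"
    using iso_inv_into[OF fibre_iso z] by auto
  have rz: "relativize z = transfer (topspace F) ?u"
    using relativize_fibre_iso[OF u(1)] u(2) by simp
  have fA: "f \<in> (topspace X - A) \<rightarrow> (topspace X - A)"
    using continuous_map_funspace[OF f] pf by auto
  interpret R: group_hom "homology_group 8 X" "local_homology 8 X A" relativize
    by (simp add: group_hom_def group_hom_axioms_def hom_induced_hom)
  interpret T: group_hom "homology_group 3 F" "local_homology 8 X A" "transfer (topspace F)"
    using iso_imp_homomorphism[OF transfer_whole_iso] by (simp add: group_hom_def group_hom_axioms_def)
  have "relativize (hom_induced 8 X {} X {} f z) = hom_induced 8 X {} X (topspace X - A) (id \<circ> f) z"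
    by (rule hom_induced_compose'[OF f]) auto
  also have "\<dots> = hom_induced 8 X {} X (topspace X - A) (f \<circ> id) z" by simp
  also have "\<dots> = local_hom 8 X A X A f (relativize z)"
    by (rule hom_induced_compose'[OF _ _ f fA, symmetric]) auto
  also have "\<dots> = transfer (topspace F) (hom_induced 3 F {} F {} \<phi> ?u)"
  proof -
    have "\<phi> \<in> topspace F - topspace F \<rightarrow> topspace F - topspace F" by simp
    moreover have "f \<in> topspace X - k ` ({a} \<times> topspace F) \<rightarrow> topspace X - k ` ({a} \<times> topspace F)"
      unfolding k_fibre by (rule fA)
    ultimately show ?thesis
      using transfer_natural[OF whole_fibre(1) whole_fibre(1) \<phi> _ _ f _ fk, of ?u] u(1)
      unfolding rz k_fibre Diff_cancel by simp
  qed
  also have "\<dots> = relativize z [^]\<^bsub>local_homology 8 X A\<^esub> d"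
    unfolding deg[OF u(1)] rz by (rule T.hom_int_pow[OF u(1)])
  also have "\<dots> = relativize (z [^]\<^bsub>homology_group 8 X\<^esub> d)"
    by (rule R.hom_int_pow[OF z, symmetric])
  finally have "relativize (hom_induced 8 X {} X {} f z) = relativize (z [^]\<^bsub>homology_group 8 X\<^esub> d)" .
  moreover have "inj_on relativize (carrier (homology_group 8 X))"
    using relativize_iso by (simp add: iso_def bij_betw_def)
  moreover have "hom_induced 8 X {} X {} f z \<in> carrier (homology_group 8 X)"
    by (rule hom_induced_carrier)
  ultimately show ?thesis
    using z by (simp add: inj_on_def)
qed

text \<open>Through \<open>fibre_iso\<close>, restriction to the point \<open>q\<close> becomes
  restriction from the fibre sphere to \<open>s\<close>, by naturality of the transfer under
  shrinking \<open>L\<close> to a point. The latter is an isomorphism as the punctured sphere is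
  contractible.\<close>

lemma local_degree_iso:
  assumes s: "s \<in> topspace F"
  defines "q \<equiv> k (a, s)"
  shows "hom_induced 8 X {} X (topspace X - {q}) id \<in> iso (homology_group 8 X) (local_homology 8 X {q})"
proof (rule iso_cancel_right[OF fibre_iso])
  let ?i = "hom_induced 3 F {} F (topspace F - {s}) id"
  have kq: "k ` ({a} \<times> {s}) = {q}" by (simp add: q_def)
  have clo: "closedin F {s}" using s by simp
  have i: "?i \<in> iso (homology_group 3 F) (local_homology 3 F {s})"
    using sphere3_punctured_iso[of s 3] s dim_fibre by (simp add: un_reduced_homology_group)
  have t: "transfer {s} \<in> iso (local_homology 3 F {s}) (local_homology 8 X {q})"
    using transfer_iso[OF clo] unfolding kq .
  show "transfer {s} \<circ> ?i \<in> iso (homology_group 3 F) (local_homology 8 X {q})"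
    by (rule iso_set_trans[OF i t])
  fix u assume u: "u \<in> carrier (homology_group 3 F)"
  have qA: "q \<in> A" using k_fibre s unfolding q_def by blast
  then have idA: "id \<in> topspace X - A \<rightarrow> topspace X - {q}" by auto
  have "hom_induced 8 X {} X (topspace X - {q}) (id \<circ> id) (fibre_iso u)
      = local_hom 8 X A X {q} id (relativize (fibre_iso u))"
    by (rule hom_induced_compose'[symmetric]) (use idA in auto)
  also have "\<dots> = local_hom 8 X A X {q} id (transfer (topspace F) u)"
    by (simp only: relativize_fibre_iso[OF u])
  also have "\<dots> = transfer {s} (?i u)"
  proof -
    have "local_hom 8 X (k ` ({a} \<times> topspace F)) X (k ` ({a} \<times> {s})) id (transfer (topspace F) u)
       = transfer {s} (local_hom 3 F (topspace F) F {s} id u)"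
      by (rule transfer_natural[OF whole_fibre(1) clo]) (use u idA k_fibre kq in auto)
    then show ?thesis unfolding k_fibre kq Diff_cancel .
  qed
  finally show "hom_induced 8 X {} X (topspace X - {q}) id (fibre_iso u) = (transfer {s} \<circ> ?i) u"
    by simp
qed (rule hom_induced_hom)

end

subsection \<open>Special unitary matrices\<close>

type_synonym cvec3 = "complex ^ 3"
type_synonym cmat3 = "complex ^ 3 ^ 3"

definition cnj_mat :: "complex ^ 'n ^ 'm \<Rightarrow> complex ^ 'n ^ 'm" where
  "cnj_mat A = (\<chi> i j. cnj (A $ i $ j))"

definition cnj_vec :: "complex ^ 'n \<Rightarrow> complex ^ 'n" where
  "cnj_vec v = (\<chi> i. cnj (v $ i))"

lemma cnj_mat_nth [simp]: "cnj_mat A $ i $ j = cnj (A $ i $ j)"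
  by (simp add: cnj_mat_def)

lemma cnj_vec_nth [simp]: "cnj_vec v $ i = cnj (v $ i)"
  by (simp add: cnj_vec_def)

lemma conj_transpose_eq: "conj_transpose A = cnj_mat (transpose A)" "conj_transpose A = transpose (cnj_mat A)"
  by (simp_all add: conj_transpose_def map_matrix_def vec_eq_iff transpose_def)

lemma conj_transpose_nth [simp]: "conj_transpose A $ i $ j = cnj (A $ j $ i)"
  by (simp add: conj_transpose_eq transpose_def)

lemma transpose_nth [simp]: "transpose A $ i $ j = A $ j $ i"
  by (simp add: transpose_def)

lemma cnj_mat_mult: "cnj_mat (A ** B) = cnj_mat A ** cnj_mat B"
  by (simp add: vec_eq_iff matrix_matrix_mult_def)

lemma cnj_mat_vec: "cnj_vec (A *v x) = cnj_mat A *v cnj_vec x"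
  by (simp add: vec_eq_iff matrix_vector_mult_def)

lemma cnj_involutions [simp]: "cnj_mat (cnj_mat A) = A" "cnj_vec (cnj_vec v) = v"
  "conj_transpose (conj_transpose A) = A" "cnj_mat (transpose A) = conj_transpose A"
  "transpose (cnj_mat A) = conj_transpose A" "cnj_mat (conj_transpose A) = transpose A"
  "transpose (conj_transpose A) = cnj_mat A" "conj_transpose (cnj_mat A) = transpose A"
  "conj_transpose (transpose A) = cnj_mat A" "cnj_mat (mat 1) = mat 1"
  "conj_transpose (mat 1) = mat 1"
  by (simp_all add: vec_eq_iff mat_def)

lemma conj_transpose_mult: "conj_transpose (A ** B) = conj_transpose B ** conj_transpose A"
  unfolding conj_transpose_eq(1) matrix_transpose_mul cnj_mat_mult ..

lemma norm_cnj_vec [simp]: "norm (cnj_vec v) = norm v"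
  by (simp add: norm_vec_def)

lemma det_cnj_mat: "det (cnj_mat A) = cnj (det A)"
  by (simp add: det_def)

lemma det_conj_transpose: "det (conj_transpose A) = cnj (det A)"
  unfolding conj_transpose_eq(1) det_cnj_mat det_transpose ..

lemma SU_I:
  assumes "A ** conj_transpose A = mat 1" "det A = 1"
  shows "A \<in> SU"
  using assms matrix_left_right_inverse[of A "conj_transpose A"] by (simp add: SU_def)

lemma SU_D:
  assumes "A \<in> SU"
  shows "A ** conj_transpose A = mat 1" "conj_transpose A ** A = mat 1" "det A = 1"
  using assms by (simp_all add: SU_def)

lemma SU_mult: "A \<in> SU \<Longrightarrow> B \<in> SU \<Longrightarrow> A ** B \<in> SU"
  by (rule SU_I) (simp_all add: conj_transpose_mult det_mul SU_D
      matrix_mul_assoc[symmetric] matrix_mul_assoc[of B "conj_transpose B"])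

lemma SU_cnj: "A \<in> SU \<Longrightarrow> cnj_mat A \<in> SU"
proof (rule SU_I)
  assume A: "A \<in> SU"
  have "cnj_mat (A ** conj_transpose A) = mat 1" using SU_D(1)[OF A] by simp
  then show "cnj_mat A ** conj_transpose (cnj_mat A) = mat 1" by (simp add: cnj_mat_mult)
qed (simp add: det_cnj_mat SU_D)

lemma SU_conj_transpose: "A \<in> SU \<Longrightarrow> conj_transpose A \<in> SU"
  by (rule SU_I) (simp_all add: SU_D det_conj_transpose)

lemma SU_transpose: "A \<in> SU \<Longrightarrow> transpose A \<in> SU"
  using SU_conj_transpose[OF SU_cnj, of A] by simp

lemma SU_cnj_transpose: "A \<in> SU \<Longrightarrow> transpose A ** cnj_mat A = mat 1"
  using SU_D(1)[OF SU_transpose, of A] by simp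

lemma SU_mat_1: "mat 1 \<in> SU"
  by (rule SU_I) simp_all

lemma SU_cancel:
  assumes "A \<in> SU"
  shows "conj_transpose A ** (A ** B) = B" "A ** (conj_transpose A ** B) = B"
    "conj_transpose A *v (A *v v) = v" "A *v (conj_transpose A *v v) = v"
    "B ** A ** conj_transpose A = B" "B ** conj_transpose A ** A = B"
  using SU_D[OF assms] by (simp_all add: matrix_mul_assoc matrix_vector_mul_assoc)
    (simp_all add: matrix_mul_assoc[symmetric])

lemma continuous_on_matrix_mult [continuous_intros]:
  fixes f :: "'a::topological_space \<Rightarrow> complex ^ 'n ^ 'm" and g :: "'a \<Rightarrow> complex ^ 'k ^ 'n"
  assumes "continuous_on S f" "continuous_on S g"
  shows "continuous_on S (\<lambda>x. f x ** g x)"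
  unfolding matrix_matrix_mult_def by (intro continuous_intros assms)

lemma continuous_on_matrix_vec [continuous_intros]:
  fixes f :: "'a::topological_space \<Rightarrow> complex ^ 'n ^ 'm" and g :: "'a \<Rightarrow> complex ^ 'n"
  assumes "continuous_on S f" "continuous_on S g"
  shows "continuous_on S (\<lambda>x. f x *v g x)"
  unfolding matrix_vector_mult_def by (intro continuous_intros assms)

lemma continuous_on_transpose [continuous_intros]:
  fixes f :: "'a::topological_space \<Rightarrow> complex ^ 'n ^ 'm"
  assumes "continuous_on S f"
  shows "continuous_on S (\<lambda>x. transpose (f x))" "continuous_on S (\<lambda>x. cnj_mat (f x))"
    "continuous_on S (\<lambda>x. conj_transpose (f x))"
  unfolding conj_transpose_eq transpose_def cnj_mat_def by (intro continuous_intros assms)+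

lemma continuous_on_cnj_vec [continuous_intros]:
  fixes f :: "'a::topological_space \<Rightarrow> complex ^ 'n"
  assumes "continuous_on S f"
  shows "continuous_on S (\<lambda>x. cnj_vec (f x))"
  unfolding cnj_vec_def by (intro continuous_intros assms)

lemma continuous_on_det [continuous_intros]:
  fixes f :: "'a::topological_space \<Rightarrow> complex ^ 'n ^ 'n"
  assumes "continuous_on S f"
  shows "continuous_on S (\<lambda>x. det (f x))"
  unfolding det_def by (intro continuous_intros assms)

section \<open>Unit vectors in complex three-space and local frames\<close>

lemma norm_cvec3: "(norm (w :: cvec3))\<^sup>2 = (cmod (w $ 1))\<^sup>2 + (cmod (w $ 2))\<^sup>2 + (cmod (w $ 3))\<^sup>2"
  by (simp add: norm_vec_def L2_set_def sum_3)

lemma sphere_cvec3: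
  assumes "w \<in> sphere (0 :: cvec3) 1"
  shows "w $ 1 * cnj (w $ 1) + w $ 2 * cnj (w $ 2) + w $ 3 * cnj (w $ 3) = 1"
proof -
  have "complex_of_real ((norm w)\<^sup>2) = 1" using assms by simp
  then show ?thesis unfolding norm_cvec3 by (simp add: complex_norm_square del: of_real_power)
qed

abbreviation e3 :: cvec3 where "e3 \<equiv> axis 3 1"

lemma e3_nth: "e3 $ 1 = 0" "e3 $ 2 = 0" "e3 $ 3 = 1"
  by (simp_all add: axis_def)

lemma mult_e3 [simp]: "(A *v e3) $ i = (A :: cmat3) $ i $ 3"
  by (simp add: matrix_vector_mult_def sum_3 e3_nth)

lemma e3_sphere: "e3 \<in> sphere 0 1" "- e3 \<in> sphere 0 1" "e3 \<noteq> - e3"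
  using minus_sphere_neq[of e3] by simp_all

lemma cnj_e3 [simp]: "cnj_vec e3 = e3"
  by (simp add: vec_eq_iff axis_def)

lemma norm_SU_mult:
  assumes "(A :: cmat3) \<in> SU"
  shows "norm (A *v e3) = 1"
proof -
  have "(conj_transpose A ** A) $ 3 $ 3 = 1" using SU_D(2)[OF assms] by (simp add: mat_def)
  then have "complex_of_real ((norm (A *v e3))\<^sup>2) = 1"
    unfolding norm_cvec3 by (simp add: matrix_matrix_mult_def sum_3 complex_norm_square mult.commute del: of_real_power)
  then have "(norm (A *v e3))\<^sup>2 = 1" using of_real_eq_1_iff by blast
  then show ?thesis by (simp add: power2_eq_1_iff) (metis norm_ge_zero not_one_le_zero neg_0_le_iff_le zero_le_one order_trans)
qed

definition diag3 :: "complex \<Rightarrow> complex \<Rightarrow> complex \<Rightarrow> cmat3" where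
  "diag3 x y z = (\<chi> i j. if i = j then (if i = 1 then x else if i = 2 then y else z) else 0)"

lemma diag3_nth [simp]:
  "diag3 x y z $ 1 $ 1 = x" "diag3 x y z $ 1 $ 2 = 0" "diag3 x y z $ 1 $ 3 = 0"
  "diag3 x y z $ 2 $ 1 = 0" "diag3 x y z $ 2 $ 2 = y" "diag3 x y z $ 2 $ 3 = 0"
  "diag3 x y z $ 3 $ 1 = 0" "diag3 x y z $ 3 $ 2 = 0" "diag3 x y z $ 3 $ 3 = z"
  by (simp_all add: diag3_def)

lemma continuous_on_diag3 [continuous_intros]:
  fixes x y z :: "'a::topological_space \<Rightarrow> complex"
  assumes "continuous_on S x" "continuous_on S y" "continuous_on S z"
  shows "continuous_on S (\<lambda>t. diag3 (x t) (y t) (z t))"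
  unfolding diag3_def
proof (intro continuous_on_vec_lambda)
  fix i j :: 3
  show "continuous_on S (\<lambda>t. if i = j then if i = 1 then x t else if i = 2 then y t else z t else 0)"
    using assms by (cases "i = j"; cases "i = 1"; cases "i = 2") simp_all
qed

lemma diag3_SU:
  assumes "x * y * z = 1" "cmod x = 1" "cmod y = 1" "cmod z = 1"
  shows "diag3 x y z \<in> SU"
proof (rule SU_I)
  have "u * cnj u = 1" if "cmod u = 1" for u
    using complex_norm_square[of u] that by simp
  then show "diag3 x y z ** conj_transpose (diag3 x y z) = mat 1"
    using assms by (simp add: vec_eq_iff forall_3 matrix_matrix_mult_def sum_3 mat_def)
  show "det (diag3 x y z) = 1" using assms by (simp add: det_3)
qed

text \<open>The negative of the unitary reflection that carries \<open>- e3\<close> to \<open>w\<close> and fixes the orthogonal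
  complement of \<open>w + e3\<close>.\<close>

definition reflection3 :: "cvec3 \<Rightarrow> cmat3" where
  "reflection3 w = (\<chi> i j. (w + e3) $ i * cnj ((w + e3) $ j) / (1 + cnj (w $ 3)) - (if i = j then 1 else 0))"

text \<open>The determinant is corrected in the first column, which leaves the third column, equal
  to w, untouched.\<close>

definition frame :: "cvec3 \<Rightarrow> cmat3" where
  "frame w = reflection3 w ** diag3 (cnj (det (reflection3 w))) 1 1"

lemma sphere_nth3_neq:
  assumes w: "w \<in> sphere (0 :: cvec3) 1" and "w \<noteq> - e3"
  shows "1 + cnj (w $ 3) \<noteq> 0" "1 + w $ 3 \<noteq> 0"
proof -
  show "1 + w $ 3 \<noteq> 0"
  proof
    assume "1 + w $ 3 = 0"
    then have w3: "w $ 3 = -1" by (simp add: eq_neg_iff_add_eq_0 add.commute)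
    have "(cmod (w $ 1))\<^sup>2 + (cmod (w $ 2))\<^sup>2 + (cmod (w $ 3))\<^sup>2 = 1"
      using w norm_cvec3[of w] by simp
    then have "(cmod (w $ 1))\<^sup>2 + (cmod (w $ 2))\<^sup>2 = 0" by (simp add: w3)
    then have "w $ 1 = 0" "w $ 2 = 0"
      by (simp_all add: sum_power2_eq_zero_iff)
    then have "w = - e3" using w3 by (simp add: vec_eq_iff forall_3 e3_nth)
    with assms show False by simp
  qed
  then show "1 + cnj (w $ 3) \<noteq> 0"
    by (metis complex_cnj_add complex_cnj_one complex_cnj_zero_iff complex_cnj_cnj)
qed

text \<open>For s = w + e3 and \<sigma> = cnj (s $ 3), the squared norm of s is \<sigma> + cnj
  \<sigma>. Divided by \<sigma> * cnj \<sigma> it is 1/\<sigma> + 1/cnj \<sigma>, so the quadratic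
  term of the product cancels the two linear ones.\<close>

lemma reflection3_unitary:
  assumes w: "w \<in> sphere (0 :: cvec3) 1" "w \<noteq> - e3"
  shows "reflection3 w ** conj_transpose (reflection3 w) = mat 1"
proof -
  define s where "s = w + e3"
  define \<sigma> where "\<sigma> = 1 + cnj (w $ 3)"
  have \<sigma>: "\<sigma> \<noteq> 0" "cnj \<sigma> \<noteq> 0" using sphere_nth3_neq[OF w] by (simp_all add: \<sigma>_def)
  have N: "(\<Sum>k\<in>UNIV. s $ k * cnj (s $ k)) = \<sigma> + cnj \<sigma>"
    using sphere_cvec3[OF w(1)] by (simp add: s_def \<sigma>_def sum_3 e3_nth algebra_simps)
  have "(\<Sum>k\<in>UNIV. (s $ i * cnj (s $ k) / \<sigma> - (if i = k then 1 else 0)) * cnj (s $ j * cnj (s $ k) / \<sigma> - (if j = k then 1 else 0)))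
      = (if i = j then 1 else 0)" for i j
  proof -
    have "(\<Sum>k\<in>UNIV. (s $ i * cnj (s $ k) / \<sigma> - (if i = k then 1 else 0)) * cnj (s $ j * cnj (s $ k) / \<sigma> - (if j = k then 1 else 0)))
      = (\<Sum>k\<in>UNIV. s $ i * cnj (s $ j) / (\<sigma> * cnj \<sigma>) * (s $ k * cnj (s $ k))
          - (if j = k then s $ i * cnj (s $ k) / \<sigma> else 0)
          - (if i = k then cnj (s $ j) * s $ k / cnj \<sigma> else 0)
          + (if i = k then (if j = k then 1 else 0) else 0))"
      by (rule sum.cong) (auto simp: algebra_simps)
    also have "\<dots> = s $ i * cnj (s $ j) / (\<sigma> * cnj \<sigma>) * (\<sigma> + cnj \<sigma>)
        - s $ i * cnj (s $ j) / \<sigma> - cnj (s $ j) * s $ i / cnj \<sigma> + (if i = j then 1 else 0)"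
      unfolding sum.distrib sum_subtractf sum_distrib_left[symmetric] N by (simp add: eq_commute)
    also have "\<dots> = (if i = j then 1 else 0)"
      using \<sigma> by (simp add: field_simps)
    finally show ?thesis .
  qed
  then show ?thesis
    unfolding vec_eq_iff matrix_matrix_mult_def mat_def
    by (simp add: reflection3_def s_def[symmetric] \<sigma>_def[symmetric] del: complex_cnj_diff complex_cnj_mult complex_cnj_divide vector_add_component)
qed

lemma frame_SU:
  assumes w: "w \<in> sphere (0 :: cvec3) 1" "w \<noteq> - e3"
  shows "frame w \<in> SU" "frame w *v e3 = w"
proof -
  let ?R = "reflection3 w" and ?D = "diag3 (cnj (det (reflection3 w))) 1 1"
  have R: "?R ** conj_transpose ?R = mat 1" by (rule reflection3_unitary[OF w])
  have "det ?R * det (conj_transpose ?R) = 1" using R by (metis det_I det_mul)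
  then have d: "det ?R * cnj (det ?R) = 1" by (simp add: det_conj_transpose)
  have D: "?D ** conj_transpose ?D = mat 1"
    using d by (simp add: vec_eq_iff forall_3 matrix_matrix_mult_def sum_3 mat_def mult.commute)
  show "frame w \<in> SU"
  proof (rule SU_I)
    have "frame w ** conj_transpose (frame w) = ?R ** (?D ** conj_transpose ?D) ** conj_transpose ?R"
      by (simp add: frame_def conj_transpose_mult matrix_mul_assoc)
    then show "frame w ** conj_transpose (frame w) = mat 1" by (simp add: D R)
    show "det (frame w) = 1" using d by (simp add: frame_def det_mul det_3[of ?D])
  qed
  have "?D *v e3 = e3" by (simp add: vec_eq_iff forall_3 e3_nth)
  moreover have "?R *v e3 = w"
    unfolding vec_eq_iff mult_e3
    using sphere_nth3_neq[OF w] by (auto simp: reflection3_def e3_nth axis_def add.commute)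
  ultimately show "frame w *v e3 = w"
    by (simp add: frame_def matrix_vector_mul_assoc[symmetric])
qed

lemma frame_continuous: "continuous_on (sphere 0 1 - {- e3}) frame"
proof -
  have "continuous_on (sphere 0 1 - {- e3}) reflection3"
    unfolding reflection3_def by (intro continuous_intros) (use sphere_nth3_neq in auto)
  then show ?thesis
    unfolding frame_def by (intro continuous_intros)
qed

text \<open>The diagonal matrix exchanges e3 and -e3 and thereby moves the missing point of
  \<open>frame\<close> from -e3 to e3; its first entry is -1 to make the determinant 1.\<close>

definition frame' :: "cvec3 \<Rightarrow> cmat3" where
  "frame' w = diag3 (-1) 1 (-1) ** frame (diag3 (-1) 1 (-1) *v w)"

lemma flip_SU: "diag3 (-1) 1 (-1) \<in> SU"
  by (rule diag3_SU) auto

lemma flip_vec: "diag3 (-1) 1 (-1) *v w = (\<chi> i. if i = 2 then w $ 2 else - w $ i)"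
  by (simp add: vec_eq_iff forall_3 matrix_vector_mult_def sum_3)

lemma flip_sphere:
  assumes "w \<in> sphere (0 :: cvec3) 1" "w \<noteq> e3"
  shows "diag3 (-1) 1 (-1) *v w \<in> sphere 0 1" "diag3 (-1) 1 (-1) *v w \<noteq> - e3"
proof -
  have "(norm (diag3 (-1) 1 (-1) *v w))\<^sup>2 = (norm w)\<^sup>2"
    unfolding norm_cvec3 by (simp add: flip_vec)
  then show "diag3 (-1) 1 (-1) *v w \<in> sphere 0 1" using assms by (simp add: power2_eq_iff_nonneg)
  show "diag3 (-1) 1 (-1) *v w \<noteq> - e3"
    using assms(2) by (auto simp: flip_vec vec_eq_iff forall_3 e3_nth)
qed

lemma frame'_SU:
  assumes w: "w \<in> sphere (0 :: cvec3) 1" "w \<noteq> e3"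
  shows "frame' w \<in> SU" "frame' w *v e3 = w"
proof -
  show "frame' w \<in> SU"
    unfolding frame'_def by (rule SU_mult[OF flip_SU frame_SU(1)[OF flip_sphere[OF w]]])
  have "frame' w *v e3 = diag3 (-1) 1 (-1) *v (diag3 (-1) 1 (-1) *v w)"
    unfolding frame'_def matrix_vector_mul_assoc[symmetric] frame_SU(2)[OF flip_sphere[OF w]] ..
  also have "\<dots> = w" by (simp add: flip_vec vec_eq_iff forall_3)
  finally show "frame' w *v e3 = w" .
qed

lemma frame'_continuous: "continuous_on (sphere 0 1 - {e3}) frame'"
  unfolding frame'_def
  by (intro continuous_on_matrix_mult continuous_on_const continuous_on_compose2[OF frame_continuous] continuous_intros)
    (use flip_sphere in auto)

lemma SU3_transitive:
  assumes "w \<in> sphere (0 :: cvec3) 1"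
  shows "\<exists>A\<in>SU3. A *v e3 = w"
  using frame_SU[OF assms] frame'_SU[OF assms] e3_sphere(3) by metis

section \<open>SU(2) as the stabilizer of e3\<close>

type_synonym quat = "complex \<times> complex"

text \<open>The standard form of SU(2) in the upper left block: the pair is the first row and
  determines the second.\<close>

definition quat_mat :: "quat \<Rightarrow> cmat3" where
  "quat_mat q = (\<chi> i j.
     if i = 1 then (if j = 1 then fst q else if j = 2 then snd q else 0)
     else if i = 2 then (if j = 1 then - cnj (snd q) else if j = 2 then cnj (fst q) else 0)
     else (if j = 3 then 1 else 0))"

definition quat_of :: "cmat3 \<Rightarrow> quat" where
  "quat_of A = (A $ 1 $ 1, A $ 1 $ 2)"

abbreviation S3 :: "quat topology" where "S3 \<equiv> sphere_top"

lemma quat_mat_nth [simp]: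
  "quat_mat q $ 1 $ 1 = fst q" "quat_mat q $ 1 $ 2 = snd q" "quat_mat q $ 1 $ 3 = 0"
  "quat_mat q $ 2 $ 1 = - cnj (snd q)" "quat_mat q $ 2 $ 2 = cnj (fst q)" "quat_mat q $ 2 $ 3 = 0"
  "quat_mat q $ 3 $ 1 = 0" "quat_mat q $ 3 $ 2 = 0" "quat_mat q $ 3 $ 3 = 1"
  by (simp_all add: quat_mat_def)

lemma quat_of_mat [simp]: "quat_of (quat_mat q) = q"
  by (simp add: quat_of_def)

lemma continuous_on_quat_mat [continuous_intros]:
  fixes f :: "'a::topological_space \<Rightarrow> quat"
  assumes "continuous_on S f"
  shows "continuous_on S (\<lambda>x. quat_mat (f x))"
  unfolding quat_mat_def
proof (intro continuous_on_vec_lambda)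
  fix i j :: 3
  show "continuous_on S (\<lambda>x. if i = 1 then (if j = 1 then fst (f x) else if j = 2 then snd (f x) else 0)
     else if i = 2 then (if j = 1 then - cnj (snd (f x)) else if j = 2 then cnj (fst (f x)) else 0)
     else (if j = 3 then 1 else 0))"
    by (cases "i = 1"; cases "i = 2"; cases "j = 1"; cases "j = 2"; cases "j = 3")
      (auto intro!: continuous_intros assms)
qed

lemma continuous_on_quat_of [continuous_intros]:
  fixes f :: "'a::topological_space \<Rightarrow> cmat3"
  assumes "continuous_on S f"
  shows "continuous_on S (\<lambda>x. quat_of (f x))"
  unfolding quat_of_def by (intro continuous_intros assms)

lemma sphere_quat: "q \<in> sphere (0::quat) 1 \<longleftrightarrow> (cmod (fst q))\<^sup>2 + (cmod (snd q))\<^sup>2 = 1"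
  by (simp add: norm_prod_def)

lemma sphere_quat_complex: "q \<in> sphere (0::quat) 1 \<longleftrightarrow> fst q * cnj (fst q) + snd q * cnj (snd q) = 1"
proof -
  have "fst q * cnj (fst q) + snd q * cnj (snd q) = complex_of_real ((cmod (fst q))\<^sup>2 + (cmod (snd q))\<^sup>2)"
    by (simp add: complex_norm_square del: of_real_power)
  then show ?thesis unfolding sphere_quat using of_real_eq_1_iff by metis
qed

lemma quat_mat_SU:
  assumes "q \<in> sphere 0 1"
  shows "quat_mat q \<in> SU" "quat_mat q *v e3 = e3"
proof -
  have q: "fst q * cnj (fst q) + snd q * cnj (snd q) = 1"
    using assms sphere_quat_complex by blast
  show "quat_mat q \<in> SU"
  proof (rule SU_I)
    show "quat_mat q ** conj_transpose (quat_mat q) = mat 1"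
      using q by (simp add: vec_eq_iff forall_3 matrix_matrix_mult_def sum_3 mat_def algebra_simps)
    show "det (quat_mat q) = 1"
      using q by (simp add: det_3 algebra_simps)
  qed
  show "quat_mat q *v e3 = e3"
    by (simp add: vec_eq_iff forall_3 e3_nth)
qed

text \<open>The third row is a unit vector with last entry 1, so its other entries vanish. In the
  remaining block, determinant 1 and orthogonality of the rows are linear equations that determine
  the second row from the first.\<close>

lemma stabilizer_quat:
  assumes G: "G \<in> SU3" "G *v e3 = e3"
  shows "quat_of G \<in> sphere 0 1" "quat_mat (quat_of G) = G"
proof -
  have c: "G $ 1 $ 3 = 0" "G $ 2 $ 3 = 0" "G $ 3 $ 3 = 1"
    using G(2) by (metis mult_e3 e3_nth)+
  have u: "(G ** conj_transpose G) $ i $ j = (if i = j then 1 else 0)" for i j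
    using SU_D(1)[OF G(1)] by (simp add: mat_def)
  have "complex_of_real ((cmod (G $ 3 $ 1))\<^sup>2 + (cmod (G $ 3 $ 2))\<^sup>2) = 0"
    using u[of 3 3] by (simp add: matrix_matrix_mult_def sum_3 c complex_norm_square del: of_real_power)
  then have "(cmod (G $ 3 $ 1))\<^sup>2 + (cmod (G $ 3 $ 2))\<^sup>2 = 0" using of_real_eq_0_iff by blast
  then have r: "G $ 3 $ 1 = 0" "G $ 3 $ 2 = 0"
    by (simp_all add: sum_power2_eq_zero_iff)
  define \<alpha> \<beta> \<gamma> \<delta> where "\<alpha> = G $ 1 $ 1" and "\<beta> = G $ 1 $ 2" and "\<gamma> = G $ 2 $ 1" and "\<delta> = G $ 2 $ 2"
  note d = \<alpha>_def[symmetric] \<beta>_def[symmetric] \<gamma>_def[symmetric] \<delta>_def[symmetric]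
  have n: "\<alpha> * cnj \<alpha> + \<beta> * cnj \<beta> = 1"
    using u[of 1 1] by (simp add: matrix_matrix_mult_def sum_3 c d)
  have o: "cnj \<alpha> * \<gamma> + cnj \<beta> * \<delta> = 0"
    using u[of 2 1] by (simp add: matrix_matrix_mult_def sum_3 c d mult.commute)
  have det: "\<alpha> * \<delta> - \<beta> * \<gamma> = 1"
    using SU_D(3)[OF G(1)] by (simp add: det_3 c r d)
  have "\<delta> = cnj \<alpha>"
  proof -
    have "\<delta> = \<delta> * (\<alpha> * cnj \<alpha> + \<beta> * cnj \<beta>)" by (simp add: n)
    also have "\<dots> = cnj \<alpha> * (\<alpha> * \<delta> - \<beta> * \<gamma>) + \<beta> * (cnj \<alpha> * \<gamma> + cnj \<beta> * \<delta>)" by (simp add: algebra_simps)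
    finally show ?thesis by (simp add: det o)
  qed
  moreover have "\<gamma> = - cnj \<beta>"
  proof -
    have "\<gamma> = \<gamma> * (\<alpha> * cnj \<alpha> + \<beta> * cnj \<beta>)" by (simp add: n)
    also have "\<dots> = \<alpha> * (cnj \<alpha> * \<gamma> + cnj \<beta> * \<delta>) - cnj \<beta> * (\<alpha> * \<delta> - \<beta> * \<gamma>)" by (simp add: algebra_simps)
    finally show ?thesis by (simp add: det o)
  qed
  ultimately show "quat_mat (quat_of G) = G"
    by (simp add: vec_eq_iff forall_3 quat_of_def c r d)
  show "quat_of G \<in> sphere 0 1"
    unfolding sphere_quat_complex using n by (simp add: quat_of_def d)
qed

section \<open>Matrix bundles over the five-sphere\<close>

text \<open>For \<open>c = cnj_vec\<close> this is the bundle with fibre \<open>{B. B (cnj w) = w}\<close>; for the constant map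
  \<open>c = e3\<close> it is the graph of \<open>B \<mapsto> B e3\<close>, a copy of \<open>SU(3)\<close>.\<close>

definition twisted_total :: "(cvec3 \<Rightarrow> cvec3) \<Rightarrow> (cvec3 \<times> cmat3) set" where
  "twisted_total c = {(w, B). w \<in> sphere 0 1 \<and> B \<in> SU3 \<and> B *v c w = w}"

text \<open>As \<open>A w\<close> sends e3 to w and \<open>C w\<close> sends \<open>c w\<close> to
  e3, stripping both from B leaves a matrix fixing e3 whenever B sends \<open>c w\<close> to w. Its
  SU(2) coordinate is the inverse of the chart.\<close>

lemma twisted_chart:
  assumes D: "D = sphere 0 1 - {b}"
    and A: "continuous_on D A" "\<And>w. w \<in> D \<Longrightarrow> A w \<in> SU3" "\<And>w. w \<in> D \<Longrightarrow> A w *v e3 = w"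
    and C: "continuous_on D C" "\<And>w. w \<in> D \<Longrightarrow> C w \<in> SU3" "\<And>w. w \<in> D \<Longrightarrow> C w *v c w = e3"
  shows "homeomorphic_map (prod_topology (top_of_set D) S3)
    (subtopology (top_of_set (twisted_total c)) {z. fst z \<noteq> b}) (\<lambda>(w, q). (w, A w ** quat_mat q ** C w))"
proof -
  let ?T = "twisted_total c \<inter> {z. fst z \<noteq> b}"
  let ?g = "\<lambda>(w, B). (w, quat_of (conj_transpose (A w) ** B ** conj_transpose (C w)))"
  have T: "subtopology (top_of_set (twisted_total c)) {z. fst z \<noteq> b} = top_of_set ?T"
    by (simp add: subtopology_subtopology)
  have ctC: "conj_transpose (C w) *v e3 = c w" if "w \<in> D" for w
    using SU_cancel(3)[OF C(2)[OF that], of "c w"] C(3)[OF that] by simp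
  have ctA: "conj_transpose (A w) *v w = e3" if "w \<in> D" for w
    using SU_cancel(3)[OF A(2)[OF that], of e3] A(3)[OF that] by simp
  have stab: "conj_transpose (A w) ** B ** conj_transpose (C w) \<in> SU3"
      "(conj_transpose (A w) ** B ** conj_transpose (C w)) *v e3 = e3" and wD: "w \<in> D"
    if "(w, B) \<in> ?T" for w B
  proof -
    show w: "w \<in> D" using that by (auto simp: D twisted_total_def)
    have B: "B \<in> SU3" "B *v c w = w" using that by (auto simp: twisted_total_def)
    show "conj_transpose (A w) ** B ** conj_transpose (C w) \<in> SU3"
      by (intro SU_mult SU_conj_transpose A(2) C(2) w B)
    show "(conj_transpose (A w) ** B ** conj_transpose (C w)) *v e3 = e3"
      by (simp only: matrix_vector_mul_assoc[symmetric] ctC[OF w] B(2) ctA[OF w])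
  qed
  have "homeomorphic_maps (top_of_set (D \<times> sphere 0 1)) (top_of_set ?T) (\<lambda>(w, q). (w, A w ** quat_mat q ** C w)) ?g"
    unfolding homeomorphic_maps_def
  proof (intro conjI ballI)
    have "continuous_on (D \<times> sphere 0 1) (\<lambda>(w, q). (w, A w ** quat_mat q ** C w))"
      unfolding case_prod_unfold
      by (intro continuous_intros continuous_on_compose2[OF A(1)] continuous_on_compose2[OF C(1)]) auto
    moreover have "(\<lambda>(w, q). (w, A w ** quat_mat q ** C w)) \<in> D \<times> sphere 0 1 \<rightarrow> ?T"
    proof (rule Pi_I)
      fix z assume "z \<in> D \<times> sphere (0::quat) 1"
      then obtain w q where z: "z = (w, q)" and w: "w \<in> D" and q: "q \<in> sphere (0::quat) 1" by blast
      have "A w ** quat_mat q ** C w \<in> SU3"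
        by (intro SU_mult A(2) C(2) w quat_mat_SU(1)[OF q])
      moreover have "(A w ** quat_mat q ** C w) *v c w = w"
        by (simp only: matrix_vector_mul_assoc[symmetric] C(3)[OF w] quat_mat_SU(2)[OF q] A(3)[OF w])
      ultimately show "(\<lambda>(w, q). (w, A w ** quat_mat q ** C w)) z \<in> ?T"
        using w by (auto simp: z D twisted_total_def)
    qed
    ultimately show "continuous_map (top_of_set (D \<times> sphere 0 1)) (top_of_set ?T) (\<lambda>(w, q). (w, A w ** quat_mat q ** C w))"
      by simp
    have "continuous_on ?T ?g"
      unfolding case_prod_unfold
      by (intro continuous_intros continuous_on_compose2[OF A(1)] continuous_on_compose2[OF C(1)])
        (use wD in auto)
    moreover have "?g \<in> ?T \<rightarrow> D \<times> sphere 0 1"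
    proof (rule Pi_I)
      fix z assume "z \<in> ?T"
      then obtain w B where z: "z = (w, B)" and wB: "(w, B) \<in> ?T" by (cases z) auto
      show "?g z \<in> D \<times> sphere 0 1"
        using stabilizer_quat(1)[OF stab[OF wB]] wD[OF wB] by (simp add: z)
    qed
    ultimately show "continuous_map (top_of_set ?T) (top_of_set (D \<times> sphere 0 1)) ?g"
      by simp
  next
    fix z assume "z \<in> topspace (top_of_set (D \<times> sphere (0::quat) 1))"
    then obtain w q where z: "z = (w, q)" "w \<in> D" "q \<in> sphere 0 1" by auto
    have "conj_transpose (A w) ** (A w ** quat_mat q ** C w) ** conj_transpose (C w) = quat_mat q"
      using SU_cancel(1)[OF A(2)[OF z(2)]] SU_cancel(5)[OF C(2)[OF z(2)]]
      by (simp add: matrix_mul_assoc[symmetric])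
    then show "?g ((\<lambda>(w, q). (w, A w ** quat_mat q ** C w)) z) = z" by (simp add: z(1))
  next
    fix z assume "z \<in> topspace (top_of_set ?T)"
    then obtain w B where z: "z = (w, B)" "(w, B) \<in> ?T" by (cases z) auto
    have "A w ** (conj_transpose (A w) ** B ** conj_transpose (C w)) ** C w = B"
      using SU_cancel(2)[OF A(2)[OF wD[OF z(2)]]] SU_cancel(6)[OF C(2)[OF wD[OF z(2)]]]
      by (simp add: matrix_mul_assoc[symmetric])
    then show "(\<lambda>(w, q). (w, A w ** quat_mat q ** C w)) (?g z) = z"
      using stabilizer_quat(2)[OF stab[OF z(2)]] by (simp add: z(1))
  qed
  then show ?thesis
    unfolding T homeomorphic_map_maps by auto
qed

lemma twisted_total_bundle:
  assumes C: "continuous_on (sphere 0 1 - {- e3}) C" "\<And>w. w \<in> sphere 0 1 - {- e3} \<Longrightarrow> C w \<in> SU3 \<and> C w *v c w = e3"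
    and C': "continuous_on (sphere 0 1 - {e3}) C'" "\<And>w. w \<in> sphere 0 1 - {e3} \<Longrightarrow> C' w \<in> SU3 \<and> C' w *v c w = e3"
  shows "sphere_bundle (top_of_set (twisted_total c)) fst e3 (- e3)
    (\<lambda>(w, q). (w, frame w ** quat_mat q ** C w)) (\<lambda>(w, q). (w, frame' w ** quat_mat q ** C' w))"
proof
  show "continuous_map (top_of_set (twisted_total c)) (sphere_top :: cvec3 topology) fst"
    by (auto simp: twisted_total_def intro!: continuous_intros)
  show "homeomorphic_map (prod_topology (top_of_set (sphere 0 1 - {- e3})) S3)
     (subtopology (top_of_set (twisted_total c)) {x. fst x \<noteq> - e3}) (\<lambda>(w, q). (w, frame w ** quat_mat q ** C w))"
    by (rule twisted_chart[OF refl frame_continuous _ _ C(1)]) (use frame_SU C(2) in auto)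
  show "homeomorphic_map (prod_topology (top_of_set (sphere 0 1 - {e3})) S3)
     (subtopology (top_of_set (twisted_total c)) {x. fst x \<noteq> e3}) (\<lambda>(w, q). (w, frame' w ** quat_mat q ** C' w))"
    by (rule twisted_chart[OF refl frame'_continuous _ _ C'(1)]) (use frame'_SU C'(2) in auto)
qed (use e3_sphere in auto)

lemma top_homology_SU3: "homology_group 8 (top_of_set SU3) \<cong> integer_group"
proof -
  let ?T = "twisted_total (\<lambda>_. e3)"
  interpret sphere_bundle "top_of_set ?T" fst e3 "- e3" "\<lambda>(w, q). (w, frame w ** quat_mat q ** mat 1)"
    "\<lambda>(w, q). (w, frame' w ** quat_mat q ** mat 1)"
    by (rule twisted_total_bundle) (simp_all add: SU_mat_1)
  have "homeomorphic_maps (top_of_set SU3) (top_of_set ?T) (\<lambda>B. (B *v e3, B)) snd"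
    unfolding homeomorphic_maps_def
    by (auto simp: twisted_total_def norm_SU_mult intro!: continuous_intros)
  then have "top_of_set SU3 homeomorphic_space top_of_set ?T"
    unfolding homeomorphic_space_def by blast
  from homeomorphic_space_imp_isomorphic_homology_groups[OF this] top_homology
  show ?thesis by (rule iso_trans)
qed

abbreviation \<E> :: "(cvec3 \<times> cmat3) set" where "\<E> \<equiv> twisted_total cnj_vec"

lemma transpose_cnj_vec:
  assumes "A \<in> SU3" "A *v e3 = w"
  shows "transpose A \<in> SU3" "transpose A *v cnj_vec w = e3"
proof -
  have "conj_transpose A *v w = e3" using SU_cancel(3)[OF assms(1), of e3] assms(2) by simp
  then have "cnj_vec (conj_transpose A *v w) = e3" by simp
  then show "transpose A *v cnj_vec w = e3" by (simp add: cnj_mat_vec)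
qed (rule SU_transpose[OF assms(1)])

text \<open>The right factor is the transposed frame because that matrix sends cnj w to e3. The
  resulting shape A q A^T is the group action itself, so an equivariant map acts on q by one and the
  same map over every w.\<close>

abbreviation \<E>_chart :: "cvec3 \<times> quat \<Rightarrow> cvec3 \<times> cmat3" where
  "\<E>_chart \<equiv> \<lambda>(w, q). (w, frame w ** quat_mat q ** transpose (frame w))"

abbreviation \<E>_chart' :: "cvec3 \<times> quat \<Rightarrow> cvec3 \<times> cmat3" where
  "\<E>_chart' \<equiv> \<lambda>(w, q). (w, frame' w ** quat_mat q ** transpose (frame' w))"

lemma \<E>_bundle: "sphere_bundle (top_of_set \<E>) fst e3 (- e3) \<E>_chart \<E>_chart'"
  by (rule twisted_total_bundle)
    (use frame_continuous frame'_continuous frame_SU frame'_SU transpose_cnj_vec in \<open>auto intro!: continuous_intros\<close>)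

subsection \<open>The equivariant maps\<close>

text \<open>An alternating word in B and cnj B with 2 m + 1 letters. The odd length is what makes it
  transform like B; a word of even length starting with B would be conjugated by A instead.\<close>

primrec twist_pow :: "nat \<Rightarrow> cmat3 \<Rightarrow> cmat3" where
  "twist_pow 0 B = B"
| "twist_pow (Suc m) B = twist_pow m B ** (cnj_mat B ** B)"

text \<open>Meant for odd \<open>k\<close>. On the normal geodesic of rotations by \<open>t\<close> it multiplies \<open>t\<close> by \<open>k\<close>.\<close>

definition psi :: "int \<Rightarrow> cmat3 \<Rightarrow> cmat3" where
  "psi k B = (if 0 \<le> k then twist_pow (nat (k div 2)) B else transpose (twist_pow (nat ((- k) div 2)) B))"

lemma twist_pow_SU: "B \<in> SU3 \<Longrightarrow> twist_pow m B \<in> SU3"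
  by (induction m) (auto intro: SU_mult SU_cnj)

lemma psi_SU: "B \<in> SU3 \<Longrightarrow> psi k B \<in> SU3"
  by (auto simp: psi_def intro: twist_pow_SU SU_transpose)

lemma twist_pow_equivariant:
  assumes A: "A \<in> SU3"
  shows "twist_pow m (A ** B ** transpose A) = A ** twist_pow m B ** transpose A"
proof (induction m)
  case (Suc m)
  have "A ** P ** transpose A ** (cnj_mat (A ** B ** transpose A) ** (A ** B ** transpose A))
      = A ** P ** (transpose A ** cnj_mat A) ** cnj_mat B ** (conj_transpose A ** A) ** B ** transpose A" for P
    by (simp add: cnj_mat_mult matrix_mul_assoc)
  then show ?case
    using Suc by (simp add: SU_cnj_transpose[OF A] SU_D[OF A] matrix_mul_assoc)
qed simp

lemma psi_equivariant:
  assumes "A \<in> SU3"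
  shows "psi k (A ** B ** transpose A) = A ** psi k B ** transpose A"
  by (simp add: psi_def twist_pow_equivariant[OF assms] matrix_transpose_mul matrix_mul_assoc)

lemma continuous_on_psi: "continuous_on S (psi k)"
proof -
  have "continuous_on S (twist_pow m)" for m
    by (induction m) (auto intro!: continuous_intros)
  then show ?thesis
    unfolding psi_def by (cases "0 \<le> k") (auto intro!: continuous_intros)
qed

text \<open>The first equation is the complex conjugate of the hypothesis; the second is the
  conjugate of the hypothesis solved for cnj w. They let alternating words and transposition stay in
  the fibre over w.\<close>

lemma twisted_fixpoint:
  assumes B: "B \<in> SU3" "B *v cnj_vec w = w"
  shows "cnj_mat B *v w = cnj_vec w" "transpose B *v cnj_vec w = w"
proof -
  have "cnj_vec (B *v cnj_vec w) = cnj_vec w" by (simp add: B(2))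
  then show "cnj_mat B *v w = cnj_vec w" by (simp add: cnj_mat_vec)
  have "conj_transpose B *v w = cnj_vec w"
    using SU_cancel(3)[OF B(1), of "cnj_vec w"] B(2) by simp
  then have "cnj_vec (conj_transpose B *v w) = w" by simp
  then show "transpose B *v cnj_vec w = w" by (simp add: cnj_mat_vec)
qed

lemma psi_fixpoint:
  assumes B: "B \<in> SU3" "B *v cnj_vec w = w"
  shows "psi k B *v cnj_vec w = w"
proof -
  have "twist_pow m B *v cnj_vec w = w" for m
    by (induction m) (simp_all add: B twisted_fixpoint[OF B] matrix_vector_mul_assoc[symmetric])
  then show ?thesis
    by (simp add: psi_def twisted_fixpoint(2)[OF twist_pow_SU[OF B(1)]] del: transpose_matrix_vector)
qed

subsection \<open>Degrees on the fibre\<close>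

definition quat_mult :: "quat \<Rightarrow> quat \<Rightarrow> quat" where
  "quat_mult x y = quat_of (quat_mat x ** quat_mat y)"

definition quat_cnj :: "quat \<Rightarrow> quat" where
  "quat_cnj q = (cnj (fst q), cnj (snd q))"

abbreviation S3_hom :: "(quat \<Rightarrow> quat) \<Rightarrow> quat chain set \<Rightarrow> quat chain set" where
  "S3_hom f \<equiv> hom_induced 3 S3 {} S3 {} f"

lemma stabilizer_mult:
  assumes "A \<in> SU3" "A *v e3 = e3" "B \<in> SU3" "B *v e3 = e3"
  shows "A ** B \<in> SU3" "(A ** B) *v e3 = e3"
  using assms by (simp_all add: SU_mult matrix_vector_mul_assoc[symmetric])

lemma quat_mat_mult:
  assumes "x \<in> sphere 0 1" "y \<in> sphere 0 1"
  shows "quat_mat (quat_mult x y) = quat_mat x ** quat_mat y" "quat_mult x y \<in> sphere 0 1"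
  unfolding quat_mult_def
  using stabilizer_quat[OF stabilizer_mult[OF quat_mat_SU[OF assms(1)] quat_mat_SU[OF assms(2)]]] by simp_all

lemma quat_mat_one: "quat_mat (1, 0) = mat 1"
  by (simp add: vec_eq_iff forall_3 mat_def)

lemma quat_mult_continuous: "continuous_map (prod_topology S3 S3) S3 (\<lambda>(x, y). quat_mult x y)"
proof -
  have "continuous_on (sphere 0 1 \<times> sphere 0 1) (\<lambda>z. quat_mult (fst z) (snd z))"
    unfolding quat_mult_def by (intro continuous_intros)
  then show ?thesis using quat_mat_mult(2) by (auto simp: case_prod_unfold)
qed

lemma quat_mult_additive:
  assumes "continuous_map S3 S3 f" "continuous_map S3 S3 g" "z \<in> carrier (homology_group 3 S3)"
  shows "S3_hom (\<lambda>x. quat_mult (f x) (g x)) z = S3_hom f z \<otimes>\<^bsub>homology_group 3 S3\<^esub> S3_hom g z"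
proof (rule sphere3_multiplication_additive[where e = "(1, 0)", OF _ quat_mult_continuous _ _ _ assms])
  show "(1, 0) \<in> topspace S3" by (simp add: sphere_quat[unfolded mem_sphere_0] norm_prod_def)
qed (simp_all add: quat_mult_def quat_mat_one norm_prod_def)

lemma cnj_quat_mat: "cnj_mat (quat_mat q) = quat_mat (quat_cnj q)"
  by (simp add: vec_eq_iff forall_3 quat_cnj_def)

lemma quat_cnj_continuous: "continuous_map S3 S3 quat_cnj"
  unfolding quat_cnj_def by (auto simp: norm_prod_def intro!: continuous_intros)

lemma S3_hom_homotopy:
  assumes "continuous_on ({0..1} \<times> sphere 0 1) (\<lambda>(t, q). h t q)"
    and "\<And>t q. \<lbrakk>0 \<le> t; t \<le> (1::real); q \<in> sphere 0 1\<rbrakk> \<Longrightarrow> h t q \<in> sphere (0::quat) 1"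
    and "\<And>q. q \<in> sphere 0 1 \<Longrightarrow> h 0 q = q" and "\<And>q. q \<in> sphere 0 1 \<Longrightarrow> h 1 q = f q"
    and u: "u \<in> carrier (homology_group 3 S3)"
  shows "S3_hom f u = u"
proof -
  have "homotopic_with (\<lambda>_. True) S3 S3 (h 0) (h 1)"
    unfolding homotopic_with_def
    by (rule exI[of _ "\<lambda>(t, q). h t q"]) (use assms(1,2) in \<open>auto simp: Pi_iff\<close>)
  then have "homotopic_with (\<lambda>_. True) S3 S3 id f"
    by (rule homotopic_with_eq) (use assms in auto)
  then show ?thesis
    using homology_homotopy_empty hom_induced_id[OF u] by metis
qed

text \<open>Conjugation negates both imaginary parts. The homotopy rotates the real plane they span
  through the angle pi.\<close>

lemma S3_hom_quat_cnj:
  assumes "u \<in> carrier (homology_group 3 S3)"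
  shows "S3_hom quat_cnj u = u"
proof (rule S3_hom_homotopy[OF _ _ _ _ assms])
  let ?h = "\<lambda>t q. (of_real (Re (fst q)) + \<i> * of_real (cos (pi * t) * Im (fst q) - sin (pi * t) * Im (snd q)),
     of_real (Re (snd q)) + \<i> * of_real (sin (pi * t) * Im (fst q) + cos (pi * t) * Im (snd q))) :: quat"
  show "continuous_on ({0..1} \<times> sphere 0 1) (\<lambda>(t, q). ?h t q)"
    unfolding case_prod_unfold by (intro continuous_intros)
  fix q :: quat
  assume q: "q \<in> sphere 0 1"
  show "?h t q \<in> sphere 0 1" for t
  proof -
    have "(c * x - s * y)\<^sup>2 + (s * x + c * y)\<^sup>2 = (c\<^sup>2 + s\<^sup>2) * (x\<^sup>2 + y\<^sup>2)" for c s x y :: real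
      by (simp add: power2_eq_square algebra_simps)
    then have "(cos (pi * t) * x - sin (pi * t) * y)\<^sup>2 + (sin (pi * t) * x + cos (pi * t) * y)\<^sup>2 = x\<^sup>2 + y\<^sup>2" for x y
      by (simp add: add.commute)
    from this[of "Im (fst q)" "Im (snd q)"] show ?thesis
      using q unfolding sphere_quat cmod_power2 by simp
  qed
  show "?h 0 q = q" "?h 1 q = quat_cnj q"
    by (simp_all add: quat_cnj_def prod_eq_iff complex_eq_iff)
qed

lemma S3_hom_minus:
  assumes "u \<in> carrier (homology_group 3 S3)"
  shows "S3_hom uminus u = u"
proof (rule S3_hom_homotopy[OF _ _ _ _ assms])
  let ?h = "\<lambda>t q. (cis (pi * t) * fst q, cis (pi * t) * snd q) :: quat"
  show "continuous_on ({0..1} \<times> sphere 0 1) (\<lambda>(t, q). ?h t q)"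
    unfolding case_prod_unfold by (intro continuous_intros)
  fix q :: quat
  assume q: "q \<in> sphere 0 1"
  show "?h t q \<in> sphere 0 1" for t
    using q unfolding sphere_quat by (simp add: norm_mult)
  show "?h 0 q = q" "?h 1 q = - q"
    by (simp_all add: prod_eq_iff)
qed

definition quat_psi :: "int \<Rightarrow> quat \<Rightarrow> quat" where
  "quat_psi k q = quat_of (psi k (quat_mat q))"

lemma quat_mat_psi:
  assumes "q \<in> sphere 0 1"
  shows "quat_mat (quat_psi k q) = psi k (quat_mat q)" "quat_psi k q \<in> sphere 0 1"
proof -
  have "psi k (quat_mat q) *v e3 = e3"
    using psi_fixpoint[of "quat_mat q" e3 k] quat_mat_SU[OF assms] by simp
  then show "quat_mat (quat_psi k q) = psi k (quat_mat q)" "quat_psi k q \<in> sphere 0 1"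
    unfolding quat_psi_def using stabilizer_quat[OF psi_SU[OF quat_mat_SU(1)[OF assms]]] by simp_all
qed

lemma quat_psi_continuous: "continuous_map S3 S3 (quat_psi k)"
proof -
  have "continuous_on (sphere 0 1) (quat_psi k)"
    unfolding quat_psi_def
    by (intro continuous_intros continuous_on_compose2[OF continuous_on_psi[of UNIV k]]) auto
  then show ?thesis using quat_mat_psi(2) by auto
qed

lemma psi_even_index: "psi (2 * int m + 1) = twist_pow m"
  by (rule ext) (simp add: psi_def)

lemma psi_minus: "0 < k \<Longrightarrow> psi (- k) B = transpose (psi k B)"
  by (simp add: psi_def)

lemma quat_psi_1: "quat_psi 1 q = q"
  using psi_even_index[of 0] by (simp add: quat_psi_def)

text \<open>Each induction step multiplies by the product of cnj q and q. Both factors act as the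
  identity on H_3, so the degree grows by 2.\<close>

lemma S3_hom_psi_nat:
  assumes u: "u \<in> carrier (homology_group 3 S3)"
  shows "S3_hom (quat_psi (2 * int m + 1)) u = u [^]\<^bsub>homology_group 3 S3\<^esub> (2 * int m + 1)"
proof (induction m)
  interpret H: comm_group "homology_group 3 S3" by simp
  case 0
  have "quat_psi (2 * int 0 + 1) = id" by (auto simp: quat_psi_1)
  then show ?case unfolding \<open>_ = id\<close> hom_induced_id[OF u] using u by simp
next
  interpret H: comm_group "homology_group 3 S3" by simp
  case (Suc m)
  let ?f = "quat_psi (2 * int m + 1)"
  have eq: "quat_psi (2 * int (Suc m) + 1) q = quat_mult (?f q) (quat_mult (quat_cnj q) q)" if q: "q \<in> topspace S3" for q
  proof -
    have q: "q \<in> sphere 0 1" "quat_cnj q \<in> sphere 0 1"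
      using q continuous_map_funspace[OF quat_cnj_continuous] by auto
    have "quat_mat (quat_mult (quat_cnj q) q) = cnj_mat (quat_mat q) ** quat_mat q"
      using quat_mat_mult(1)[OF q(2,1)] by (simp add: cnj_quat_mat)
    then have "quat_mult (?f q) (quat_mult (quat_cnj q) q) = quat_of (twist_pow m (quat_mat q) ** (cnj_mat (quat_mat q) ** quat_mat q))"
      unfolding quat_mult_def[of "?f q"] quat_mat_psi(1)[OF q(1)] by (simp add: psi_even_index)
    also have "\<dots> = quat_psi (2 * int (Suc m) + 1) q"
      unfolding quat_psi_def psi_even_index by simp
    finally show ?thesis by simp
  qed
  have id: "continuous_map S3 S3 (\<lambda>q. q)" by simp
  have c: "continuous_map S3 S3 (\<lambda>q. quat_mult (quat_cnj q) q)"
  proof -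
    have "continuous_map S3 (prod_topology S3 S3) (\<lambda>q. (quat_cnj q, q))"
      unfolding continuous_map_paired by (intro conjI quat_cnj_continuous id)
    from continuous_map_compose[OF this quat_mult_continuous] show ?thesis
      by (simp only: o_def case_prod_conv)
  qed
  have "S3_hom (quat_psi (2 * int (Suc m) + 1)) u = S3_hom (\<lambda>q. quat_mult (?f q) (quat_mult (quat_cnj q) q)) u"
    by (subst hom_induced_eq[OF eq]) auto
  also have "\<dots> = S3_hom ?f u \<otimes>\<^bsub>homology_group 3 S3\<^esub> S3_hom (\<lambda>q. quat_mult (quat_cnj q) q) u"
    by (rule quat_mult_additive[OF quat_psi_continuous c u])
  also have "S3_hom (\<lambda>q. quat_mult (quat_cnj q) q) u = u \<otimes>\<^bsub>homology_group 3 S3\<^esub> u"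
    unfolding quat_mult_additive[OF quat_cnj_continuous id u] S3_hom_quat_cnj[OF u]
    using hom_induced_id[OF u] by (simp add: id_def)
  also have "u \<otimes>\<^bsub>homology_group 3 S3\<^esub> u = u [^]\<^bsub>homology_group 3 S3\<^esub> (2::int)"
    using u H.int_pow_mult[of u 1 1] by simp
  also have "S3_hom ?f u \<otimes>\<^bsub>homology_group 3 S3\<^esub> u [^]\<^bsub>homology_group 3 S3\<^esub> (2::int) = u [^]\<^bsub>homology_group 3 S3\<^esub> (2 * int (Suc m) + 1)"
    unfolding Suc using u by (simp add: H.int_pow_mult[symmetric] algebra_simps)
  finally show ?case .
qed

text \<open>For q in SU(2) the transpose times the conjugate is 1. The degrees of transposition and
  conjugation therefore add up to 0, and conjugation has degree 1.\<close>

lemma S3_hom_transpose: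
  assumes u: "u \<in> carrier (homology_group 3 S3)"
  shows "S3_hom (quat_psi (- 1)) u = inv\<^bsub>homology_group 3 S3\<^esub> u"
proof -
  interpret H: comm_group "homology_group 3 S3" by simp
  have eq: "quat_mult (quat_psi (- 1) q) (quat_cnj q) = (1, 0)" if "q \<in> topspace S3" for q
  proof -
    have q: "q \<in> sphere 0 1" using that by simp
    have "psi (- 1) (quat_mat q) = transpose (quat_mat q)" by (simp add: psi_def)
    then show ?thesis
      unfolding quat_mult_def quat_mat_psi(1)[OF q] cnj_quat_mat[symmetric]
      by (simp add: SU_cnj_transpose[OF quat_mat_SU(1)[OF q]]) (simp add: quat_of_def mat_def)
  qed
  have "S3_hom (\<lambda>q. quat_mult (quat_psi (- 1) q) (quat_cnj q)) u = S3_hom (\<lambda>_. (1, 0)) u"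
    by (subst hom_induced_eq[OF eq]) auto
  also have "\<dots> = \<one>\<^bsub>homology_group 3 S3\<^esub>"
    by (rule hom_induced_const) (simp_all add: norm_prod_def)
  finally have "S3_hom (quat_psi (- 1)) u \<otimes>\<^bsub>homology_group 3 S3\<^esub> u = \<one>\<^bsub>homology_group 3 S3\<^esub>"
    unfolding quat_mult_additive[OF quat_psi_continuous quat_cnj_continuous u] S3_hom_quat_cnj[OF u] .
  then show ?thesis
    using H.inv_equality[of "S3_hom (quat_psi (- 1)) u" u] u hom_induced_carrier[of 3 S3 "{}" S3 "{}" "quat_psi (- 1)" u] by simp
qed

lemma S3_hom_psi:
  assumes u: "u \<in> carrier (homology_group 3 S3)" and k: "odd k"
  shows "S3_hom (quat_psi k) u = u [^]\<^bsub>homology_group 3 S3\<^esub> k"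
proof -
  interpret H: comm_group "homology_group 3 S3" by simp
  have pos: "S3_hom (quat_psi k) u = u [^]\<^bsub>homology_group 3 S3\<^esub> k" if "0 < k" "odd k" for k
  proof -
    have "int (nat (k div 2)) = k div 2" using that by simp
    then have "k = 2 * int (nat (k div 2)) + 1" using that by presburger
    then show ?thesis using S3_hom_psi_nat[OF u, of "nat (k div 2)"] by simp
  qed
  show ?thesis
  proof (cases "0 < k")
    case False
    then have k': "0 < - k" "odd (- k)" using k by presburger+
    have "quat_psi k q = (quat_psi (- 1) \<circ> quat_psi (- k)) q" if "q \<in> topspace S3" for q
    proof -
      have q: "q \<in> sphere 0 1" using that by simp
      have "(quat_psi (- 1) \<circ> quat_psi (- k)) q = quat_of (psi (- 1) (psi (- k) (quat_mat q)))"
        using quat_mat_psi[OF q, of "- k"] by (simp add: quat_psi_def[of "- 1"])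
      also have "\<dots> = quat_psi k q"
        using psi_minus[OF k'(1)] by (simp add: quat_psi_def psi_def[of "- 1"])
      finally show ?thesis by simp
    qed
    then have "S3_hom (quat_psi k) u = S3_hom (quat_psi (- 1) \<circ> quat_psi (- k)) u"
      by (simp only: hom_induced_eq[of S3 "quat_psi k" "quat_psi (- 1) \<circ> quat_psi (- k)"])
    also have "\<dots> = S3_hom (quat_psi (- 1)) (S3_hom (quat_psi (- k)) u)"
      by (rule hom_induced_compose'[OF quat_psi_continuous _ quat_psi_continuous, symmetric]) auto
    also have "\<dots> = inv\<^bsub>homology_group 3 S3\<^esub> (u [^]\<^bsub>homology_group 3 S3\<^esub> (- k))"
      unfolding pos[OF k'] by (rule S3_hom_transpose) (simp add: u)
    also have "\<dots> = u [^]\<^bsub>homology_group 3 S3\<^esub> k"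
      using u by (simp add: H.int_pow_neg)
    finally show ?thesis .
  qed (use pos k in auto)
qed

section \<open>The maps and the involution on \<open>\<E>\<close>\<close>

definition \<E>_psi :: "int \<Rightarrow> cvec3 \<times> cmat3 \<Rightarrow> cvec3 \<times> cmat3" where
  "\<E>_psi k = (\<lambda>(w, B). (w, psi k B))"

lemma \<E>_iff: "(w, B) \<in> \<E> \<longleftrightarrow> w \<in> sphere 0 1 \<and> B \<in> SU3 \<and> B *v cnj_vec w = w"
  by (simp add: twisted_total_def)

lemma \<E>_psi_continuous: "continuous_map (top_of_set \<E>) (top_of_set \<E>) (\<E>_psi k)"
proof -
  have "continuous_on \<E> (\<E>_psi k)"
    unfolding \<E>_psi_def case_prod_unfold
    by (intro continuous_intros continuous_on_compose2[OF continuous_on_psi[of UNIV k]]) auto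
  moreover have "\<E>_psi k z \<in> \<E>" if "z \<in> \<E>" for z
    using that psi_SU psi_fixpoint by (cases z) (auto simp: \<E>_psi_def \<E>_iff)
  ultimately show ?thesis by auto
qed

lemma \<E>_psi_degree:
  assumes k: "odd k" and z: "z \<in> carrier (homology_group 8 (top_of_set \<E>))"
  shows "hom_induced 8 (top_of_set \<E>) {} (top_of_set \<E>) {} (\<E>_psi k) z = z [^]\<^bsub>homology_group 8 (top_of_set \<E>)\<^esub> k"
proof (rule sphere_bundle.fibrewise_degree[OF \<E>_bundle \<E>_psi_continuous _ _ quat_psi_continuous S3_hom_psi[OF _ k] z])
  fix w :: cvec3 and q :: quat
  assume w: "w \<in> sphere 0 1 - {- e3}" and q: "q \<in> sphere 0 1"
  have "frame w \<in> SU3" using frame_SU(1)[of w] w by blast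
  then show "\<E>_psi k (\<E>_chart (w, q)) = \<E>_chart (w, quat_psi k q)"
    by (simp add: \<E>_psi_def psi_equivariant quat_mat_psi(1)[OF q])
qed (auto simp: \<E>_psi_def)

text \<open>For B = A q A^T with A e3 = w this is A q D A^T, where D is diagonal with entries cnj c,
  cnj c, c^2. Replacing w by c w in the defining equation asks that cnj w be sent to c^2 w, whence
  the last entry; the other two restore determinant 1. Written in terms of w and B, the formula is
  independent of the choice of A.\<close>

definition turn :: "complex \<Rightarrow> cvec3 \<times> cmat3 \<Rightarrow> cvec3 \<times> cmat3" where
  "turn c = (\<lambda>(w, B). (\<chi> i. c * w $ i, \<chi> i j. cnj c * B $ i $ j + (c\<^sup>2 - cnj c) * (w $ i * w $ j)))"

definition involution :: "cvec3 \<times> cmat3 \<Rightarrow> cvec3 \<times> cmat3" where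
  "involution = (\<lambda>(w, B). (- w, B))"

lemma cnj_vec_minus: "cnj_vec (- w) = - cnj_vec w"
  by (simp add: vec_eq_iff)

lemma matrix_vec_minus: "(A :: complex ^ 'n ^ 'm) *v (- x) = - (A *v x)"
  by (simp add: vec_eq_iff matrix_vector_mult_def sum_negf)

lemma involution_\<E>: "z \<in> \<E> \<Longrightarrow> involution z \<in> \<E>"
  by (cases z) (simp add: involution_def \<E>_iff cnj_vec_minus matrix_vec_minus)

lemma involution_continuous: "continuous_map (top_of_set \<E>) (top_of_set \<E>) involution"
proof -
  have "continuous_on \<E> involution"
    unfolding involution_def case_prod_unfold by (intro continuous_intros)
  then show ?thesis using involution_\<E> by auto
qed

text \<open>Multiplying B by the conjugate transpose of A on the left and by cnj A on the right
  gives a matrix fixing e3. Unlike the chart, this pointwise form also covers w = -e3.\<close>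

lemma \<E>_decompose:
  assumes "(w, B) \<in> \<E>"
  obtains A q where "A \<in> SU3" "A *v e3 = w" "q \<in> sphere 0 1" "B = A ** quat_mat q ** transpose A"
proof -
  have w: "w \<in> sphere 0 1" and B: "B \<in> SU3" "B *v cnj_vec w = w" using assms by (auto simp: \<E>_iff)
  obtain A where A: "A \<in> SU3" "A *v e3 = w" using SU3_transitive[OF w] by blast
  define G where "G = conj_transpose A ** B ** cnj_mat A"
  have "G \<in> SU3" unfolding G_def by (intro SU_mult SU_conj_transpose SU_cnj A B)
  moreover have "G *v e3 = e3"
  proof -
    have "cnj_mat A *v e3 = cnj_vec w" using cnj_mat_vec[of A e3] A(2) by simp
    moreover have "conj_transpose A *v w = e3" using SU_cancel(3)[OF A(1), of e3] A(2) by simp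
    ultimately show ?thesis by (simp add: G_def matrix_vector_mul_assoc[symmetric] B(2))
  qed
  ultimately have q: "quat_of G \<in> sphere 0 1" "quat_mat (quat_of G) = G" by (rule stabilizer_quat)+
  have "cnj_mat A ** transpose A = mat 1"
    using SU_D(2)[OF SU_transpose[OF A(1)]] by simp
  then have "A ** G ** transpose A = (A ** conj_transpose A) ** B ** mat 1"
    unfolding G_def by (metis matrix_mul_assoc)
  then have "B = A ** quat_mat (quat_of G) ** transpose A"
    by (simp add: q(2) SU_D(1)[OF A(1)])
  with A q(1) that show ?thesis by blast
qed

lemma unit_complex: "cmod c = 1 \<Longrightarrow> c * cnj c = 1"
  using complex_norm_square[of c] by simp

lemma turn_\<E>:
  assumes c: "cmod c = 1" and z: "z \<in> \<E>"
  shows "turn c z \<in> \<E>"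
proof -
  obtain w B where wB: "z = (w, B)" by (cases z)
  then have w: "w \<in> sphere 0 1" and B: "B \<in> SU3" "B *v cnj_vec w = w" using z by (auto simp: \<E>_iff)
  obtain A q where A: "A \<in> SU3" "A *v e3 = w" and q: "q \<in> sphere 0 1" and Bq: "B = A ** quat_mat q ** transpose A"
    using \<E>_decompose z wB by metis
  note l = unit_complex[OF c]
  define w' where "w' = (\<chi> i. c * w $ i)"
  define B' where "B' = (\<chi> i j. cnj c * B $ i $ j + (c\<^sup>2 - cnj c) * (w $ i * w $ j))"
  have "(norm w')\<^sup>2 = (norm w)\<^sup>2"
    unfolding norm_cvec3 by (simp add: w'_def norm_mult c)
  then have "w' \<in> sphere 0 1" using w by (simp add: power2_eq_iff_nonneg)
  moreover have "B' \<in> SU3"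
  proof -
    have wA: "w $ i = A $ i $ 3" for i using mult_e3[of A i] A(2) by simp
    \<comment> \<open>The third column of A is w and \<open>quat_mat q\<close> fixes e3, so adding a
      multiple of w w^T to a multiple of B only alters the third diagonal entry, from cnj c to
      c^2.\<close>
    have "B' = A ** (quat_mat q ** diag3 (cnj c) (cnj c) (c\<^sup>2)) ** transpose A"
      by (simp add: vec_eq_iff B'_def Bq wA matrix_matrix_mult_def sum_3 algebra_simps)
    moreover have "diag3 (cnj c) (cnj c) (c\<^sup>2) \<in> SU3"
    proof (rule diag3_SU)
      have "cnj c * cnj c * c\<^sup>2 = (c * cnj c)\<^sup>2" by (simp add: power2_eq_square algebra_simps)
      then show "cnj c * cnj c * c\<^sup>2 = 1" by (simp add: l)
    qed (simp_all add: c norm_power)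
    ultimately show ?thesis
      using A(1) quat_mat_SU(1)[OF q] by (auto intro!: SU_mult SU_transpose)
  qed
  moreover have "B' *v cnj_vec w' = w'"
  proof -
    have "(B' *v cnj_vec w') $ i = w' $ i" for i
    proof -
      have Bi: "B $ i $ 1 * cnj (w $ 1) + B $ i $ 2 * cnj (w $ 2) + B $ i $ 3 * cnj (w $ 3) = w $ i"
        using arg_cong[OF B(2), of "\<lambda>v. v $ i"] by (simp add: matrix_vector_mult_def sum_3)
      have "(B' *v cnj_vec w') $ i = cnj c * cnj c * (B $ i $ 1 * cnj (w $ 1) + B $ i $ 2 * cnj (w $ 2) + B $ i $ 3 * cnj (w $ 3))
         + (c\<^sup>2 - cnj c) * cnj c * w $ i * (w $ 1 * cnj (w $ 1) + w $ 2 * cnj (w $ 2) + w $ 3 * cnj (w $ 3))"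
        by (simp add: matrix_vector_mult_def sum_3 B'_def w'_def algebra_simps)
      also have "\<dots> = c * (c * cnj c) * w $ i"
        unfolding Bi sphere_cvec3[OF w] by (simp add: power2_eq_square algebra_simps)
      finally show ?thesis by (simp add: l w'_def)
    qed
    then show ?thesis by (simp add: vec_eq_iff)
  qed
  ultimately show ?thesis
    unfolding wB turn_def B'_def w'_def by (simp add: \<E>_iff)
qed

lemma turn_homotopy: "homotopic_with (\<lambda>_. True) (top_of_set \<E>) (top_of_set \<E>) id (turn (- 1))"
proof -
  let ?h = "\<lambda>(t, z). turn (cis (pi * t)) z"
  have "homotopic_with (\<lambda>_. True) (top_of_set \<E>) (top_of_set \<E>) (turn (cis 0)) (turn (cis pi))"
    unfolding homotopic_with_def
  proof (intro exI[of _ ?h] conjI)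
    have "continuous_on ({0..1} \<times> \<E>) ?h"
      unfolding turn_def case_prod_unfold by (intro continuous_intros)
    moreover have "?h y \<in> \<E>" if "y \<in> {0..1} \<times> \<E>" for y
      using that by (cases y) (auto intro: turn_\<E>)
    ultimately show "continuous_map (prod_topology (top_of_set {0..1}) (top_of_set \<E>)) (top_of_set \<E>) ?h"
      by auto
  qed auto
  then show ?thesis
    by (rule homotopic_with_eq) (auto simp: turn_def vec_eq_iff)
qed

text \<open>Over a fixed w, the composite sends B to -B + 2 w w^T. In the chart this negates the
  upper left block only, hence is q \<mapsto> -q, which acts as the identity on H_3.\<close>

lemma involution_turn_degree:
  assumes z: "z \<in> carrier (homology_group 8 (top_of_set \<E>))"
  shows "hom_induced 8 (top_of_set \<E>) {} (top_of_set \<E>) {} (involution \<circ> turn (- 1)) z = z"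
proof -
  interpret H: comm_group "homology_group 8 (top_of_set \<E>)" by simp
  have r: "continuous_map (top_of_set \<E>) (top_of_set \<E>) (turn (- 1))"
    using homotopic_with_imp_continuous_maps[OF turn_homotopy] by blast
  have "hom_induced 8 (top_of_set \<E>) {} (top_of_set \<E>) {} (involution \<circ> turn (- 1)) z
      = z [^]\<^bsub>homology_group 8 (top_of_set \<E>)\<^esub> (1::int)"
  proof (rule sphere_bundle.fibrewise_degree[OF \<E>_bundle continuous_map_compose[OF r involution_continuous] _ _ _ _ z])
    show "fst ((involution \<circ> turn (- 1)) x) = fst x" for x
      by (cases x) (simp add: involution_def turn_def vec_eq_iff)
    fix w :: cvec3 and q :: quat
    assume "w \<in> sphere 0 1 - {- e3}" and q: "q \<in> sphere 0 1"
    then have A: "frame w *v e3 = w" using frame_SU(2)[of w] by blast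
    have wA: "w $ i = frame w $ i $ 3" for i using mult_e3[of "frame w" i] A by simp
    have "(\<chi> i j. cnj (- 1) * (frame w ** quat_mat q ** transpose (frame w)) $ i $ j + ((- 1)\<^sup>2 - cnj (- 1)) * (frame w $ i $ 3 * frame w $ j $ 3))
       = frame w ** quat_mat (- q) ** transpose (frame w)"
      by (simp add: vec_eq_iff matrix_matrix_mult_def sum_3 algebra_simps)
    then show "(involution \<circ> turn (- 1)) (\<E>_chart (w, q)) = \<E>_chart (w, - q)"
      by (simp add: involution_def turn_def wA[symmetric] vec_eq_iff)
  next
    show "continuous_map S3 S3 uminus" by (auto intro!: continuous_intros)
    interpret K: comm_group "homology_group 3 S3" by simp
    show "S3_hom uminus u = u [^]\<^bsub>homology_group 3 S3\<^esub> (1::int)" if "u \<in> carrier (homology_group 3 S3)" for u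
      using S3_hom_minus[OF that] that by simp
  qed
  then show ?thesis using z by simp
qed

lemma involution_degree:
  assumes z: "z \<in> carrier (homology_group 8 (top_of_set \<E>))"
  shows "hom_induced 8 (top_of_set \<E>) {} (top_of_set \<E>) {} involution z = z"
proof -
  have r: "continuous_map (top_of_set \<E>) (top_of_set \<E>) (turn (- 1))"
    using homotopic_with_imp_continuous_maps[OF turn_homotopy] by blast
  have "hom_induced 8 (top_of_set \<E>) {} (top_of_set \<E>) {} (turn (- 1)) z = z"
    using homology_homotopy_empty[OF turn_homotopy] hom_induced_id[OF z] by metis
  then have "hom_induced 8 (top_of_set \<E>) {} (top_of_set \<E>) {} involution z
     = hom_induced 8 (top_of_set \<E>) {} (top_of_set \<E>) {} involution (hom_induced 8 (top_of_set \<E>) {} (top_of_set \<E>) {} (turn (- 1)) z)"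
    by simp
  also have "\<dots> = hom_induced 8 (top_of_set \<E>) {} (top_of_set \<E>) {} (involution \<circ> turn (- 1)) z"
    by (rule hom_induced_compose'[OF r _ involution_continuous]) auto
  finally show ?thesis using involution_turn_degree[OF z] by simp
qed

subsection \<open>Two-to-one maps\<close>

text \<open>If \<open>P\<close> has exactly two preimages of a point, exchanged by an involution acting trivially on
  \<open>H\<^sub>n\<close>, then both preimages contribute the same local degree, so the contributions cannot cancel.\<close>

lemma two_to_one_injective:
  fixes E :: "'x topology" and M :: "'y topology"
  assumes q: "closedin E {q1}" "closedin E {q2}" "q1 \<noteq> q2"
    and P: "continuous_map E M P" and m: "closedin M {P q1}"
    and \<iota>: "continuous_map E E \<iota>" "\<iota> q1 = q2" "\<And>x. x \<in> topspace E \<Longrightarrow> \<iota> (\<iota> x) = x"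
      "\<And>x. x \<in> topspace E \<Longrightarrow> P (\<iota> x) = P x"
    and fibre: "\<And>x. \<lbrakk>x \<in> topspace E; P x = P q1\<rbrakk> \<Longrightarrow> x = q1 \<or> x = q2"
    and U: "openin E U" "q1 \<in> U" "q2 \<notin> U" "openin M (P ` U)"
      "homeomorphic_map (subtopology E U) (subtopology M (P ` U)) P"
    and \<iota>_hom: "\<And>z. z \<in> carrier (homology_group n E) \<Longrightarrow> hom_induced n E {} E {} \<iota> z = z"
    and loc: "hom_induced n E {} E (topspace E - {q1}) id \<in> iso (homology_group n E) (local_homology n E {q1})"
    and tors: "\<And>z. \<lbrakk>z \<in> carrier (homology_group n E); z \<otimes>\<^bsub>homology_group n E\<^esub> z = \<one>\<^bsub>homology_group n E\<^esub>\<rbrakk>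
        \<Longrightarrow> z = \<one>\<^bsub>homology_group n E\<^esub>"
    and z: "z \<in> carrier (homology_group n E)"
    and Pz: "hom_induced n E {} M {} P z = \<one>\<^bsub>homology_group n M\<^esub>"
  shows "z = \<one>\<^bsub>homology_group n E\<^esub>"
proof -
  let ?Q = "{q1, q2}"
  \<comment> \<open>Each of the two subspaces retains one of the points, so a local class at that
    point can enter the group at the pair \<open>?Q\<close> without contributing at the
    other.\<close>
  define E1 where "E1 = subtopology E (topspace E - {q2})"
  define E2 where "E2 = subtopology E (topspace E - {q1})"
  have qE: "q1 \<in> topspace E" "q2 \<in> topspace E" using q(1,2) closedin_subset by blast+
  have t1: "topspace E1 = topspace E - {q2}" and t2: "topspace E2 = topspace E - {q1}"
    by (auto simp: E1_def E2_def)
  have \<iota>q2: "\<iota> q2 = q1" using \<iota>(2,3) qE by metis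
  have \<iota>E: "\<iota> x \<in> topspace E" if "x \<in> topspace E" for x
    using continuous_map_funspace[OF \<iota>(1)] that by auto
  have \<iota>_eq: "\<iota> x = q1 \<longleftrightarrow> x = q2" "\<iota> x = q2 \<longleftrightarrow> x = q1" if "x \<in> topspace E" for x
    using \<iota>(2,3) \<iota>q2 that by metis+
  have PE: "P x \<in> topspace M" if "x \<in> topspace E" for x
    using continuous_map_funspace[OF P] that by auto
  have Pq2: "P q2 = P q1" using \<iota>(2,4) qE by metis
  have c1: "continuous_map E1 E id" and c2: "continuous_map E2 E id"
    by (simp_all add: E1_def E2_def continuous_map_from_subtopology)
  have cid: "continuous_map E E id" by simp
  define r1 where "r1 = hom_induced n E {} E (topspace E - {q1}) id"
  define r2 where "r2 = hom_induced n E {} E (topspace E - {q2}) id"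
  define j where "j = hom_induced n E {} E (topspace E - ?Q) id"
  define i1 where "i1 = local_hom n E1 {q1} E {q1} id"
  define i2 where "i2 = local_hom n E2 {q2} E {q2} id"
  define u1 where "u1 = local_hom n E1 {q1} E ?Q id"
  define u2 where "u2 = local_hom n E2 {q2} E ?Q id"
  define s1 where "s1 = local_hom n E ?Q E {q1} id"
  define s2 where "s2 = local_hom n E ?Q E {q2} id"
  define t where "t = local_hom n E1 {q1} E2 {q2} \<iota>"
  let ?T = "local_homology n E ?Q"
  note defs = r1_def r2_def j_def i1_def i2_def u1_def u2_def s1_def s2_def t_def

  have su: "s1 (u1 x) = i1 x" "s2 (u2 x) = i2 x" for x
  proof -
    have "s1 (u1 x) = local_hom n E1 {q1} E {q1} (id \<circ> id) x"
      unfolding defs by (rule local_hom_compose[OF c1 _ cid]) (auto simp: t1)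
    then show "s1 (u1 x) = i1 x" by (simp add: defs)
    have "s2 (u2 x) = local_hom n E2 {q2} E {q2} (id \<circ> id) x"
      unfolding defs by (rule local_hom_compose[OF c2 _ cid]) (auto simp: t2)
    then show "s2 (u2 x) = i2 x" by (simp add: defs)
  qed
  \<comment> \<open>The inclusion factors through the pair of \<open>D\<close> with itself, whose
    homology is trivial.\<close>
  have triv: "hom_induced n D S E (topspace E - {a}) id x = \<one>\<^bsub>local_homology n E {a}\<^esub>"
    if "continuous_map D E id" "topspace D = topspace E - {a}" "S \<subseteq> topspace D" for D S a x
  proof -
    have "hom_induced n D S E (topspace E - {a}) (id \<circ> id) x
       = hom_induced n D (topspace D) E (topspace E - {a}) id (hom_induced n D S D (topspace D) id x)"
      by (rule hom_induced_compose'[symmetric]) (use that in auto)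
    also have "hom_induced n D S D (topspace D) id x = \<one>\<^bsub>relative_homology_group n D (topspace D)\<^esub>"
      using trivial_relative_homology_group_topspace[of n D] hom_induced_carrier[of n D S D "topspace D" id x]
      by (simp add: trivial_group_def)
    finally show ?thesis by (simp only: hom_induced_one comp_id)
  qed
  have su': "s2 (u1 x) = \<one>\<^bsub>local_homology n E {q2}\<^esub>" "s1 (u2 x) = \<one>\<^bsub>local_homology n E {q1}\<^esub>" for x
  proof -
    have "s2 (u1 x) = local_hom n E1 {q1} E {q2} (id \<circ> id) x"
      unfolding defs by (rule local_hom_compose[OF c1 _ cid]) (auto simp: t1)
    then show "s2 (u1 x) = \<one>\<^bsub>local_homology n E {q2}\<^esub>" using triv[OF c1 t1] by (simp add: t1)
    have "s1 (u2 x) = local_hom n E2 {q2} E {q1} (id \<circ> id) x"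
      unfolding defs by (rule local_hom_compose[OF c2 _ cid]) (auto simp: t2)
    then show "s1 (u2 x) = \<one>\<^bsub>local_homology n E {q1}\<^esub>" using triv[OF c2 t2] by (simp add: t2)
  qed
  have sj: "s1 (j z) = r1 z" "s2 (j z) = r2 z" for z
  proof -
    have "s1 (j z) = hom_induced n E {} E (topspace E - {q1}) (id \<circ> id) z"
      unfolding defs by (rule hom_induced_compose'[OF cid _ cid]) auto
    then show "s1 (j z) = r1 z" by (simp add: defs)
    have "s2 (j z) = hom_induced n E {} E (topspace E - {q2}) (id \<circ> id) z"
      unfolding defs by (rule hom_induced_compose'[OF cid _ cid]) auto
    then show "s2 (j z) = r2 z" by (simp add: defs)
  qed

  have i1: "i1 \<in> iso (local_homology n E1 {q1}) (local_homology n E {q1})"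
    unfolding i1_def E1_def
    by (rule open_inclusion_local_homology_iso) (use q qE in \<open>auto intro: openin_diff\<close>)
  obtain x1 where x1: "x1 \<in> carrier (local_homology n E1 {q1})" "i1 x1 = r1 z"
    using iso_inv_into[OF i1, of "r1 z"] hom_induced_carrier[of n E "{}" E "topspace E - {q1}" id z]
    unfolding r1_def by blast
  have ct: "continuous_map E1 E2 \<iota>"
    using \<iota>(1) \<iota>E \<iota>_eq unfolding E1_def E2_def
    by (auto simp: continuous_map_in_subtopology continuous_map_from_subtopology)
  \<comment> \<open>Invariance of \<open>z\<close> under the involution enters here: its restriction
    at \<open>q2\<close> is the transported restriction at \<open>q1\<close>.\<close>
  have i2x: "i2 (t x1) = r2 z"
  proof -
    have "i2 (t x1) = local_hom n E1 {q1} E {q2} (id \<circ> \<iota>) x1"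
      unfolding defs by (rule local_hom_compose[OF ct _ c2]) (use \<iota>E \<iota>_eq in \<open>auto simp: t1 t2\<close>)
    also have "\<dots> = local_hom n E1 {q1} E {q2} (\<iota> \<circ> id) x1" by simp
    also have "\<dots> = local_hom n E {q1} E {q2} \<iota> (i1 x1)"
      unfolding defs by (rule local_hom_compose[OF c1 _ \<iota>(1), symmetric]) (use \<iota>E \<iota>_eq in \<open>auto simp: t1\<close>)
    also have "\<dots> = hom_induced n E {} E (topspace E - {q2}) (\<iota> \<circ> id) z"
      unfolding x1(2) r1_def by (rule hom_induced_compose'[OF cid _ \<iota>(1)]) (use \<iota>E \<iota>_eq in auto)
    also have "\<dots> = hom_induced n E {} E (topspace E - {q2}) (id \<circ> \<iota>) z" by simp
    also have "\<dots> = r2 (hom_induced n E {} E {} \<iota> z)"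
      unfolding r2_def by (rule hom_induced_compose'[OF \<iota>(1) _ cid, symmetric]) auto
    finally show ?thesis by (simp add: \<iota>_hom[OF z])
  qed

  interpret T: comm_group ?T by simp
  interpret s1: group_hom ?T "local_homology n E {q1}" s1
    by (simp add: s1_def group_hom_def group_hom_axioms_def hom_induced_hom)
  interpret s2: group_hom ?T "local_homology n E {q2}" s2
    by (simp add: s2_def group_hom_def group_hom_axioms_def hom_induced_hom)
  interpret i1: group_hom "local_homology n E1 {q1}" "local_homology n E {q1}" i1
    by (simp add: i1_def group_hom_def group_hom_axioms_def hom_induced_hom)
  interpret r1: group_hom "homology_group n E" "local_homology n E {q1}" r1
    by (simp add: r1_def group_hom_def group_hom_axioms_def hom_induced_hom)
  \<comment> \<open>A class at the pair of points is determined by its two restrictions: exactness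
    of the triple brings it from \<open>E1\<close> once \<open>s2\<close> kills it, and there
    \<open>s1\<close> is the excision isomorphism \<open>i1\<close>.\<close>
  have separated: "y = \<one>\<^bsub>?T\<^esub>"
    if y: "y \<in> carrier ?T" and y1: "s1 y = \<one>\<^bsub>local_homology n E {q1}\<^esub>" and y2: "s2 y = \<one>\<^bsub>local_homology n E {q2}\<^esub>" for y
  proof -
    have sub: "topspace E - ?Q \<subseteq> topspace E - {q2}" by auto
    have dom: "topspace E1 - {q1} = topspace E - ?Q" by (auto simp: t1)
    have "y \<in> kernel ?T (local_homology n E {q2}) s2" using y y2 by (simp add: kernel_def)
    also have "\<dots> = u1 ` carrier (local_homology n E1 {q1})"
      using homology_exactness_triple_3[OF sub, of n E] unfolding defs dom E1_def[symmetric] by simp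
    finally obtain x where x: "x \<in> carrier (local_homology n E1 {q1})" "y = u1 x"
      by (elim imageE)
    have "i1 x = \<one>\<^bsub>local_homology n E {q1}\<^esub>" using su(1)[of x] y1 x(2) by simp
    then have "x = \<one>\<^bsub>local_homology n E1 {q1}\<^esub>"
      using iso_eq_oneD[OF i1 _ _ x(1)] by simp
    then show ?thesis using x(2) by (simp add: u1_def hom_induced_one)
  qed
  have carr [simp]: "j z \<in> carrier ?T" "u1 x \<in> carrier ?T" "u2 x \<in> carrier ?T" for x
    by (simp_all add: defs hom_induced_carrier)
  have r_carr [simp]: "r1 z \<in> carrier (local_homology n E {q1})" "r2 z \<in> carrier (local_homology n E {q2})"
    by (simp_all add: defs hom_induced_carrier)
  \<comment> \<open>Both sides of the decomposition \<open>jz\<close> below have the same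
    restrictions at \<open>q1\<close> and \<open>q2\<close>.\<close>
  have "j z \<otimes>\<^bsub>?T\<^esub> inv\<^bsub>?T\<^esub> (u1 x1 \<otimes>\<^bsub>?T\<^esub> u2 (t x1)) = \<one>\<^bsub>?T\<^esub>"
    by (rule separated) (simp_all add: sj su su' x1(2) i2x)
  then have jz: "j z = u1 x1 \<otimes>\<^bsub>?T\<^esub> u2 (t x1)"
    using T.inv_equality[of "j z" "inv\<^bsub>?T\<^esub> (u1 x1 \<otimes>\<^bsub>?T\<^esub> u2 (t x1))"] by simp

  define PQ where "PQ = local_hom n E ?Q M {P q1} P"
  define p1 where "p1 = local_hom n E1 {q1} M {P q1} P"
  have PQd: "P \<in> topspace E - ?Q \<rightarrow> topspace M - {P q1}" using PE fibre by blast
  have Pd1: "P \<in> topspace E1 - {q1} \<rightarrow> topspace M - {P q1}" using PE fibre by (auto simp: t1)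
  interpret PQ: group_hom ?T "local_homology n M {P q1}" PQ
    by (simp add: PQ_def group_hom_def group_hom_axioms_def hom_induced_hom)
  interpret p1: group_hom "local_homology n E1 {q1}" "local_homology n M {P q1}" p1
    by (simp add: p1_def group_hom_def group_hom_axioms_def hom_induced_hom)
  have "PQ (j z) = hom_induced n E {} M (topspace M - {P q1}) (P \<circ> id) z"
    unfolding PQ_def j_def by (rule hom_induced_compose'[OF cid _ P PQd]) auto
  also have "\<dots> = hom_induced n E {} M (topspace M - {P q1}) (id \<circ> P) z" by simp
  also have "\<dots> = hom_induced n M {} M (topspace M - {P q1}) id (hom_induced n E {} M {} P z)"
    by (rule hom_induced_compose'[OF P, symmetric]) auto
  finally have PQj: "PQ (j z) = \<one>\<^bsub>local_homology n M {P q1}\<^esub>"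
    by (simp add: Pz hom_induced_one)
  have PQ1: "PQ (u1 x1) = p1 x1"
  proof -
    have "PQ (u1 x1) = local_hom n E1 {q1} M {P q1} (P \<circ> id) x1"
      unfolding PQ_def u1_def by (rule local_hom_compose[OF c1 _ P PQd]) (auto simp: t1)
    then show ?thesis by (simp add: p1_def)
  qed
  have PQ2: "PQ (u2 (t x1)) = p1 x1"
  proof -
    have Pd2: "P \<in> topspace E2 - {q2} \<rightarrow> topspace M - {P q1}" using PE fibre by (auto simp: t2)
    have cP2: "continuous_map E2 M P" unfolding E2_def by (rule continuous_map_from_subtopology[OF P])
    have "PQ (u2 (t x1)) = local_hom n E2 {q2} M {P q1} (P \<circ> id) (t x1)"
      unfolding PQ_def u2_def by (rule local_hom_compose[OF c2 _ P PQd]) (auto simp: t2)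
    also have "\<dots> = local_hom n E1 {q1} M {P q1} ((P \<circ> id) \<circ> \<iota>) x1"
      unfolding t_def by (rule local_hom_compose[OF ct]) (use \<iota>E \<iota>_eq Pd2 cP2 in \<open>auto simp: t1 t2\<close>)
    also have "local_hom n E1 {q1} M {P q1} ((P \<circ> id) \<circ> \<iota>) = p1"
      unfolding p1_def by (rule hom_induced_eq) (simp add: t1 \<iota>(4))
    finally show ?thesis .
  qed
  \<comment> \<open>As \<open>P \<circ> \<iota> = P\<close>, the two preimages contribute equally,
    so the trivial image of \<open>z\<close> is twice one local contribution.\<close>
  have "p1 x1 \<otimes>\<^bsub>local_homology n M {P q1}\<^esub> p1 x1 = \<one>\<^bsub>local_homology n M {P q1}\<^esub>"
    using PQj unfolding jz by (simp add: PQ1 PQ2)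
  then have p1x: "p1 (x1 \<otimes>\<^bsub>local_homology n E1 {q1}\<^esub> x1) = \<one>\<^bsub>local_homology n M {P q1}\<^esub>"
    using x1(1) by simp

  define V where "V = subtopology E U"
  have UE: "U \<subseteq> topspace E" using U(1) openin_subset by blast
  have tV: "topspace V = U" using UE by (auto simp: V_def)
  have V1: "V = subtopology E1 U"
  proof -
    have "(topspace E - {q2}) \<inter> U = U" using UE U(3) by blast
    then show ?thesis by (simp add: V_def E1_def subtopology_subtopology)
  qed
  have "openin E1 U"
    unfolding E1_def using U(1,3) UE by (auto simp: openin_subtopology)
  moreover have "closedin E1 {q1}"
    unfolding E1_def closedin_subtopology using q qE by (intro exI[of _ "{q1}"]) auto
  ultimately have inc: "local_hom n V {q1} E1 {q1} id \<in> iso (local_homology n V {q1}) (local_homology n E1 {q1})"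
    unfolding V1 using U(2) by (intro open_inclusion_local_homology_iso) auto
  have PV: "local_hom n V {q1} M {P q1} P \<in> iso (local_homology n V {q1}) (local_homology n M {P q1})"
    using open_embedding_local_homology_iso[of V M P "{q1}" n] U(2,4,5) m unfolding tV V_def[symmetric] by simp
  have p1: "p1 \<in> iso (local_homology n E1 {q1}) (local_homology n M {P q1})"
  proof (rule iso_cancel_right[OF inc PV])
    show "p1 \<in> hom (local_homology n E1 {q1}) (local_homology n M {P q1})"
      unfolding p1_def by (rule hom_induced_hom)
    fix x
    have "continuous_map V E1 id" unfolding V1 by (simp add: continuous_map_from_subtopology)
    moreover have "continuous_map E1 M P" unfolding E1_def by (rule continuous_map_from_subtopology[OF P])
    ultimately have "p1 (local_hom n V {q1} E1 {q1} id x) = local_hom n V {q1} M {P q1} (P \<circ> id) x"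
      unfolding p1_def by (intro local_hom_compose[OF _ _ _ Pd1]) (use UE U(3) in \<open>auto simp: tV t1\<close>)
    then show "p1 (local_hom n V {q1} E1 {q1} id x) = local_hom n V {q1} M {P q1} P x" by simp
  qed
  \<comment> \<open>On \<open>U\<close> the map \<open>P\<close> is an open embedding, so
    \<open>p1\<close> is injective and twice \<open>x1\<close> vanishes. The assumption
    \<open>loc\<close> lifts this to twice \<open>z\<close>, and \<open>tors\<close> removes the
    factor 2.\<close>
  have "x1 \<otimes>\<^bsub>local_homology n E1 {q1}\<^esub> x1 = \<one>\<^bsub>local_homology n E1 {q1}\<^esub>"
    by (rule iso_eq_oneD[OF p1 _ _ _ p1x]) (simp_all add: x1(1))
  then have "r1 z \<otimes>\<^bsub>local_homology n E {q1}\<^esub> r1 z = \<one>\<^bsub>local_homology n E {q1}\<^esub>"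
    using i1.hom_mult[OF x1(1) x1(1)] by (simp add: x1(2))
  then have "r1 (z \<otimes>\<^bsub>homology_group n E\<^esub> z) = \<one>\<^bsub>local_homology n E {q1}\<^esub>"
    using z by simp
  then have "z \<otimes>\<^bsub>homology_group n E\<^esub> z = \<one>\<^bsub>homology_group n E\<^esub>"
    by (intro iso_eq_oneD[OF loc]) (simp_all add: z r1_def)
  then show ?thesis using tors z by blast
qed

section \<open>Reading off a degree in an infinite cyclic group\<close>

lemma infinite_cyclic_pow_eq_one:
  assumes "group G" "G \<cong> integer_group" "x \<in> carrier G" "x \<noteq> \<one>\<^bsub>G\<^esub>" "x [^]\<^bsub>G\<^esub> (n::int) = \<one>\<^bsub>G\<^esub>"
  shows "n = 0"
proof -
  obtain h where h: "h \<in> iso G integer_group" using assms(2) unfolding is_iso_def by blast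
  interpret group_hom G integer_group h
    using h assms(1) iso_imp_homomorphism by (auto simp: group_hom_def group_hom_axioms_def)
  have "h x \<noteq> 0"
    using iso_eq_oneD[OF h assms(1) _ assms(3)] assms(4) by auto
  moreover have "n * h x = 0"
    using hom_int_pow[OF assms(3), of n] assms(5) by simp
  ultimately show ?thesis by simp
qed

text \<open>The class \<open>y\<close> need not be a generator: with y the a-th power of a
  generator, a nonzero, comparing exponents gives d * a = a * k and so d = k. This admits the image
  of a class under a projection of unknown degree.\<close>

lemma has_degree_of_nontrivial_class:
  fixes X :: "'a topology" and n :: nat
  defines "H \<equiv> homology_group (int n) X"
  assumes iso: "H \<cong> integer_group" and f: "continuous_map X X f"
    and y: "y \<in> carrier H" "y \<noteq> \<one>\<^bsub>H\<^esub>" and fy: "hom_induced (int n) X {} X {} f y = y [^]\<^bsub>H\<^esub> k"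
  shows "has_degree n X f k"
proof -
  interpret H: comm_group H by (simp add: H_def)
  interpret f: group_hom H H "hom_induced (int n) X {} X {} f"
    by (simp add: H_def group_hom_def group_hom_axioms_def hom_induced_hom)
  have "cyclic_group H" using isomorphic_group_cyclicity[OF iso] by (simp add: H.is_group)
  then obtain \<mu> where \<mu>: "\<mu> \<in> carrier H" "subgroup_generated H {\<mu>} = H"
    unfolding cyclic_group_def by blast
  have powers: "\<exists>i::int. x = \<mu> [^]\<^bsub>H\<^esub> i" if "x \<in> carrier H" for x
    using H.carrier_subgroup_generated_by_singleton[OF \<mu>(1)] that unfolding \<mu>(2) by auto
  obtain h where "h \<in> iso H integer_group" using iso unfolding is_iso_def by blast
  then have "bij_betw h (carrier H) (UNIV :: int set)" by (simp add: iso_def)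
  then have inf: "infinite (carrier H)" using bij_betw_finite infinite_UNIV_int by blast
  obtain a where a: "y = \<mu> [^]\<^bsub>H\<^esub> (a::int)" using powers[OF y(1)] by blast
  obtain d where d: "hom_induced (int n) X {} X {} f \<mu> = \<mu> [^]\<^bsub>H\<^esub> (d::int)"
    using powers f.hom_closed[OF \<mu>(1)] by blast
  have "a \<noteq> 0" "\<mu> \<noteq> \<one>\<^bsub>H\<^esub>" using y(2) a by auto
  have "\<mu> [^]\<^bsub>H\<^esub> (d * a) = \<mu> [^]\<^bsub>H\<^esub> (a * k)"
    using fy \<mu>(1) unfolding a f.hom_int_pow[OF \<mu>(1)] d by (simp add: H.int_pow_pow)
  then have "\<mu> [^]\<^bsub>H\<^esub> (d * a - a * k) = \<one>\<^bsub>H\<^esub>"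
    using \<mu>(1) by (simp add: H.int_pow_diff)
  then have "d * a - a * k = 0"
    by (rule infinite_cyclic_pow_eq_one[OF H.is_group iso \<mu>(1) \<open>\<mu> \<noteq> _\<close>])
  then have "d = k" using \<open>a \<noteq> 0\<close> by (simp add: mult.commute)
  then show ?thesis
    using f inf \<mu> d unfolding has_degree_def fundamental_class_def H_def by blast
qed

section \<open>The axial vector and the two sheets of the projection\<close>

text \<open>The axial vector of \<open>B - B\<^sup>T\<close>; for \<open>B \<in> SU(3)\<close> it spans the solutions \<open>v\<close> of \<open>B v = cnj v\<close>
  unless \<open>B\<close> is symmetric.\<close>

definition axial :: "cmat3 \<Rightarrow> cvec3" where
  "axial B = vector [B $ 3 $ 2 - B $ 2 $ 3, B $ 1 $ 3 - B $ 3 $ 1, B $ 2 $ 1 - B $ 1 $ 2]"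

lemma axial_nth [simp]:
  "axial B $ 1 = B $ 3 $ 2 - B $ 2 $ 3" "axial B $ 2 = B $ 1 $ 3 - B $ 3 $ 1" "axial B $ 3 = B $ 2 $ 1 - B $ 1 $ 2"
  by (simp_all add: axial_def)

lemma axial_eq: "axial B = (\<chi> i. if i = 1 then B $ 3 $ 2 - B $ 2 $ 3 else if i = 2 then B $ 1 $ 3 - B $ 3 $ 1 else B $ 2 $ 1 - B $ 1 $ 2)"
  by (simp add: vec_eq_iff forall_3)

lemma continuous_on_axial [continuous_intros]:
  fixes f :: "'a::topological_space \<Rightarrow> cmat3"
  assumes "continuous_on S f"
  shows "continuous_on S (\<lambda>x. axial (f x))"
  unfolding axial_eq
proof (intro continuous_on_vec_lambda)
  fix i :: 3
  show "continuous_on S (\<lambda>x. if i = 1 then f x $ 3 $ 2 - f x $ 2 $ 3 else if i = 2 then f x $ 1 $ 3 - f x $ 3 $ 1 else f x $ 2 $ 1 - f x $ 1 $ 2)"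
    by (cases "i = 1"; cases "i = 2") (auto intro!: continuous_intros assms)
qed

text \<open>\<open>K\<close> is the adjugate of B. As B has determinant 1 and is unitary, its
  conjugate transpose equals \<open>K\<close>, so the entries of cnj B are cofactors of B and the
  claim becomes a polynomial identity.\<close>

lemma SU3_axial:
  assumes B: "B \<in> SU3"
  shows "B *v axial B = cnj_vec (axial B)"
proof -
  define K :: cmat3 where "K = vector
    [vector [B$2$2 * B$3$3 - B$2$3 * B$3$2, B$1$3 * B$3$2 - B$1$2 * B$3$3, B$1$2 * B$2$3 - B$1$3 * B$2$2],
     vector [B$2$3 * B$3$1 - B$2$1 * B$3$3, B$1$1 * B$3$3 - B$1$3 * B$3$1, B$1$3 * B$2$1 - B$1$1 * B$2$3],
     vector [B$2$1 * B$3$2 - B$2$2 * B$3$1, B$1$2 * B$3$1 - B$1$1 * B$3$2, B$1$1 * B$2$2 - B$1$2 * B$2$1]]"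
  have "B ** K = mat (det B)"
    by (simp add: vec_eq_iff forall_3 matrix_matrix_mult_def sum_3 mat_def det_3 K_def algebra_simps)
  then have "conj_transpose B = K"
    using SU_cancel(1)[OF B, of K] SU_D(3)[OF B] by simp
  then have "cnj (B $ j $ i) = K $ i $ j" for i j
    by (metis conj_transpose_nth)
  then show ?thesis
    by (simp add: vec_eq_iff forall_3 matrix_vector_mult_def sum_3 K_def algebra_simps)
qed

text \<open>Both B and its transpose send v = cnj w to w, so v is in the kernel of B minus its
  transpose, that is, v has zero cross product with the axial vector y. Thus v is a multiple \<zeta>
  of y; comparing w = B v = \<zeta> * cnj y with w = cnj v shows that \<zeta> is real.\<close>

lemma \<E>_axial:
  assumes wB: "(w, B) \<in> \<E>" and x: "axial B \<noteq> 0"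
  obtains c :: real where "\<And>i. w $ i = c * cnj (axial B $ i)" "\<bar>c\<bar> * norm (axial B) = 1"
proof -
  have w: "w \<in> sphere 0 1" and B: "B \<in> SU3" "B *v cnj_vec w = w" using wB by (auto simp: \<E>_iff)
  define v where "v = cnj_vec w"
  define y where "y = axial B"
  have wv: "w $ i = cnj (v $ i)" for i by (simp add: v_def)
  have e1: "(B *v v) $ i = w $ i" and e2: "(transpose B *v v) $ i = w $ i" for i
    using B(2) twisted_fixpoint(2)[OF B] by (simp_all only: v_def)
  have "(B *v v) $ i - (transpose B *v v) $ i = 0" for i by (simp only: e1 e2 diff_self)
  from this[of 1] this[of 2] this[of 3]
  have c: "y $ 2 * v $ 3 = y $ 3 * v $ 2" "y $ 3 * v $ 1 = y $ 1 * v $ 3" "y $ 1 * v $ 2 = y $ 2 * v $ 1"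
    by (simp_all add: y_def matrix_vector_mult_def sum_3 algebra_simps del: transpose_matrix_vector)
  obtain k where k: "y $ k \<noteq> 0" using x by (auto simp: vec_eq_iff y_def)
  define \<zeta> where "\<zeta> = v $ k / y $ k"
  have v\<zeta>: "v $ i = \<zeta> * y $ i" for i
  proof -
    have "y $ k * v $ i = y $ i * v $ k"
      using exhaust_3[of i] exhaust_3[of k] c by (auto simp: mult.commute)
    then show ?thesis using k by (simp add: \<zeta>_def field_simps)
  qed
  have "w $ i = \<zeta> * cnj (y $ i)" for i
  proof -
    have "w $ i = (B *v v) $ i" by (simp only: e1)
    also have "\<dots> = \<zeta> * (B *v y) $ i"
      by (simp add: matrix_vector_mult_def sum_3 v\<zeta> algebra_simps)
    also have "(B *v y) $ i = cnj (y $ i)"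
      using SU3_axial[OF B(1)] by (simp add: y_def)
    finally show ?thesis .
  qed
  moreover have "\<zeta> = cnj \<zeta>"
    using calculation[of k] wv[of k] v\<zeta>[of k] k by simp
  then have \<zeta>: "\<zeta> = complex_of_real (Re \<zeta>)" by (simp add: complex_eq_iff)
  ultimately have wc: "w $ i = Re \<zeta> * cnj (y $ i)" for i by simp
  have "(norm w)\<^sup>2 = (Re \<zeta>)\<^sup>2 * (norm y)\<^sup>2"
    unfolding norm_cvec3 wc by (simp add: norm_mult power_mult_distrib algebra_simps)
  then have "(\<bar>Re \<zeta>\<bar> * norm y)\<^sup>2 = 1" using w by (simp add: power_mult_distrib)
  then have "\<bar>Re \<zeta>\<bar> * norm y = 1"
    using power2_eq_iff_nonneg[of "\<bar>Re \<zeta>\<bar> * norm y" 1] by simp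
  then show ?thesis using that wc unfolding y_def by blast
qed

lemma pairing_axial:
  assumes "\<And>i. w $ i = complex_of_real c * cnj (axial B $ i)"
  shows "Re (\<Sum>i\<in>UNIV. w $ i * axial B $ i) = c * (norm (axial B))\<^sup>2"
proof -
  have "(\<Sum>i\<in>UNIV. w $ i * axial B $ i) = complex_of_real (c * (norm (axial B))\<^sup>2)"
    unfolding sum_3 norm_cvec3 of_real_mult of_real_add complex_norm_square assms by (simp only: algebra_simps)
  then show ?thesis by simp
qed

text \<open>For B with nonzero axial vector, the two lifts are opposite real multiples of its
  conjugate; this pairing has the sign of the multiple and so singles out one sheet.\<close>

definition positive_part :: "(cvec3 \<times> cmat3) set" where
  "positive_part = {z \<in> \<E>. 0 < Re (\<Sum>i\<in>UNIV. fst z $ i * axial (snd z) $ i)}"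

definition asymmetric :: "cmat3 set" where
  "asymmetric = {B \<in> SU3. axial B \<noteq> 0}"

lemma positive_part_open: "openin (top_of_set \<E>) positive_part"
proof -
  have "continuous_on \<E> (\<lambda>z. Re (\<Sum>i\<in>UNIV. fst z $ i * axial (snd z) $ i))"
    by (intro continuous_intros)
  from continuous_openin_preimage_gen[OF this open_greaterThan[of 0]] show ?thesis
    by (simp add: positive_part_def vimage_def Int_def)
qed

lemma asymmetric_open: "openin (top_of_set SU3) asymmetric"
proof -
  have "continuous_on SU3 axial" by (intro continuous_intros)
  moreover have "open (- {0 :: cvec3})" by (simp add: open_Compl)
  ultimately show ?thesis
    using continuous_openin_preimage_gen[of SU3 axial "- {0}"] by (simp add: asymmetric_def vimage_def Int_def)
qed

text \<open>The inverse of the projection on the positive sheet: the lift with positive factor has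
  unit length for the factor 1 / \<open>norm (axial B)\<close>.\<close>

definition normal_lift :: "cmat3 \<Rightarrow> cvec3 \<times> cmat3" where
  "normal_lift B = (\<chi> i. cnj (axial B $ i) / complex_of_real (norm (axial B)), B)"

lemma normal_lift_positive:
  assumes "B \<in> asymmetric"
  shows "normal_lift B \<in> positive_part"
proof -
  have B: "B \<in> SU3" and x: "axial B \<noteq> 0" using assms by (auto simp: asymmetric_def)
  define n where "n = norm (axial B)"
  define w where "w = (\<chi> i. cnj (axial B $ i) / complex_of_real n)"
  have n: "n > 0" using x by (simp add: n_def)
  have wi: "w $ i = complex_of_real (1 / n) * cnj (axial B $ i)" for i by (simp add: w_def)
  have "(norm w)\<^sup>2 = (1 / n)\<^sup>2 * n\<^sup>2"
    unfolding n_def norm_cvec3[of "axial B"] norm_cvec3[of w] wi[unfolded n_def]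
    by (simp add: norm_mult power_mult_distrib norm_divide power_divide algebra_simps del: axial_nth complex_cnj_diff)
  then have "(norm w)\<^sup>2 = 1\<^sup>2" using n by (simp add: power_divide)
  then have "norm w = 1" by (rule power2_eq_imp_eq) simp_all
  then have "w \<in> sphere 0 1" by simp
  moreover have "B *v cnj_vec w = w"
  proof -
    have "(B *v cnj_vec w) $ i = complex_of_real (1 / n) * (B *v axial B) $ i" for i
      by (simp add: matrix_vector_mult_def sum_3 wi algebra_simps add_divide_distrib del: axial_nth)
    then show ?thesis unfolding SU3_axial[OF B] by (simp add: vec_eq_iff wi)
  qed
  ultimately have "(w, B) \<in> \<E>" using B by (simp add: \<E>_iff)
  moreover have "0 < Re (\<Sum>i\<in>UNIV. w $ i * axial B $ i)"
    unfolding pairing_axial[OF wi] using n x by simp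
  ultimately have "(w, B) \<in> positive_part" by (simp add: positive_part_def)
  moreover have "normal_lift B = (w, B)" by (simp add: normal_lift_def w_def n_def)
  ultimately show ?thesis by simp
qed

lemma positive_part_lift:
  assumes "(w, B) \<in> positive_part"
  shows "B \<in> asymmetric" "normal_lift B = (w, B)"
proof -
  have E: "(w, B) \<in> \<E>" and pos: "0 < Re (\<Sum>i\<in>UNIV. w $ i * axial B $ i)"
    using assms by (auto simp: positive_part_def)
  have x: "axial B \<noteq> 0" using pos by auto
  then show "B \<in> asymmetric" using E by (simp add: asymmetric_def \<E>_iff)
  obtain c :: real where c: "\<And>i. w $ i = c * cnj (axial B $ i)" "\<bar>c\<bar> * norm (axial B) = 1"
    using \<E>_axial[OF E x] by blast
  have "c > 0" using pos x unfolding pairing_axial[OF c(1)] by (simp add: zero_less_mult_iff)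
  then have "c = 1 / norm (axial B)" using c(2) x by (simp add: field_simps)
  then show "normal_lift B = (w, B)"
    by (simp add: normal_lift_def vec_eq_iff c(1))
qed

lemma snd_positive_part:
  "snd ` positive_part = asymmetric"
  "homeomorphic_map (top_of_set positive_part) (top_of_set asymmetric) snd"
proof -
  show "snd ` positive_part = asymmetric"
  proof
    show "snd ` positive_part \<subseteq> asymmetric" using positive_part_lift(1) by auto
    show "asymmetric \<subseteq> snd ` positive_part"
    proof
      fix B assume "B \<in> asymmetric"
      then show "B \<in> snd ` positive_part"
        using normal_lift_positive by (intro image_eqI[of _ _ "normal_lift B"]) (auto simp: normal_lift_def)
    qed
  qed
  have c: "continuous_on asymmetric normal_lift"
    unfolding normal_lift_def by (intro continuous_intros) (auto simp: asymmetric_def)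
  have "homeomorphic_maps (top_of_set positive_part) (top_of_set asymmetric) snd normal_lift"
    unfolding homeomorphic_maps_def
  proof (intro conjI ballI)
    show "continuous_map (top_of_set positive_part) (top_of_set asymmetric) snd"
      using positive_part_lift(1) by (auto intro!: continuous_intros)
    show "continuous_map (top_of_set asymmetric) (top_of_set positive_part) normal_lift"
      using c normal_lift_positive by auto
    show "normal_lift (snd z) = z" if "z \<in> topspace (top_of_set positive_part)" for z
      using that positive_part_lift(2) by (cases z) auto
    show "snd (normal_lift B) = B" for B by (simp add: normal_lift_def)
  qed
  then show "homeomorphic_map (top_of_set positive_part) (top_of_set asymmetric) snd"
    using homeomorphic_map_maps by blast
qed

section \<open>The base point and the conclusion\<close>

abbreviation base_point :: cmat3 where "base_point \<equiv> quat_mat (0, - 1)"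

text \<open>\<open>base_point\<close> is the real rotation by a right angle about the third axis.
  Its axial vector is 2 e3, so its lifts are e3 and -e3, and the positive one lies in the fibre
  around which the chart of \<open>\<E>\<close> is centred.\<close>

lemma base_point_SU: "base_point \<in> SU3" "base_point *v e3 = e3"
  using quat_mat_SU[of "(0, - 1)"] by (simp_all add: norm_prod_def)

lemma base_point_\<E>: "(e3, base_point) \<in> \<E>" "(- e3, base_point) \<in> \<E>"
  using base_point_SU by (simp_all add: \<E>_iff cnj_vec_minus matrix_vec_minus)

lemma axial_base_point: "axial base_point = 2 *\<^sub>R e3"
  by (simp add: vec_eq_iff forall_3 e3_nth scaleR_conv_of_real)

lemma fibre_base_point:
  assumes "(w, base_point) \<in> \<E>"
  shows "w = e3 \<or> w = - e3"
proof -
  have "axial base_point \<noteq> 0" by (simp add: axial_base_point axis_eq_0_iff)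
  then obtain c :: real where c: "\<And>i. w $ i = c * cnj (axial base_point $ i)" "\<bar>c\<bar> * norm (axial base_point) = 1"
    using \<E>_axial[OF assms] by blast
  have "\<bar>c\<bar> = 1 / 2" using c(2) unfolding axial_base_point by simp
  then have "c = 1 / 2 \<or> c = - 1 / 2" by linarith
  then have "complex_of_real c = complex_of_real (1 / 2) \<or> complex_of_real c = complex_of_real (- 1 / 2)"
    unfolding of_real_eq_iff .
  moreover have "w $ 1 = 0" "w $ 2 = 0" "w $ 3 = complex_of_real c * 2"
    using c(1)[of 1] c(1)[of 2] c(1)[of 3] by simp_all
  ultimately show ?thesis by (auto simp: vec_eq_iff forall_3 e3_nth)
qed

lemma base_point_positive: "(e3, base_point) \<in> positive_part" "(- e3, base_point) \<notin> positive_part"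
  using base_point_\<E> by (simp_all add: positive_part_def sum_3 e3_nth)

lemma \<E>_projection_injective:
  assumes z: "z \<in> carrier (homology_group 8 (top_of_set \<E>))"
    and "hom_induced 8 (top_of_set \<E>) {} (top_of_set SU3) {} snd z = \<one>\<^bsub>homology_group 8 (top_of_set SU3)\<^esub>"
  shows "z = \<one>\<^bsub>homology_group 8 (top_of_set \<E>)\<^esub>"
proof -
  interpret sphere_bundle "top_of_set \<E>" fst e3 "- e3" \<E>_chart \<E>_chart' by (rule \<E>_bundle)
  let ?q = "(e3, base_point)"
  \<comment> \<open>The local isomorphism is available at points \<open>\<E>_chart (e3, s)\<close>;
    surjectivity of the chart onto the fibre supplies \<open>s\<close> without evaluating
    \<open>frame e3\<close>.\<close>
  obtain s where s: "s \<in> topspace S3" "?q = \<E>_chart (e3, s)"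
  proof -
    have "?q \<in> {x \<in> topspace (top_of_set \<E>). fst x = e3}" using base_point_\<E> by simp
    then show ?thesis using that unfolding k_fibre[symmetric] by blast
  qed
  have open_sub: "subtopology (top_of_set \<E>) positive_part = top_of_set positive_part"
      "subtopology (top_of_set SU3) (snd ` positive_part) = top_of_set asymmetric"
    unfolding snd_positive_part(1)
    by (auto simp: subtopology_subtopology positive_part_def asymmetric_def intro!: arg_cong[of _ _ top_of_set])
  show ?thesis
  proof (rule two_to_one_injective[where P = snd and \<iota> = involution and ?q1.0 = ?q and ?q2.0 = "(- e3, base_point)"
        and U = positive_part, OF _ _ _ _ _ involution_continuous _ _ _ _ positive_part_open base_point_positive _ _ _ _ _ assms])
    show "closedin (top_of_set \<E>) {?q}" "closedin (top_of_set \<E>) {(- e3, base_point)}"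
      using base_point_\<E> by simp_all
    show "?q \<noteq> (- e3, base_point)" using e3_sphere(3) by simp
    show "continuous_map (top_of_set \<E>) (top_of_set SU3) snd"
      by (auto simp: \<E>_iff intro!: continuous_intros)
    show "closedin (top_of_set SU3) {snd ?q}" using base_point_SU by simp
    show "involution ?q = (- e3, base_point)" by (simp add: involution_def)
    show "involution (involution x) = x" "snd (involution x) = snd x" for x
      by (cases x; simp add: involution_def)+
    show "x = ?q \<or> x = (- e3, base_point)" if "x \<in> topspace (top_of_set \<E>)" "snd x = snd ?q" for x
      using that fibre_base_point by (cases x) auto
    show "openin (top_of_set SU3) (snd ` positive_part)"
      unfolding snd_positive_part(1) by (rule asymmetric_open)
    show "homeomorphic_map (subtopology (top_of_set \<E>) positive_part) (subtopology (top_of_set SU3) (snd ` positive_part)) snd"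
      unfolding open_sub by (rule snd_positive_part(2))
    show "hom_induced 8 (top_of_set \<E>) {} (top_of_set \<E>) {} involution z = z"
      if "z \<in> carrier (homology_group 8 (top_of_set \<E>))" for z
      by (rule involution_degree[OF that])
    show "hom_induced 8 (top_of_set \<E>) {} (top_of_set \<E>) (topspace (top_of_set \<E>) - {?q}) id
        \<in> iso (homology_group 8 (top_of_set \<E>)) (local_homology 8 (top_of_set \<E>) {?q})"
      unfolding s(2) by (rule local_degree_iso[OF s(1)])
    fix z assume z: "z \<in> carrier (homology_group 8 (top_of_set \<E>))"
      and zz: "z \<otimes>\<^bsub>homology_group 8 (top_of_set \<E>)\<^esub> z = \<one>\<^bsub>homology_group 8 (top_of_set \<E>)\<^esub>"
    interpret H: comm_group "homology_group 8 (top_of_set \<E>)" by simp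
    have "z [^]\<^bsub>homology_group 8 (top_of_set \<E>)\<^esub> (2::int) = \<one>\<^bsub>homology_group 8 (top_of_set \<E>)\<^esub>"
      using H.int_pow_mult[OF z, of 1 1] z zz by simp
    then show "z = \<one>\<^bsub>homology_group 8 (top_of_set \<E>)\<^esub>"
      using infinite_cyclic_pow_eq_one[OF H.is_group top_homology z] by fastforce
  qed
qed

theorem lemma4p1:
  fixes k :: int
  assumes "odd k"
  shows "\<exists>\<psi> :: complex ^ 3 ^ 3 \<Rightarrow> complex ^ 3 ^ 3.
           continuous_map (top_of_set SU3) (top_of_set SU3) \<psi> \<and>
           has_degree 8 (top_of_set SU3) \<psi> k \<and>
           (\<forall>A\<in>SU3. \<forall>B\<in>SU3. \<psi> (A ** B ** transpose A) = A ** \<psi> B ** transpose A)"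
proof (intro exI[of _ "psi k"] conjI ballI)
  let ?E = "top_of_set \<E>" and ?M = "top_of_set SU3"
  show cont: "continuous_map ?M ?M (psi k)"
    using continuous_on_psi psi_SU by auto
  show "psi k (A ** B ** transpose A) = A ** psi k B ** transpose A" if "A \<in> SU3" for A B
    by (rule psi_equivariant[OF that])
  interpret sphere_bundle ?E fst e3 "- e3" \<E>_chart \<E>_chart' by (rule \<E>_bundle)
  interpret P: group_hom "homology_group 8 ?E" "homology_group 8 ?M" "hom_induced 8 ?E {} ?M {} snd"
    by (simp add: group_hom_def group_hom_axioms_def hom_induced_hom)
  have cP: "continuous_map ?E ?M snd" by (auto simp: \<E>_iff intro!: continuous_intros)
  \<comment> \<open>Any nontrivial class of H_8 upstairs will do: its image stays nontrivial and is
    sent to its k-th power, because the projection intertwines \<open>\<E>_psi k\<close> with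
    \<open>psi k\<close>.\<close>
  have "\<not> trivial_group (homology_group 8 ?E)"
    using isomorphic_group_triviality[OF top_homology] by simp
  then obtain z where z: "z \<in> carrier (homology_group 8 ?E)" "z \<noteq> \<one>\<^bsub>homology_group 8 ?E\<^esub>"
    using P.G.trivial_group_subset by blast
  let ?y = "hom_induced 8 ?E {} ?M {} snd z"
  have "hom_induced 8 ?M {} ?M {} (psi k) ?y = hom_induced 8 ?E {} ?M {} (psi k \<circ> snd) z"
    by (rule hom_induced_compose'[OF cP _ cont]) auto
  also have "psi k \<circ> snd = snd \<circ> \<E>_psi k" by (auto simp: \<E>_psi_def)
  also have "hom_induced 8 ?E {} ?M {} (snd \<circ> \<E>_psi k) z = hom_induced 8 ?E {} ?M {} snd (hom_induced 8 ?E {} ?E {} (\<E>_psi k) z)"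
    by (rule hom_induced_compose'[OF \<E>_psi_continuous _ cP, symmetric]) auto
  also have "\<dots> = ?y [^]\<^bsub>homology_group 8 ?M\<^esub> k"
    unfolding \<E>_psi_degree[OF assms z(1)] by (rule P.hom_int_pow[OF z(1)])
  finally have deg: "hom_induced 8 ?M {} ?M {} (psi k) ?y = ?y [^]\<^bsub>homology_group 8 ?M\<^esub> k" .
  moreover have "?y \<in> carrier (homology_group 8 ?M)" by (rule hom_induced_carrier)
  moreover have "?y \<noteq> \<one>\<^bsub>homology_group 8 ?M\<^esub>"
    using \<E>_projection_injective[OF z(1)] z(2) by blast
  ultimately show "has_degree 8 ?M (psi k) k"
    using has_degree_of_nontrivial_class[of 8 ?M "psi k" ?y k] top_homology_SU3 cont by simp
qed

end
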